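(* Let $A,J,E_c,E_d\in\mathbb{R}^{n\times n}$ and $\bar T>0$. Consider the stochastic impulsive system $$dx(t)=Ax(t)\,dt+E_cx(t)\,dW_1(t),\ t\neq t_k,\qquad x(t_k^+)=Jx(t_k)+E_dx(t_k)\nu_1(k),\ k\in\mathbb{N},\qquad x(0)=x_0 .$$ The following statements are equivalent: (i) There exists $P\in\mathbb{S}^n_{\succ0}$ such that $$\mathbb{E}[J^T\Xi_P(\theta)J+E_d^T\Xi_P(\theta)E_d]-P\prec0\quad\text{and}\quad A^TP+PA+E_c^TPE_c\prec0$$ hold for all $\theta\ge\bar T$. (ii) There exists $P\in\mathbb{S}^n_{\succ0}$ such that $$\mathbb{E}[J^T\Xi_P(\bar T)J+E_d^T\Xi_P(\bar T)E_d]-P\prec0\quad\text{and}\quad A^TP+PA+E_c^TPE_c\prec0 .$$ (iii) There exist a matrix-valued function $S:\mathbb{R}_{\ge0}\to\mathbb{S}^n$ with $S(\bar T)\succ0$ and $S(\bar T+s)=S(\bar T)$ for all $s\ge0$, and a scalar $\varepsilon>0$ such that $$A^TS(\bar T)+S(\bar T)A+E_c^TS(\bar T)E_c\prec0,$$ $$\dot S(\tau)+A^TS(\tau)+S(\tau)A+E_c^TS(\tau)E_c\preceq0\quad\text{and}\quad J^TS(0)J-S(\bar T)+E_d^TS(0)E_d+\varepsilon I\preceq0$$ hold for all $\tau\in[0,\bar T]$. Moreover, when one of these equivalent statements holds, the system is mean-square asymptotically stable under minimum dwell-time $\bar T$, that is, for any sequence of impulse times verifying $T_k=t_{k+1}-t_k\ge\bar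 T$ for all $k\in\mathbb{N}_0$ (with $t_0=0$).
   Context: $\mathbb{S}^n$ is the set of real symmetric $n\times n$ matrices and $\mathbb{S}^n_{\succ0}$ the positive definite ones; $\prec,\preceq,\succ,\succeq$ refer to the (semi)definite order. Setting: $x(t)\in\mathbb{R}^n$, $x_0\in\mathbb{R}^n$; trajectories are left-continuous and $x(t^+):=\lim_{s\downarrow t}x(s)$. The impulse instants $\{t_k\}_{k\in\mathbb{N}}$ are deterministic, $t_0=0$ (no jump occurs at $t_0$), $T_k:=t_{k+1}-t_k$ for $k\in\mathbb{N}_0=\{0,1,2,\dots\}$, $\mathbb{N}=\{1,2,\dots\}$. $W_1$ is a standard scalar Wiener process and the stochastic differential equation is in the Itô sense. $\{\nu_1(k)\}_k$ is a sequence of i.i.d. scalar random variables with zero mean and unit variance, $\nu_1(k)$ being independent of $x(t_k)$; the sequence $\{\nu_1(k)\}$ and the process $W_1$ are independent. The system is mean-square asymptotically stable (for a given sequence of impulse times) if $\mathbb{E}[\|x(t)\|_2^2]\to0$ as $t\to\infty$ (for every $x_0\in\mathbb{R}^n$). $\Phi(t)\in\mathbb{R}^{n\times n}$, $t\ge0$, is the random fundamental solution defined by $d\Phi(t)=A\Phi(t)dt+E_c\Phi(t)dW_1(t)$, $\Phi(0)=I$, and for $Z\in\mathbb{S}^n$, $\Xi_Z(s):=\Phi(s)^TZ\Phi(s)$, $s\ge0$. The restriction of $S$ to $[0,\bar T]$ is differentiable, with $\dot S=dS/d\tau$ understood as the one-sided derivative of this restriction at the endpoints $0$ and $\bar T$.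 *)

theory Defs
  imports "HOL-Probability.Probability"
begin

definition pos_def :: "real^'n^'n \<Rightarrow> bool" where
  "pos_def X \<longleftrightarrow> transpose X = X \<and> (\<forall>v. v \<noteq> 0 \<longrightarrow> 0 < v \<bullet> (X *v v))"

definition pos_semidef :: "real^'n^'n \<Rightarrow> bool" where
  "pos_semidef X \<longleftrightarrow> transpose X = X \<and> (\<forall>v. 0 \<le> v \<bullet> (X *v v))"

definition loewner_less :: "real^'n^'n \<Rightarrow> real^'n^'n \<Rightarrow> bool" (infix "\<prec>\<^sub>L" 50) where
  "X \<prec>\<^sub>L Y \<longleftrightarrow> pos_def (Y - X)"

definition loewner_le :: "real^'n^'n \<Rightarrow> real^'n^'n \<Rightarrow> bool" (infix "\<preceq>\<^sub>L" 50) where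
  "X \<preceq>\<^sub>L Y \<longleftrightarrow> pos_semidef (Y - X)"

text \<open>
  Like the library's \<open>indep_var\<close>, but for two random variables with values in different types.
\<close>

definition independent_rvs ::
    "'a measure \<Rightarrow> 'b measure \<Rightarrow> ('a \<Rightarrow> 'b) \<Rightarrow> 'c measure \<Rightarrow> ('a \<Rightarrow> 'c) \<Rightarrow> bool" where
  "independent_rvs M S X T Y \<longleftrightarrow>
     X \<in> measurable M S \<and> Y \<in> measurable M T \<and>
     prob_space.indep_set M (sets (vimage_algebra (space M) X S))
       (sets (vimage_algebra (space M) Y T))"

text \<open>
  Standard scalar Wiener process with respect to a filtration. Only the values at nonnegative
  times matter; the type real is used as time index because the library's filtrations are
  indexed by whole types.
\<close>

definition wiener_process :: "'a measure \<Rightarrow> (real \<Rightarrow> 'a measure) \<Rightarrow> (real \<Rightarrow> 'a \<Rightarrow> real) \<Rightarrow> bool" where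
  "wiener_process M F W \<longleftrightarrow>
     (\<forall>s\<ge>0. W s \<in> borel_measurable (F s)) \<and>
     (AE \<omega> in M. W 0 \<omega> = 0) \<and>
     (AE \<omega> in M. continuous_on {0..} (\<lambda>s. W s \<omega>)) \<and>
     (\<forall>s\<ge>0. \<forall>u>s.
        distributed M lborel (\<lambda>\<omega>. W u \<omega> - W s \<omega>) (normal_density 0 (sqrt (u - s))) \<and>
        prob_space.indep_set M (sets (F s))
          (sets (vimage_algebra (space M) (\<lambda>\<omega>. W u \<omega> - W s \<omega>) borel)))"

text \<open>
  Convergence in probability. Measurability is part of the notion: the measure of a
  non-measurable set is 0, so without it the last conjunct could hold vacuously.
\<close>

definition tendsto_in_prob ::
    "'a measure \<Rightarrow> (nat \<Rightarrow> 'a \<Rightarrow> 'b::euclidean_space) \<Rightarrow> ('a \<Rightarrow> 'b) \<Rightarrow> bool" where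
  "tendsto_in_prob M X Y \<longleftrightarrow>
     (\<forall>m. X m \<in> borel_measurable M) \<and> Y \<in> borel_measurable M \<and>
     (\<forall>e>0. (\<lambda>m. measure M {\<omega> \<in> space M. e \<le> dist (X m \<omega>) (Y \<omega>)}) \<longlonglongrightarrow> 0)"

text \<open>
  The simple process on \<open>{a<..b}\<close> with partition \<open>a = p 0 \<le> \<dots> \<le> p N = b\<close> has the value
  \<open>\<xi> i\<close>, which is bounded and known at time \<open>p i\<close>, on \<open>{p i<..p (Suc i)}\<close>.
\<close>

definition simple_process ::
    "(real \<Rightarrow> 'a measure) \<Rightarrow> real \<Rightarrow> real \<Rightarrow> nat \<Rightarrow> (nat \<Rightarrow> real) \<Rightarrow>
     (nat \<Rightarrow> 'a \<Rightarrow> 'b::euclidean_space) \<Rightarrow> bool" where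
  "simple_process F a b N p \<xi> \<longleftrightarrow>
     p 0 = a \<and> p N = b \<and> (\<forall>i<N. p i \<le> p (Suc i)) \<and>
     (\<forall>i<N. \<xi> i \<in> borel_measurable (F (p i)) \<and>
        (\<exists>C. \<forall>\<omega>\<in>space (F (p i)). norm (\<xi> i \<omega>) \<le> C))"

definition simple_value ::
    "nat \<Rightarrow> (nat \<Rightarrow> real) \<Rightarrow> (nat \<Rightarrow> 'a \<Rightarrow> 'b::euclidean_space) \<Rightarrow> real \<Rightarrow> 'a \<Rightarrow> 'b" where
  "simple_value N p \<xi> s \<omega> = (\<Sum>i<N. indicator {p i<..p (Suc i)} s *\<^sub>R \<xi> i \<omega>)"

definition simple_ito_integral ::
    "(real \<Rightarrow> 'a \<Rightarrow> real) \<Rightarrow> nat \<Rightarrow> (nat \<Rightarrow> real) \<Rightarrow>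
     (nat \<Rightarrow> 'a \<Rightarrow> 'b::euclidean_space) \<Rightarrow> 'a \<Rightarrow> 'b" where
  "simple_ito_integral W N p \<xi> \<omega> = (\<Sum>i<N. (W (p (Suc i)) \<omega> - W (p i) \<omega>) *\<^sub>R \<xi> i \<omega>)"

text \<open>
  \<open>I\<close> is (a version of) the Ito integral of \<open>H\<close> against \<open>W\<close> over \<open>{a<..b}\<close>, for adapted
  measurable integrands whose paths are almost surely square integrable: \<open>H\<close> is approximated
  by simple processes, with the time integral of the squared error and the error of the
  stochastic integrals both tending to 0 in probability.
  The values of \<open>H\<close> may be vectors or matrices (with their Frobenius norm).
\<close>

definition is_ito_integral ::
    "'a measure \<Rightarrow> (real \<Rightarrow> 'a measure) \<Rightarrow> (real \<Rightarrow> 'a \<Rightarrow> real) \<Rightarrow> real \<Rightarrow> real \<Rightarrow>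
     (real \<Rightarrow> 'a \<Rightarrow> 'b::euclidean_space) \<Rightarrow> ('a \<Rightarrow> 'b) \<Rightarrow> bool" where
  "is_ito_integral M F W a b H I \<longleftrightarrow>
     (\<forall>s\<in>{a<..b}. H s \<in> borel_measurable (F s)) \<and>
     (\<lambda>(s, \<omega>). H s \<omega>) \<in> borel_measurable (restrict_space borel {a<..b} \<Otimes>\<^sub>M M) \<and>
     (AE \<omega> in M. set_integrable lborel {a<..b} (\<lambda>s. (norm (H s \<omega>))\<^sup>2)) \<and>
     (\<exists>N p \<xi>. (\<forall>m. simple_process F a b (N m) (p m) (\<xi> m)) \<and>
        tendsto_in_prob M
          (\<lambda>m \<omega>. LINT s:{a<..b}|lborel. (norm (simple_value (N m) (p m) (\<xi> m) s \<omega> - H s \<omega>))\<^sup>2)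
          (\<lambda>_. 0) \<and>
        tendsto_in_prob M (\<lambda>m. simple_ito_integral W (N m) (p m) (\<xi> m)) I)"

text \<open>
  \<open>X\<close> solves \<open>dX = f(X) dt + g(X) dW\<close> on \<open>{a<..b}\<close> with initial value \<open>X(a+) = \<xi>\<close>.
  Nothing is said about \<open>X a\<close>, which differs from \<open>X(a+)\<close> when \<open>X\<close> is left-continuous and
  jumps at \<open>a\<close>.
\<close>

definition ito_sde_on ::
    "'a measure \<Rightarrow> (real \<Rightarrow> 'a measure) \<Rightarrow> (real \<Rightarrow> 'a \<Rightarrow> real) \<Rightarrow>
     ('b::euclidean_space \<Rightarrow> 'b) \<Rightarrow> ('b \<Rightarrow> 'b) \<Rightarrow> real \<Rightarrow> real \<Rightarrow> ('a \<Rightarrow> 'b) \<Rightarrow>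
     (real \<Rightarrow> 'a \<Rightarrow> 'b) \<Rightarrow> bool" where
  "ito_sde_on M F W f g a b \<xi> X \<longleftrightarrow>
     (\<forall>s\<in>{a<..b}. X s \<in> borel_measurable (F s)) \<and>
     (\<forall>\<omega>\<in>space M. continuous_on {a<..b} (\<lambda>s. X s \<omega>) \<and>
        (\<exists>l. ((\<lambda>s. X s \<omega>) \<longlongrightarrow> l) (at_right a))) \<and>
     (AE \<omega> in M. ((\<lambda>s. X s \<omega>) \<longlongrightarrow> \<xi> \<omega>) (at_right a)) \<and>
     (\<forall>s\<in>{a<..b}. \<exists>I. is_ito_integral M F W a s (\<lambda>u \<omega>. g (X u \<omega>)) I \<and>
        (AE \<omega> in M. X s \<omega> = \<xi> \<omega> + (LINT u:{a<..s}|lborel. f (X u \<omega>)) + I \<omega>))"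

definition fundamental_solution ::
    "'a measure \<Rightarrow> (real \<Rightarrow> 'a measure) \<Rightarrow> (real \<Rightarrow> 'a \<Rightarrow> real) \<Rightarrow>
     real^'n^'n \<Rightarrow> real^'n^'n \<Rightarrow> (real \<Rightarrow> 'a \<Rightarrow> real^'n^'n) \<Rightarrow> bool" where
  "fundamental_solution M F W A Ec \<Phi> \<longleftrightarrow>
     (\<forall>\<omega>\<in>space M. \<Phi> 0 \<omega> = mat 1) \<and>
     (\<forall>b>0. ito_sde_on M F W (\<lambda>X. A ** X) (\<lambda>X. Ec ** X) 0 b (\<lambda>_. mat 1) \<Phi>)"

definition Xi :: "(real \<Rightarrow> 'a \<Rightarrow> real^'n^'n) \<Rightarrow> real^'n^'n \<Rightarrow> real \<Rightarrow> 'a \<Rightarrow> real^'n^'n" where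
  "Xi \<Phi> Z s \<omega> = transpose (\<Phi> s \<omega>) ** Z ** \<Phi> s \<omega>"

text \<open>The index set of the sequence \<open>\<nu>\<close> is \<open>{1..}\<close>; \<open>\<nu> 0\<close> plays no role.\<close>

definition iid_standardized :: "'a measure \<Rightarrow> (nat \<Rightarrow> 'a \<Rightarrow> real) \<Rightarrow> bool" where
  "iid_standardized M \<nu> \<longleftrightarrow>
     prob_space.indep_vars M (\<lambda>_. borel) \<nu> {1..} \<and>
     (\<forall>k\<ge>1. distr M borel (\<nu> k) = distr M borel (\<nu> 1) \<and>
        integrable M (\<nu> k) \<and> integrable M (\<lambda>\<omega>. (\<nu> k \<omega>)\<^sup>2) \<and>
        prob_space.expectation M (\<nu> k) = 0 \<and> prob_space.variance M (\<nu> k) = 1)"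

definition independent_processes ::
    "'a measure \<Rightarrow> (nat \<Rightarrow> 'a \<Rightarrow> real) \<Rightarrow> (real \<Rightarrow> 'a \<Rightarrow> real) \<Rightarrow> bool" where
  "independent_processes M \<nu> W \<longleftrightarrow>
     independent_rvs M
       (\<Pi>\<^sub>M k\<in>{1..}. borel) (\<lambda>\<omega>. \<lambda>k\<in>{1..}. \<nu> k \<omega>)
       (\<Pi>\<^sub>M s\<in>{0..}. borel) (\<lambda>\<omega>. \<lambda>s\<in>{0..}. W s \<omega>)"

text \<open>
  Trajectories are continuous on each \<open>{t k<..t (Suc k)}\<close>, hence left-continuous, and the
  right limit at \<open>t k\<close> is the value after the jump; there is no jump at \<open>t 0 = 0\<close>.
\<close>

definition impulsive_solution ::
    "'a measure \<Rightarrow> (real \<Rightarrow> 'a measure) \<Rightarrow> (real \<Rightarrow> 'a \<Rightarrow> real) \<Rightarrow> (nat \<Rightarrow> 'a \<Rightarrow> real) \<Rightarrow>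
     real^'n^'n \<Rightarrow> real^'n^'n \<Rightarrow> real^'n^'n \<Rightarrow> real^'n^'n \<Rightarrow> (nat \<Rightarrow> real) \<Rightarrow> real^'n \<Rightarrow>
     (real \<Rightarrow> 'a \<Rightarrow> real^'n) \<Rightarrow> bool" where
  "impulsive_solution M F W \<nu> A J Ec Ed t x0 x \<longleftrightarrow>
     (\<forall>\<omega>\<in>space M. x 0 \<omega> = x0) \<and>
     (\<forall>k\<ge>1. independent_rvs M borel (\<nu> k) borel (x (t k))) \<and>
     (\<forall>k. ito_sde_on M F W (\<lambda>v. A *v v) (\<lambda>v. Ec *v v) (t k) (t (Suc k))
        (\<lambda>\<omega>. if k = 0 then x0 else J *v x (t k) \<omega> + \<nu> k \<omega> *\<^sub>R (Ed *v x (t k) \<omega>)) x)"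

text \<open>
  The second moment is taken as a nonnegative integral, so that an infinite second moment is
  not mistaken for 0.
\<close>

definition ms_asymp_stable ::
    "'a measure \<Rightarrow> (real \<Rightarrow> 'a measure) \<Rightarrow> (real \<Rightarrow> 'a \<Rightarrow> real) \<Rightarrow> (nat \<Rightarrow> 'a \<Rightarrow> real) \<Rightarrow>
     real^'n^'n \<Rightarrow> real^'n^'n \<Rightarrow> real^'n^'n \<Rightarrow> real^'n^'n \<Rightarrow> (nat \<Rightarrow> real) \<Rightarrow> bool" where
  "ms_asymp_stable M F W \<nu> A J Ec Ed t \<longleftrightarrow>
     (\<forall>x0 x. impulsive_solution M F W \<nu> A J Ec Ed t x0 x \<longrightarrow>
        ((\<lambda>s. \<integral>\<^sup>+\<omega>. ennreal ((norm (x s \<omega>))\<^sup>2) \<partial>M) \<longlongrightarrow> 0) at_top)"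

definition theta_condition ::
    "'a measure \<Rightarrow> (real \<Rightarrow> 'a \<Rightarrow> real^'n^'n) \<Rightarrow> real^'n^'n \<Rightarrow> real^'n^'n \<Rightarrow> real^'n^'n \<Rightarrow>
     real^'n^'n \<Rightarrow> real^'n^'n \<Rightarrow> real \<Rightarrow> bool" where
  "theta_condition M \<Phi> A J Ec Ed P \<theta> \<longleftrightarrow>
     prob_space.expectation M (\<lambda>\<omega>. transpose J ** Xi \<Phi> P \<theta> \<omega> ** J
       + transpose Ed ** Xi \<Phi> P \<theta> \<omega> ** Ed) - P \<prec>\<^sub>L 0 \<and>
     transpose A ** P + P ** A + transpose Ec ** P ** Ec \<prec>\<^sub>L 0"

definition clock_condition ::
    "real^'n^'n \<Rightarrow> real^'n^'n \<Rightarrow> real^'n^'n \<Rightarrow> real^'n^'n \<Rightarrow> real \<Rightarrow>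
     (real \<Rightarrow> real^'n^'n) \<Rightarrow> real \<Rightarrow> bool" where
  "clock_condition A J Ec Ed Tbar S \<epsilon> \<longleftrightarrow>
     transpose A ** S Tbar + S Tbar ** A + transpose Ec ** S Tbar ** Ec \<prec>\<^sub>L 0 \<and>
     (\<exists>S'. \<forall>\<tau>\<in>{0..Tbar}.
        (S has_vector_derivative S' \<tau>) (at \<tau> within {0..Tbar}) \<and>
        S' \<tau> + transpose A ** S \<tau> + S \<tau> ** A + transpose Ec ** S \<tau> ** Ec \<preceq>\<^sub>L 0 \<and>
        transpose J ** S 0 ** J - S Tbar + transpose Ed ** S 0 ** Ed + \<epsilon> *\<^sub>R mat 1 \<preceq>\<^sub>L 0)"

end

theory Submission
  imports Defs
begin

text \<open>
  Write \<open>L Z = A\<^sup>T Z + Z A + Ec\<^sup>T Z Ec\<close> and \<open>N s Z = E[\<Xi>\<^sub>Z(s)]\<close>. Everything follows from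
  \<open>d/ds N s Z = N s (L Z)\<close>, from the fact that \<open>N s\<close> commutes with \<open>L\<close>, and from
  \<open>E[x(t\<^sub>k + s)\<^sup>T Z x(t\<^sub>k + s)] = E[x(t\<^sub>k\<^sup>+)\<^sup>T (N s Z) x(t\<^sub>k\<^sup>+)]\<close>. If \<open>L P\<close> is negative then \<open>N s P\<close>
  decreases in \<open>s\<close>, which gives (i) from (ii); (iii) follows from (ii) with \<open>S \<tau> = N (Tbar - \<tau>) P\<close>, and
  (ii) from (iii) because \<open>N \<tau> (S \<tau>)\<close> decreases in \<open>\<tau>\<close>; finally \<open>E[x\<^sup>T P x]\<close> contracts by a fixed factor
  from one impulse to the next.

  The moment equation is obtained without Ito's formula. Simple processes stopped at a bounded energy
  together with Fatou's lemma give \<open>E|Y + I|\<^sup>2 \<le> E|Y|\<^sup>2 + 2 E \<integral>|H|\<^sup>2\<close> for the Ito integral \<open>I\<close> of \<open>H\<close> over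
  \<open>{u<..v}\<close> and \<open>Y\<close> known at time \<open>u\<close>. Replacing \<open>Y\<close> by its multiples shows that \<open>I\<close> is orthogonal to \<open>Y\<close>;
  a version localized to the event that the solution is bounded gives finite second moments by
  Gronwall's argument; and the integrand \<open>g (X s) - g (X u)\<close> shows that, with \<open>h = v - u\<close>, the increment
  \<open>X v - X u\<close> is \<open>h f (X u) + (W v - W u) g (X u)\<close> up to terms that change second moments by \<open>O(h\<^sup>3\<^sup>/\<^sup>2)\<close>.
\<close>

section \<open>Square integrable random variables and simple processes\<close>

text \<open>The definition of the Ito integral offers convergence in probability only: neither the
  integral nor the solution is known to have a second moment. A second obstacle is the start of each
  interval. The value after an impulse contains \<open>\<nu> k\<close>, which the filtration need
  not know at time \<open>t k\<close>, so no conditioning at that time is available. Expansions are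
  therefore made at times strictly inside an interval, where the solution is adapted, and reach the
  left end by continuity of the second moments. The factor 2 in the moment bound comes from
  comparing squares of approximations by \<open>(x + y)^2 \<le> 2 * x^2 + 2 * y^2\<close>. It is
  harmless, because the bound serves only for orders of magnitude and for orthogonality, where it
  competes with arbitrarily large multiples of \<open>Y\<close>. Finally, trajectories are never
  written as \<open>\<Phi>\<close> applied to their initial value, which would call for uniqueness
  of solutions; the moments of the two equations are matched by duality instead.\<close>

definition sq_integrable :: "'a measure \<Rightarrow> ('a \<Rightarrow> 'b::euclidean_space) \<Rightarrow> bool" where
  "sq_integrable M X \<longleftrightarrow> X \<in> borel_measurable M \<and> integrable M (\<lambda>\<omega>. (norm (X \<omega>))\<^sup>2)"

lemma norm_add_sq_le: "(norm (x + y :: 'b::real_normed_vector))\<^sup>2 \<le> 2 * (norm x)\<^sup>2 + 2 * (norm y)\<^sup>2"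
proof -
  have "(norm (x + y))\<^sup>2 \<le> (norm x + norm y)\<^sup>2"
    by (intro power_mono norm_triangle_ineq) auto
  also have "\<dots> \<le> 2 * (norm x)\<^sup>2 + 2 * (norm y)\<^sup>2"
    using sum_squares_bound[of "norm x" "norm y"] by (simp add: power2_sum)
  finally show ?thesis .
qed

lemma norm_mult_le_AM_GM: "norm x * norm y \<le> (norm (x::'b::real_normed_vector))\<^sup>2 + (norm (y::'c::real_normed_vector))\<^sup>2"
proof -
  have "0 \<le> norm x * norm y" by simp
  then show ?thesis using sum_squares_bound[of "norm x" "norm y"] by linarith
qed

lemma sq_integrable_linear_bound:
  fixes X :: "'a \<Rightarrow> 'b::euclidean_space" and Y :: "'a \<Rightarrow> 'c::euclidean_space"
  assumes "sq_integrable M X" "Y \<in> borel_measurable M" "AE \<omega> in M. norm (Y \<omega>) \<le> c * norm (X \<omega>)"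
  shows "sq_integrable M Y"
  unfolding sq_integrable_def
proof (rule conjI[OF assms(2)], rule Bochner_Integration.integrable_bound[where f = "\<lambda>\<omega>. c\<^sup>2 * (norm (X \<omega>))\<^sup>2"])
  show "integrable M (\<lambda>\<omega>. c\<^sup>2 * (norm (X \<omega>))\<^sup>2)"
    using assms(1) by (simp add: sq_integrable_def)
  show "(\<lambda>\<omega>. (norm (Y \<omega>))\<^sup>2) \<in> borel_measurable M"
    using assms(2) by measurable
  show "AE \<omega> in M. norm ((norm (Y \<omega>))\<^sup>2) \<le> norm (c\<^sup>2 * (norm (X \<omega>))\<^sup>2)"
    using assms(3)
  proof eventually_elim
    case (elim \<omega>)
    then have "(norm (Y \<omega>))\<^sup>2 \<le> (c * norm (X \<omega>))\<^sup>2" by (intro power_mono) auto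
    then show ?case by (simp add: power_mult_distrib)
  qed
qed

lemma sq_integrable_add:
  assumes "sq_integrable M X" "sq_integrable M Y"
  shows "sq_integrable M (\<lambda>\<omega>. X \<omega> + Y \<omega>)"
  unfolding sq_integrable_def
proof (rule conjI, goal_cases)
  have [measurable]: "X \<in> borel_measurable M" "Y \<in> borel_measurable M"
    using assms by (auto simp: sq_integrable_def)
  case 1
  show ?case by measurable
next
  have [measurable]: "X \<in> borel_measurable M" "Y \<in> borel_measurable M"
    using assms by (auto simp: sq_integrable_def)
  case 2
  show ?case
  proof (rule Bochner_Integration.integrable_bound[where f = "\<lambda>\<omega>. 2 * (norm (X \<omega>))\<^sup>2 + 2 * (norm (Y \<omega>))\<^sup>2"])
  show "(\<lambda>\<omega>. (norm (X \<omega> + Y \<omega>))\<^sup>2) \<in> borel_measurable M" by measurable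
  show "AE \<omega> in M. norm ((norm (X \<omega> + Y \<omega>))\<^sup>2) \<le> norm (2 * (norm (X \<omega>))\<^sup>2 + 2 * (norm (Y \<omega>))\<^sup>2)"
    using norm_add_sq_le by auto
  qed (use assms in \<open>auto simp: sq_integrable_def\<close>)
qed

lemma sq_integrable_scaleR:
  "sq_integrable M X \<Longrightarrow> sq_integrable M (\<lambda>\<omega>. c *\<^sub>R X \<omega>)"
  by (rule sq_integrable_linear_bound[where c = "\<bar>c\<bar>"]) (auto simp: sq_integrable_def)

lemma sq_integrable_diff:
  assumes "sq_integrable M X" "sq_integrable M Y"
  shows "sq_integrable M (\<lambda>\<omega>. X \<omega> - Y \<omega>)"
  using sq_integrable_add[OF assms(1) sq_integrable_scaleR[OF assms(2), of "-1"]] by simp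

lemma sq_integrable_bounded_linear:
  assumes "sq_integrable M X" "bounded_linear f"
  shows "sq_integrable M (\<lambda>\<omega>. f (X \<omega>))"
proof -
  have [measurable]: "f \<in> borel_measurable borel"
    by (intro borel_measurable_continuous_onI linear_continuous_on assms(2))
  have "X \<in> borel_measurable M" using assms(1) by (simp add: sq_integrable_def)
  moreover obtain K where "\<And>x. norm (f x) \<le> norm x * K"
    using bounded_linear.bounded[OF assms(2)] by blast
  ultimately show ?thesis
    by (intro sq_integrable_linear_bound[OF assms(1), where c = K]) (auto simp: mult.commute)
qed

lemma integrable_bilinear_sq_integrable:
  fixes B :: "'b::euclidean_space \<Rightarrow> 'c::euclidean_space \<Rightarrow> 'd::euclidean_space"
  assumes "sq_integrable M X" "sq_integrable M Y" "bounded_bilinear B"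
  shows "integrable M (\<lambda>\<omega>. B (X \<omega>) (Y \<omega>))"
proof -
  obtain K where K: "\<And>x y. norm (B x y) \<le> norm x * norm y * K" "K \<ge> 0"
    using bounded_bilinear.nonneg_bounded[OF assms(3)] by blast
  have "continuous_on UNIV (\<lambda>z. B (fst z) (snd z))"
    by (intro bounded_bilinear.continuous_on[OF assms(3)] continuous_intros)
  then have [measurable]: "(\<lambda>z. B (fst z) (snd z)) \<in> borel_measurable borel"
    by (rule borel_measurable_continuous_onI)
  have [measurable]: "X \<in> borel_measurable M" "Y \<in> borel_measurable M"
    using assms by (auto simp: sq_integrable_def)
  have "(\<lambda>\<omega>. (\<lambda>z. B (fst z) (snd z)) (X \<omega>, Y \<omega>)) \<in> borel_measurable M"
    by measurable
  then have m: "(\<lambda>\<omega>. B (X \<omega>) (Y \<omega>)) \<in> borel_measurable M" by simp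
  show ?thesis
  proof (rule Bochner_Integration.integrable_bound[where f = "\<lambda>\<omega>. K * ((norm (X \<omega>))\<^sup>2 + (norm (Y \<omega>))\<^sup>2)", OF _ m])
    show "integrable M (\<lambda>\<omega>. K * ((norm (X \<omega>))\<^sup>2 + (norm (Y \<omega>))\<^sup>2))"
      using assms by (auto simp: sq_integrable_def)
    have "norm (B x y) \<le> K * ((norm x)\<^sup>2 + (norm y)\<^sup>2)" for x y
      using order_trans[OF K(1) mult_right_mono[OF norm_mult_le_AM_GM K(2)]] by (simp add: mult.commute)
    then show "AE \<omega> in M. norm (B (X \<omega>) (Y \<omega>)) \<le> norm (K * ((norm (X \<omega>))\<^sup>2 + (norm (Y \<omega>))\<^sup>2))"
      using K(2) by simp
  qed
qed

lemma integrable_inner_sq_integrable: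
  "sq_integrable M X \<Longrightarrow> sq_integrable M Y \<Longrightarrow> integrable M (\<lambda>\<omega>. X \<omega> \<bullet> Y \<omega>)"
  by (rule integrable_bilinear_sq_integrable[OF _ _ bounded_bilinear_inner])

lemma sq_integrableI_bounded:
  assumes "finite_measure M" "X \<in> borel_measurable M" "\<And>\<omega>. \<omega> \<in> space M \<Longrightarrow> norm (X \<omega>) \<le> C"
  shows "sq_integrable M X"
  unfolding sq_integrable_def
proof (intro conjI assms(2) finite_measure.integrable_const_bound[OF assms(1), where B = "C\<^sup>2"])
  show "AE \<omega> in M. norm ((norm (X \<omega>))\<^sup>2) \<le> C\<^sup>2"
    using assms(3) by (intro AE_I2) (auto intro!: power_mono)
  show "(\<lambda>\<omega>. (norm (X \<omega>))\<^sup>2) \<in> borel_measurable M" using assms(2) by measurable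
qed

section \<open>Combinatorics of partitions and simple processes\<close>

lemma clip_swap:
  fixes w :: "'t::linorder \<Rightarrow> 'v::ab_group_add"
  assumes "x \<le> x'" "y \<le> y'"
  shows "w (max x (min x' y')) - w (max x (min x' y)) = w (max y (min y' x')) - w (max y (min y' x))"
  using assms by (auto simp: max_def min_def)

lemma sum_div_mod:
  fixes f :: "nat \<Rightarrow> nat \<Rightarrow> 'v::comm_monoid_add"
  shows "(\<Sum>k<N * n. f (k div n) (k mod n)) = (\<Sum>i<N. \<Sum>j<n. f i j)"
proof (cases "n = 0")
  case False
  have "(\<Sum>k<N * n. f (k div n) (k mod n)) = (\<Sum>i<N. \<Sum>k\<in>{i * n..<i * n + n}. f (k div n) (k mod n))"
    by (rule sum.nat_group[symmetric])
  also have "\<dots> = (\<Sum>i<N. \<Sum>j<n. f i j)"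
  proof (rule sum.cong[OF refl])
    fix i
    have "(\<Sum>k\<in>{i * n..<i * n + n}. f (k div n) (k mod n)) = (\<Sum>k\<in>{0 + i * n..<n + i * n}. f (k div n) (k mod n))"
      by (simp add: add.commute)
    also have "\<dots> = (\<Sum>j\<in>{0..<n}. f ((j + i * n) div n) ((j + i * n) mod n))"
      by (rule sum.shift_bounds_nat_ivl)
    also have "\<dots> = (\<Sum>j<n. f i j)"
      using False by (intro sum.cong) (auto simp: div_add1_eq)
    finally show "(\<Sum>k\<in>{i * n..<i * n + n}. f (k div n) (k mod n)) = (\<Sum>j<n. f i j)" .
  qed
  finally show ?thesis .
qed simp

lemma partition_mono:
  fixes p :: "nat \<Rightarrow> real"
  assumes "\<forall>i<N. p i \<le> p (Suc i)" "i \<le> j" "j \<le> N"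
  shows "p i \<le> p j"
  using assms(2,3)
proof (induction j rule: dec_induct)
  case (step j)
  then show ?case using assms(1) by (auto intro: order_trans[of _ "p j"])
qed simp

lemma partition_cell_exists:
  fixes p :: "nat \<Rightarrow> real"
  assumes "p 0 < s" "s \<le> p N"
  shows "\<exists>i<N. p i < s \<and> s \<le> p (Suc i)"
  using assms(2)
proof (induction N)
  case (Suc N)
  then show ?case by (cases "s \<le> p N") (auto intro: less_SucI)
qed (use assms(1) in simp)

lemma partition_cell_unique:
  fixes p :: "nat \<Rightarrow> real"
  assumes "\<forall>i<N. p i \<le> p (Suc i)" "i < N" "j < N" "p i < s" "s \<le> p (Suc i)" "p j < s" "s \<le> p (Suc j)"
  shows "i = j"
proof (rule ccontr)
  assume "i \<noteq> j"
  then consider "Suc i \<le> j" | "Suc j \<le> i" by linarith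
  then show False
    using partition_mono[OF assms(1), of "Suc i" j] partition_mono[OF assms(1), of "Suc j" i] assms
    by cases auto
qed

lemma simple_process_mono: "simple_process F a b N p \<xi> \<Longrightarrow> i \<le> j \<Longrightarrow> j \<le> N \<Longrightarrow> p i \<le> p j"
  unfolding simple_process_def by (blast intro: partition_mono)

lemma simple_process_bounds:
  assumes "simple_process F a b N p \<xi>" "i \<le> N"
  shows "a \<le> p i" "p i \<le> b"
  using simple_process_mono[OF assms(1), of 0 i] simple_process_mono[OF assms(1), of i N] assms
  by (auto simp: simple_process_def)

lemma simple_value_cell:
  assumes "simple_process F a b N p \<xi>" "i < N" "p i < s" "s \<le> p (Suc i)"
  shows "simple_value N p \<xi> s \<omega> = \<xi> i \<omega>"
proof -
  have p: "\<forall>i<N. p i \<le> p (Suc i)" using assms(1) by (simp add: simple_process_def)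
  have ind: "indicator {p j<..p (Suc j)} s = (of_bool (j = i) :: real)" if "j < N" for j
  proof (cases "s \<in> {p j<..p (Suc j)}")
    case True
    then show ?thesis using partition_cell_unique[OF p assms(2) that assms(3,4)] by simp
  next
    case False
    then show ?thesis using assms by auto
  qed
  have "simple_value N p \<xi> s \<omega> = (\<Sum>j<N. if j = i then \<xi> i \<omega> else 0)"
    unfolding simple_value_def by (intro sum.cong refl) (simp add: ind)
  then show ?thesis using assms(2) by simp
qed

lemma simple_value_outside:
  assumes "simple_process F a b N p \<xi>" "s \<notin> {a<..b}"
  shows "simple_value N p \<xi> s \<omega> = 0"
  unfolding simple_value_def
proof (rule sum.neutral, safe)
  fix i assume "i < N"
  then have "a \<le> p i" "p (Suc i) \<le> b" by (auto intro: simple_process_bounds[OF assms(1)])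
  then show "indicator {p i<..p (Suc i)} s *\<^sub>R \<xi> i \<omega> = 0"
    using assms(2) by (auto simp: indicator_def)
qed

lemma simple_value_exists_cell:
  assumes "simple_process F a b N p \<xi>" "s \<in> {a<..b}"
  obtains i where "i < N" "p i < s" "s \<le> p (Suc i)"
  using partition_cell_exists[of p s N] assms by (auto simp: simple_process_def)

text \<open>
  This identity transfers every manipulation of stochastic integrals of simple processes that is
  valid for all integrators to the values of these processes.
\<close>

lemma simple_value_eq_integral:
  assumes "simple_process F a b N p \<xi>"
  shows "simple_value N p \<xi> s \<omega> = simple_ito_integral (\<lambda>t _. of_bool (s \<le> t)) N p \<xi> \<omega>"
  unfolding simple_value_def simple_ito_integral_def
proof (rule sum.cong[OF refl])
  fix i assume "i \<in> {..<N}"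
  then have "p i \<le> p (Suc i)" using assms by (simp add: simple_process_def)
  then show "indicator {p i<..p (Suc i)} s *\<^sub>R \<xi> i \<omega> = (of_bool (s \<le> p (Suc i)) - of_bool (s \<le> p i)) *\<^sub>R \<xi> i \<omega>"
    by (auto simp: indicator_def)
qed

text \<open>The time integral of the squared simple process; by the isometry its expectation is the
  second moment of the stochastic integral.\<close>

definition simple_energy :: "nat \<Rightarrow> (nat \<Rightarrow> real) \<Rightarrow> (nat \<Rightarrow> 'a \<Rightarrow> 'b::euclidean_space) \<Rightarrow> 'a \<Rightarrow> real" where
  "simple_energy N p \<xi> \<omega> = (\<Sum>i<N. (p (Suc i) - p i) * (norm (\<xi> i \<omega>))\<^sup>2)"

lemma simple_energy_nonneg: "simple_process F a b N p \<xi> \<Longrightarrow> 0 \<le> simple_energy N p \<xi> \<omega>"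
  unfolding simple_energy_def simple_process_def by (intro sum_nonneg) auto

lemma simple_value_sq:
  assumes "simple_process F a b N p \<xi>"
  shows "(norm (simple_value N p \<xi> s \<omega>))\<^sup>2 = (\<Sum>i<N. indicator {p i<..p (Suc i)} s * (norm (\<xi> i \<omega>))\<^sup>2)"
proof (cases "s \<in> {a<..b}")
  case True
  then obtain i where i: "i < N" "p i < s" "s \<le> p (Suc i)"
    using simple_value_exists_cell[OF assms] by blast
  have p: "\<forall>i<N. p i \<le> p (Suc i)" using assms(1) by (simp add: simple_process_def)
  have ind: "indicator {p j<..p (Suc j)} s = (of_bool (j = i) :: real)" if "j < N" for j
  proof (cases "s \<in> {p j<..p (Suc j)}")
    case True
    then show ?thesis using partition_cell_unique[OF p i(1) that i(2,3)] by simp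
  next
    case False
    then show ?thesis using i by auto
  qed
  have "(\<Sum>j<N. indicator {p j<..p (Suc j)} s * (norm (\<xi> j \<omega>))\<^sup>2) = (\<Sum>j<N. if j = i then (norm (\<xi> i \<omega>))\<^sup>2 else 0)"
    by (intro sum.cong refl) (simp add: ind)
  then show ?thesis using i by (simp add: simple_value_cell[OF assms i])
next
  case False
  have "indicator {p i<..p (Suc i)} s * (norm (\<xi> i \<omega>))\<^sup>2 = 0" if "i < N" for i
  proof -
    have "a \<le> p i" "p (Suc i) \<le> b" using that by (auto intro: simple_process_bounds[OF assms(1)])
    then show ?thesis using False by (auto simp: indicator_def)
  qed
  then have "(\<Sum>i<N. indicator {p i<..p (Suc i)} s * (norm (\<xi> i \<omega>))\<^sup>2) = 0"
    by (intro sum.neutral) auto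
  then show ?thesis by (simp only: simple_value_outside[OF assms False]) simp
qed

lemma simple_value_measurable [measurable]:
  "(\<lambda>s. simple_value N p \<xi> s \<omega>) \<in> borel_measurable borel"
  unfolding simple_value_def by measurable

lemma nn_integral_simple_value_sq:
  assumes "simple_process F a b N p \<xi>"
  shows "(\<integral>\<^sup>+s. ennreal ((norm (simple_value N p \<xi> s \<omega>))\<^sup>2) \<partial>lborel) = ennreal (simple_energy N p \<xi> \<omega>)"
proof -
  have p: "p i \<le> p (Suc i)" if "i < N" for i using assms(1) that by (simp add: simple_process_def)
  have "(\<integral>\<^sup>+s. ennreal ((norm (simple_value N p \<xi> s \<omega>))\<^sup>2) \<partial>lborel)
      = (\<integral>\<^sup>+s. (\<Sum>i<N. ennreal ((norm (\<xi> i \<omega>))\<^sup>2) * indicator {p i<..p (Suc i)} s) \<partial>lborel)"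
  proof (rule nn_integral_cong)
    fix s
    have "ennreal ((norm (simple_value N p \<xi> s \<omega>))\<^sup>2) = (\<Sum>i<N. ennreal (indicator {p i<..p (Suc i)} s * (norm (\<xi> i \<omega>))\<^sup>2))"
      by (simp only: simple_value_sq[OF assms]) (rule sum_ennreal[symmetric], simp)
    also have "\<dots> = (\<Sum>i<N. ennreal ((norm (\<xi> i \<omega>))\<^sup>2) * indicator {p i<..p (Suc i)} s)"
      by (intro sum.cong) (auto simp: indicator_def)
    finally show "ennreal ((norm (simple_value N p \<xi> s \<omega>))\<^sup>2) = \<dots>" .
  qed
  also have "\<dots> = (\<Sum>i<N. ennreal ((norm (\<xi> i \<omega>))\<^sup>2) * emeasure lborel {p i<..p (Suc i)})"
    by (subst nn_integral_sum) (simp_all add: nn_integral_cmult_indicator)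
  also have "\<dots> = (\<Sum>i<N. ennreal ((p (Suc i) - p i) * (norm (\<xi> i \<omega>))\<^sup>2))"
    using p by (intro sum.cong) (auto simp: ennreal_mult'[symmetric] mult.commute)
  also have "\<dots> = ennreal (simple_energy N p \<xi> \<omega>)"
    unfolding simple_energy_def using p by (intro sum_ennreal) auto
  finally show ?thesis .
qed

section \<open>Sums, restrictions and stopping of simple processes\<close>

lemma (in filtration) measurable_F_mono:
  "s \<le> t \<Longrightarrow> f \<in> measurable (F s) N \<Longrightarrow> f \<in> measurable (F t) N"
  using measurable_mono[of N N "F s" "F t"] space_F sets_F_mono by (auto simp: subset_iff)

text \<open>Each cell of \<open>p\<close> is cut at the points of \<open>q\<close> clipped to it,
  cell after cell, so that the union of the two partitions need not be sorted; degenerate cells are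
  the price. The identity holds for every integrator \<open>w\<close>, hence also for the values of
  the processes, and the mesh bound is inherited from \<open>q\<close>.\<close>

lemma simple_process_merge:
  fixes \<xi> \<eta> :: "nat \<Rightarrow> 'a \<Rightarrow> 'b::euclidean_space"
  assumes F: "filtration \<Omega> F"
    and \<xi>: "simple_process F a b N p \<xi>" and \<eta>: "simple_process F a b n q \<eta>"
    and mesh: "\<And>j. j < n \<Longrightarrow> q (Suc j) - q j \<le> \<delta>" and "0 \<le> \<delta>"
  obtains K r \<zeta> where "simple_process F a b K r \<zeta>" "\<And>k. k < K \<Longrightarrow> r (Suc k) - r k \<le> \<delta>"
    "\<And>w \<omega>. simple_ito_integral w K r \<zeta> \<omega> = simple_ito_integral w N p \<xi> \<omega> + simple_ito_integral w n q \<eta> \<omega>"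
proof (cases "a = b")
  case True
  have p: "p i = a" if "i \<le> N" for i
    using simple_process_bounds[OF \<xi> that] True by simp
  have q: "q i = a" if "i \<le> n" for i
    using simple_process_bounds[OF \<eta> that] True by simp
  show ?thesis
  proof (rule that[of 0 "\<lambda>_. a"])
    show "simple_process F a b 0 (\<lambda>_. a) (\<lambda>_ _. 0 :: 'b)"
      using True by (simp add: simple_process_def)
    show "simple_ito_integral w 0 (\<lambda>_. a) (\<lambda>_ _. 0) \<omega> = simple_ito_integral w N p \<xi> \<omega> + simple_ito_integral w n q \<eta> \<omega>" for w \<omega>
      by (simp add: simple_ito_integral_def p q)
  qed simp
next
  case False
  interpret filtration \<Omega> F by (rule F)
  have p0: "p 0 = a" "p N = b" and pm: "\<And>i. i < N \<Longrightarrow> p i \<le> p (Suc i)"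
    and q0: "q 0 = a" "q n = b" and qm: "\<And>j. j < n \<Longrightarrow> q j \<le> q (Suc j)"
    using \<xi> \<eta> by (auto simp: simple_process_def)
  have pb: "a \<le> p i" "p i \<le> b" if "i \<le> N" for i using simple_process_bounds[OF \<xi> that] by auto
  have qb: "a \<le> q i" "q i \<le> b" if "i \<le> n" for i using simple_process_bounds[OF \<eta> that] by auto
  have N: "0 < N" and n: "0 < n" using p0 q0 False by (auto intro: gr0I)
  \<comment> \<open>Cell \<open>k\<close> of the refinement stands for the pair
    \<open>i = k div n\<close>, \<open>j = k mod n\<close> and runs from \<open>c i (q j)\<close> to
    \<open>c i (q (Suc j))\<close>.\<close>
  define c where "c i x = max (p i) (min (p (Suc i)) x)" for i x
  define r where "r k = (if k < N * n then c (k div n) (q (k mod n)) else b)" for k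
  have dv: "k div n < N" "k mod n < n" if "k < N * n" for k
    using that n by (auto simp: less_mult_imp_div_less)
  have r1: "r k = c (k div n) (q (k mod n))" if "k < N * n" for k
    using that by (simp add: r_def)
  \<comment> \<open>In the last column the cell ends at \<open>p (Suc i)\<close>. This is also where
    the next row starts, since clipping \<open>q 0 = a\<close> to the next cell gives the left end
    of that cell.\<close>
  have r2: "r (Suc k) = c (k div n) (q (Suc (k mod n)))" if k: "k < N * n" for k
  proof (cases "Suc (k mod n) = n")
    case False
    then have "Suc k div n = k div n" "Suc k mod n = Suc (k mod n)"
      by (auto simp: div_Suc mod_Suc)
    moreover have "Suc k < N * n"
    proof -
      have "Suc k = (k div n) * n + Suc (k mod n)" by simp
      also have "\<dots> < (k div n) * n + n" using False dv(2)[OF k] by linarith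
      also have "\<dots> = Suc (k div n) * n" by simp
      also have "\<dots> \<le> N * n" using dv(1)[OF k] by (intro mult_right_mono) auto
      finally show ?thesis .
    qed
    ultimately show ?thesis by (simp add: r_def)
  next
    case True
    then have d: "Suc k div n = Suc (k div n)" "Suc k mod n = 0"
      by (auto simp: div_Suc mod_Suc)
    have e: "c (k div n) (q (Suc (k mod n))) = p (Suc (k div n))"
      using pm[OF dv(1)[OF k]] pb[of "Suc (k div n)"] dv(1)[OF k] by (simp add: True q0 c_def)
    show ?thesis
    proof (cases "Suc k < N * n")
      case True
      with dv(1)[OF True] d have "Suc (k div n) < N" by simp
      then show ?thesis
        using True d e pm[of "Suc (k div n)"] pb[of "Suc (k div n)"] pb[of "Suc (Suc (k div n))"]
        by (simp add: r_def q0 c_def)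
    next
      case False
      then have "Suc k = N * n" using k by simp
      then have "Suc k div n = N" using n by simp
      then show ?thesis using False d e p0 by (simp add: r_def)
    qed
  qed
  have cm: "c i x \<le> c i y" if "x \<le> y" for i x y
    using that by (auto simp: c_def)
  have rm: "r k \<le> r (Suc k)" if "k < N * n" for k
    using r1[OF that] r2[OF that] cm[OF qm[OF dv(2)[OF that]]] by simp
  \<comment> \<open>In a degenerate cell \<open>\<xi>\<close> or \<open>\<eta>\<close> may not be
    known yet at time \<open>r k\<close>. The value 0 keeps the process adapted and does not affect
    integrals, because the increment of \<open>w\<close> vanishes there.\<close>
  define \<zeta> where "\<zeta> k \<omega> = (if r k < r (Suc k) then \<xi> (k div n) \<omega> + \<eta> (k mod n) \<omega> else 0)" for k \<omega>
  have \<xi>m: "\<xi> i \<in> borel_measurable (F (p i))" if "i < N" for i using \<xi> that by (auto simp: simple_process_def)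
  have \<eta>m: "\<eta> i \<in> borel_measurable (F (q i))" if "i < n" for i using \<eta> that by (auto simp: simple_process_def)
  show ?thesis
  proof (rule that[of "N * n" r \<zeta>])
    show "simple_process F a b (N * n) r \<zeta>"
      unfolding simple_process_def
    proof (intro conjI allI impI)
      show "r 0 = a"
        using N n pm[of 0] by (simp add: r_def p0 q0 c_def)
      show "r (N * n) = b" by (simp add: r_def)
      fix k assume k: "k < N * n"
      show "r k \<le> r (Suc k)" by (rule rm[OF k])
      show "\<zeta> k \<in> borel_measurable (F (r k))"
      proof (cases "r k < r (Suc k)")
        case True
        then have "p (k div n) \<le> r k" "q (k mod n) \<le> r k"
          using r1[OF k] r2[OF k] pm[OF dv(1)[OF k]] qm[OF dv(2)[OF k]]
          by (auto simp: c_def max_def min_def split: if_splits)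
        then have "\<xi> (k div n) \<in> borel_measurable (F (r k))" "\<eta> (k mod n) \<in> borel_measurable (F (r k))"
          using measurable_F_mono \<xi>m[OF dv(1)[OF k]] \<eta>m[OF dv(2)[OF k]] by blast+
        then show ?thesis using True by (simp add: \<zeta>_def[abs_def])
      qed (simp add: \<zeta>_def[abs_def])
      obtain C1 where C1: "\<And>\<omega>. \<omega> \<in> \<Omega> \<Longrightarrow> norm (\<xi> (k div n) \<omega>) \<le> C1"
        using \<xi> dv(1)[OF k] space_F unfolding simple_process_def by metis
      obtain C2 where C2: "\<And>\<omega>. \<omega> \<in> \<Omega> \<Longrightarrow> norm (\<eta> (k mod n) \<omega>) \<le> C2"
        using \<eta> dv(2)[OF k] space_F unfolding simple_process_def by metis
      have "norm (\<zeta> k \<omega>) \<le> \<bar>C1\<bar> + \<bar>C2\<bar>" if "\<omega> \<in> \<Omega>" for \<omega>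
        using C1[OF that] C2[OF that] norm_triangle_ineq[of "\<xi> (k div n) \<omega>" "\<eta> (k mod n) \<omega>"]
        by (auto simp: \<zeta>_def)
      then show "\<exists>C. \<forall>\<omega>\<in>space (F (r k)). norm (\<zeta> k \<omega>) \<le> C"
        by (auto simp: space_F)
    qed
    show "r (Suc k) - r k \<le> \<delta>" if k: "k < N * n" for k
    proof -
      have "c i y - c i x \<le> max 0 (y - x)" for i x y
        by (auto simp: c_def max_def min_def)
      from this[of "k div n" "q (Suc (k mod n))" "q (k mod n)"] mesh[OF dv(2)[OF k]]
      show ?thesis using \<open>0 \<le> \<delta>\<close> by (simp add: r1[OF k] r2[OF k])
    qed
    fix w :: "real \<Rightarrow> 'a \<Rightarrow> real" and \<omega>
    let ?d = "\<lambda>i j. w (c i (q (Suc j))) \<omega> - w (c i (q j)) \<omega>"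
    have "simple_ito_integral w (N * n) r \<zeta> \<omega>
        = (\<Sum>k<N * n. ?d (k div n) (k mod n) *\<^sub>R (\<xi> (k div n) \<omega> + \<eta> (k mod n) \<omega>))"
      unfolding simple_ito_integral_def
    proof (rule sum.cong[OF refl])
      fix k assume "k \<in> {..<N * n}"
      then have k: "k < N * n" by simp
      show "(w (r (Suc k)) \<omega> - w (r k) \<omega>) *\<^sub>R \<zeta> k \<omega> = ?d (k div n) (k mod n) *\<^sub>R (\<xi> (k div n) \<omega> + \<eta> (k mod n) \<omega>)"
        using rm[OF k] unfolding \<zeta>_def r1[OF k] r2[OF k] by (cases "c (k div n) (q (k mod n)) = c (k div n) (q (Suc (k mod n)))") auto
    qed
    also have "\<dots> = (\<Sum>i<N. \<Sum>j<n. ?d i j *\<^sub>R (\<xi> i \<omega> + \<eta> j \<omega>))"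
      by (rule sum_div_mod[of "\<lambda>i j. ?d i j *\<^sub>R (\<xi> i \<omega> + \<eta> j \<omega>)"])
    also have "\<dots> = (\<Sum>i<N. (\<Sum>j<n. ?d i j) *\<^sub>R \<xi> i \<omega>) + (\<Sum>i<N. \<Sum>j<n. ?d i j *\<^sub>R \<eta> j \<omega>)"
      by (simp add: scaleR_add_right sum.distrib scaleR_sum_left)
    also have "(\<Sum>i<N. \<Sum>j<n. ?d i j *\<^sub>R \<eta> j \<omega>) = (\<Sum>j<n. (\<Sum>i<N. ?d i j) *\<^sub>R \<eta> j \<omega>)"
      by (subst sum.swap) (simp add: scaleR_sum_left)
    also have "(\<Sum>i<N. (\<Sum>j<n. ?d i j) *\<^sub>R \<xi> i \<omega>) = simple_ito_integral w N p \<xi> \<omega>"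
      unfolding simple_ito_integral_def
    proof (rule sum.cong[OF refl])
      fix i assume "i \<in> {..<N}"
      then have i: "i < N" by simp
      have "(\<Sum>j<n. ?d i j) = w (c i b) \<omega> - w (c i a) \<omega>"
        by (subst sum_lessThan_telescope) (simp add: q0)
      moreover have "c i b = p (Suc i)" "c i a = p i"
        using i pm[OF i] pb[of i] pb[of "Suc i"] by (auto simp: c_def)
      ultimately show "(\<Sum>j<n. ?d i j) *\<^sub>R \<xi> i \<omega> = (w (p (Suc i)) \<omega> - w (p i) \<omega>) *\<^sub>R \<xi> i \<omega>" by simp
    qed
    also have "(\<Sum>j<n. (\<Sum>i<N. ?d i j) *\<^sub>R \<eta> j \<omega>) = simple_ito_integral w n q \<eta> \<omega>"
      unfolding simple_ito_integral_def
    proof (rule sum.cong[OF refl])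
      fix j assume "j \<in> {..<n}"
      then have j: "j < n" by simp
      define d where "d x = max (q j) (min (q (Suc j)) x)" for x
      \<comment> \<open>The sum over \<open>i\<close> telescopes only after the two partitions
        exchange their roles: clipping a cell of \<open>q\<close> to a cell of \<open>p\<close>
        gives the same interval as the converse, or both results are degenerate when the cells are
        disjoint.\<close>
      have "(\<Sum>i<N. ?d i j) = (\<Sum>i<N. w (d (p (Suc i))) \<omega> - w (d (p i)) \<omega>)"
        using pm qm[OF j] unfolding c_def d_def
        by (intro sum.cong refl clip_swap[where w = "\<lambda>x. w x \<omega>"]) auto
      also have "\<dots> = w (d b) \<omega> - w (d a) \<omega>"
        by (subst sum_lessThan_telescope[where f = "\<lambda>i. w (d (p i)) \<omega>"]) (simp add: p0)
      finally have "(\<Sum>i<N. ?d i j) = w (d b) \<omega> - w (d a) \<omega>" .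
      moreover have "d b = q (Suc j)" "d a = q j"
        using j qm[OF j] qb[of j] qb[of "Suc j"] by (auto simp: d_def)
      ultimately show "(\<Sum>i<N. ?d i j) *\<^sub>R \<eta> j \<omega> = (w (q (Suc j)) \<omega> - w (q j) \<omega>) *\<^sub>R \<eta> j \<omega>" by simp
    qed
    finally show "simple_ito_integral w (N * n) r \<zeta> \<omega> = simple_ito_integral w N p \<xi> \<omega> + simple_ito_integral w n q \<eta> \<omega>" .
  qed
qed

lemma simple_process_uminus:
  assumes "simple_process F a b N p \<xi>"
  shows "simple_process F a b N p (\<lambda>i \<omega>. - \<xi> i \<omega>)"
  using assms unfolding simple_process_def by auto

lemma simple_ito_integral_uminus:
  "simple_ito_integral w N p (\<lambda>i \<omega>. - \<xi> i \<omega>) \<omega> = - simple_ito_integral w N p \<xi> \<omega>"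
  by (simp add: simple_ito_integral_def sum_negf)

text \<open>A cell that begins after \<open>u\<close> collapses to the point \<open>u\<close>, where
  its value is not yet known; hence the replacement by 0.\<close>

lemma simple_process_restrict_left:
  fixes \<xi> :: "nat \<Rightarrow> 'a \<Rightarrow> 'b::euclidean_space"
  assumes F: "filtration \<Omega> F" and \<xi>: "simple_process F a b N p \<xi>" and u: "a \<le> u" "u \<le> b"
  shows "simple_process F a u N (\<lambda>i. min u (p i)) (\<lambda>i \<omega>. if p i \<le> u then \<xi> i \<omega> else 0)"
proof -
  interpret filtration \<Omega> F by (rule F)
  show ?thesis
    unfolding simple_process_def
  proof (intro conjI allI impI)
    show "min u (p 0) = a" "min u (p N) = u" using \<xi> u by (auto simp: simple_process_def)
    fix i assume i: "i < N"
    show "min u (p i) \<le> min u (p (Suc i))" using \<xi> i by (auto simp: simple_process_def min.coboundedI2)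
    show "(\<lambda>\<omega>. if p i \<le> u then \<xi> i \<omega> else 0) \<in> borel_measurable (F (min u (p i)))"
      using \<xi> i by (cases "p i \<le> u") (auto simp: simple_process_def min_def)
    obtain C where C: "\<forall>\<omega>\<in>\<Omega>. norm (\<xi> i \<omega>) \<le> C"
      using \<xi> i by (auto simp: simple_process_def space_F)
    then have "\<forall>\<omega>\<in>\<Omega>. norm (if p i \<le> u then \<xi> i \<omega> else 0) \<le> \<bar>C\<bar>" by force
    then show "\<exists>C. \<forall>\<omega>\<in>space (F (min u (p i))). norm (if p i \<le> u then \<xi> i \<omega> else 0) \<le> C"
      unfolding space_F by blast
  qed
qed

lemma simple_process_restrict_right:
  fixes \<xi> :: "nat \<Rightarrow> 'a \<Rightarrow> 'b::euclidean_space"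
  assumes F: "filtration \<Omega> F" and \<xi>: "simple_process F a b N p \<xi>" and u: "a \<le> u" "u \<le> b"
  shows "simple_process F u b N (\<lambda>i. max u (p i)) \<xi>"
proof -
  interpret filtration \<Omega> F by (rule F)
  show ?thesis
    unfolding simple_process_def
  proof (intro conjI allI impI)
    show "max u (p 0) = u" "max u (p N) = b" using \<xi> u by (auto simp: simple_process_def)
    fix i assume i: "i < N"
    show "max u (p i) \<le> max u (p (Suc i))" using \<xi> i by (auto simp: simple_process_def max.coboundedI2)
    show "\<xi> i \<in> borel_measurable (F (max u (p i)))"
      using \<xi> i by (auto simp: simple_process_def intro: measurable_F_mono[of "p i" "max u (p i)"])
    show "\<exists>C. \<forall>\<omega>\<in>space (F (max u (p i))). norm (\<xi> i \<omega>) \<le> C"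
      using \<xi> i by (auto simp: simple_process_def space_F)
  qed
qed

lemma simple_ito_integral_split:
  fixes \<xi> :: "nat \<Rightarrow> 'a \<Rightarrow> 'b::euclidean_space"
  assumes \<xi>: "simple_process F a b N p \<xi>"
  shows "simple_ito_integral w N p \<xi> \<omega>
    = simple_ito_integral w N (\<lambda>i. min u (p i)) (\<lambda>i \<omega>. if p i \<le> u then \<xi> i \<omega> else 0) \<omega>
      + simple_ito_integral w N (\<lambda>i. max u (p i)) \<xi> \<omega>"
  unfolding simple_ito_integral_def sum.distrib[symmetric]
proof (rule sum.cong[OF refl])
  fix i assume "i \<in> {..<N}"
  then have "p i \<le> p (Suc i)" using \<xi> by (auto simp: simple_process_def)
  then show "(w (p (Suc i)) \<omega> - w (p i) \<omega>) *\<^sub>R \<xi> i \<omega> =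
      (w (min u (p (Suc i))) \<omega> - w (min u (p i)) \<omega>) *\<^sub>R (if p i \<le> u then \<xi> i \<omega> else 0) +
      (w (max u (p (Suc i))) \<omega> - w (max u (p i)) \<omega>) *\<^sub>R \<xi> i \<omega>"
    by (auto simp: max_def min_def scaleR_add_left[symmetric])
qed

text \<open>At any \<open>s\<close> one of the two halves vanishes, and the splitting identity
  applies to the integrator that produces values.\<close>

lemma simple_value_restrict:
  fixes \<xi> :: "nat \<Rightarrow> 'a \<Rightarrow> 'b::euclidean_space"
  assumes F: "filtration \<Omega> F" and \<xi>: "simple_process F a b N p \<xi>" and u: "a \<le> u" "u \<le> b"
  shows "s \<le> u \<Longrightarrow> simple_value N (\<lambda>i. min u (p i)) (\<lambda>i \<omega>. if p i \<le> u then \<xi> i \<omega> else 0) s \<omega> = simple_value N p \<xi> s \<omega>" (is "_ \<Longrightarrow> ?L = _")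
    and "u < s \<Longrightarrow> simple_value N (\<lambda>i. max u (p i)) \<xi> s \<omega> = simple_value N p \<xi> s \<omega>" (is "_ \<Longrightarrow> ?R = _")
proof -
  have sum: "simple_value N p \<xi> s \<omega> = ?L + ?R"
    unfolding simple_value_eq_integral[OF \<xi>] simple_value_eq_integral[OF simple_process_restrict_left[OF F \<xi> u]]
      simple_value_eq_integral[OF simple_process_restrict_right[OF F \<xi> u]]
    by (rule simple_ito_integral_split[OF \<xi>])
  show "?L = simple_value N p \<xi> s \<omega>" if "s \<le> u"
    unfolding sum using that by (simp add: simple_value_outside[OF simple_process_restrict_right[OF F \<xi> u]])
  show "?R = simple_value N p \<xi> s \<omega>" if "u < s"
    unfolding sum using that by (simp add: simple_value_outside[OF simple_process_restrict_left[OF F \<xi> u]])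
qed

text \<open>
  Stopping a simple process before its energy exceeds a level keeps it nonanticipating, since the
  energy of a cell is known at the left end of that cell.
\<close>

definition stop_at_energy :: "real \<Rightarrow> (nat \<Rightarrow> real) \<Rightarrow> (nat \<Rightarrow> 'a \<Rightarrow> 'b::euclidean_space) \<Rightarrow> nat \<Rightarrow> 'a \<Rightarrow> 'b" where
  "stop_at_energy K p \<xi> i \<omega> = (if simple_energy (Suc i) p \<xi> \<omega> \<le> K then \<xi> i \<omega> else 0)"

lemma simple_energy_mono:
  assumes "simple_process F a b N p \<xi>" "i \<le> j" "j \<le> N"
  shows "simple_energy i p \<xi> \<omega> \<le> simple_energy j p \<xi> \<omega>"
  using assms(2,3) unfolding simple_energy_def
proof (induction j rule: dec_induct)
  case (step j)
  have "0 \<le> (p (Suc j) - p j) * (norm (\<xi> j \<omega>))\<^sup>2"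
    using assms(1) step.prems by (auto simp: simple_process_def)
  then show ?case using step by simp
qed simp

lemma simple_process_stop_at_energy:
  assumes F: "filtration \<Omega> F" and \<xi>: "simple_process F a b N p \<xi>"
  shows "simple_process F a b N p (stop_at_energy K p \<xi>)"
proof -
  interpret filtration \<Omega> F by (rule F)
  have "stop_at_energy K p \<xi> i \<in> borel_measurable (F (p i))
      \<and> (\<exists>C. \<forall>\<omega>\<in>space (F (p i)). norm (stop_at_energy K p \<xi> i \<omega>) \<le> C)" if i: "i < N" for i
  proof
    have [measurable]: "\<xi> j \<in> borel_measurable (F (p i))" if "j < Suc i" for j
      using \<xi> that i simple_process_mono[OF \<xi>, of j i]
      by (intro measurable_F_mono[of "p j" "p i"]) (auto simp: simple_process_def)
    have [measurable]: "simple_energy (Suc i) p \<xi> \<in> borel_measurable (F (p i))"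
      unfolding simple_energy_def[abs_def] by measurable
    have [measurable]: "\<xi> i \<in> borel_measurable (F (p i))"
      using \<xi> i by (auto simp: simple_process_def)
    show "stop_at_energy K p \<xi> i \<in> borel_measurable (F (p i))"
      unfolding stop_at_energy_def[abs_def] by measurable
    obtain C where C: "\<forall>\<omega>\<in>\<Omega>. norm (\<xi> i \<omega>) \<le> C"
      using \<xi> i by (auto simp: simple_process_def space_F)
    then have "\<forall>\<omega>\<in>\<Omega>. norm (stop_at_energy K p \<xi> i \<omega>) \<le> \<bar>C\<bar>" by (force simp: stop_at_energy_def)
    then show "\<exists>C. \<forall>\<omega>\<in>space (F (p i)). norm (stop_at_energy K p \<xi> i \<omega>) \<le> C"
      by (auto simp: space_F)
  qed
  then show ?thesis using \<xi> unfolding simple_process_def by auto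
qed

lemma simple_energy_stop_at_energy:
  assumes \<xi>: "simple_process F a b N p \<xi>" and "0 \<le> K"
  shows "simple_energy N p (stop_at_energy K p \<xi>) \<omega> \<le> K"
    and "simple_energy N p (stop_at_energy K p \<xi>) \<omega> \<le> simple_energy N p \<xi> \<omega>"
proof -
  have p: "0 \<le> p (Suc i) - p i" if "i < N" for i using \<xi> that by (simp add: simple_process_def)
  have le: "simple_energy n p (stop_at_energy K p \<xi>) \<omega> \<le> simple_energy n p \<xi> \<omega>" if "n \<le> N" for n
    unfolding simple_energy_def using p that by (intro sum_mono mult_left_mono) (auto simp: stop_at_energy_def)
  then show "simple_energy N p (stop_at_energy K p \<xi>) \<omega> \<le> simple_energy N p \<xi> \<omega>" by simp
  have "simple_energy n p (stop_at_energy K p \<xi>) \<omega> \<le> K" if "n \<le> N" for n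
    using that
  proof (induction n)
    case (Suc n)
    show ?case
    proof (cases "simple_energy (Suc n) p \<xi> \<omega> \<le> K")
      case True
      then show ?thesis using le[OF Suc.prems] by simp
    next
      case False
      then have "stop_at_energy K p \<xi> n \<omega> = 0" by (simp add: stop_at_energy_def)
      then show ?thesis using Suc by (simp add: simple_energy_def)
    qed
  qed (use assms in \<open>simp add: simple_energy_def\<close>)
  then show "simple_energy N p (stop_at_energy K p \<xi>) \<omega> \<le> K" by simp
qed

lemma simple_ito_integral_stop_at_energy:
  assumes \<xi>: "simple_process F a b N p \<xi>" and "simple_energy N p \<xi> \<omega> \<le> K"
  shows "simple_ito_integral w N p (stop_at_energy K p \<xi>) \<omega> = simple_ito_integral w N p \<xi> \<omega>"
  unfolding simple_ito_integral_def
proof (rule sum.cong[OF refl])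
  fix i assume "i \<in> {..<N}"
  then have "simple_energy (Suc i) p \<xi> \<omega> \<le> K"
    using simple_energy_mono[OF \<xi>, of "Suc i" N \<omega>] assms(2) by simp
  then show "(w (p (Suc i)) \<omega> - w (p i) \<omega>) *\<^sub>R stop_at_energy K p \<xi> i \<omega> = (w (p (Suc i)) \<omega> - w (p i) \<omega>) *\<^sub>R \<xi> i \<omega>"
    by (simp add: stop_at_energy_def)
qed

section \<open>Moments of simple stochastic integrals\<close>

lemma (in prob_space) indep_set_mono:
  assumes "indep_set A B" "A' \<subseteq> A" "B' \<subseteq> B"
  shows "indep_set A' B'"
  using assms unfolding indep_set_def
  by (elim indep_sets_mono_sets) (auto split: bool.split)

lemma (in prob_space) indep_var_if_indep_set:
  assumes ind: "indep_set A (sets (vimage_algebra (space M) Y T))"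
    and X: "X \<in> measurable M S" and Y: "Y \<in> measurable M T"
    and A: "sigma_sets (space M) {X -` B \<inter> space M | B. B \<in> sets S} \<subseteq> A"
  shows "indep_var S X T Y"
  unfolding indep_var_eq using X Y
  by (auto intro: indep_set_mono[OF ind A] simp: sets_vimage_algebra)

text \<open>The \<open>k\<close>-th index is taken so large that a deviation of
  \<open>(1/2)^k\<close> has probability below \<open>(1/2)^k\<close>; these probabilities are
  summable, and the Borel-Cantelli lemma applies.\<close>

lemma tendsto_in_prob_AE_subseq:
  fixes X :: "nat \<Rightarrow> 'a \<Rightarrow> 'b::euclidean_space"
  assumes "prob_space M" "tendsto_in_prob M X Y"
  obtains r where "strict_mono r" "AE \<omega> in M. (\<lambda>m. X (r m) \<omega>) \<longlonglongrightarrow> Y \<omega>"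
proof -
  interpret prob_space M by fact
  have [measurable]: "\<And>m. X m \<in> borel_measurable M" "Y \<in> borel_measurable M"
    and lim: "\<And>e. e > 0 \<Longrightarrow> (\<lambda>m. measure M {\<omega> \<in> space M. e \<le> dist (X m \<omega>) (Y \<omega>)}) \<longlonglongrightarrow> 0"
    using assms(2) by (auto simp: tendsto_in_prob_def)
  define A where "A k m = {\<omega> \<in> space M. (1/2) ^ k \<le> dist (X m \<omega>) (Y \<omega>)}" for k m :: nat
  have A: "A k m \<in> sets M" for k m unfolding A_def by measurable
  have ev: "\<exists>m>n. measure M (A k m) < (1/2) ^ k" for k n
  proof -
    have "(\<lambda>m. measure M (A k m)) \<longlonglongrightarrow> 0"
      unfolding A_def by (rule lim) simp
    then have "eventually (\<lambda>m. measure M (A k m) < (1/2) ^ k) sequentially"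
      by (rule order_tendstoD) simp
    then obtain m0 where "\<forall>m\<ge>m0. measure M (A k m) < (1/2) ^ k"
      unfolding eventually_sequentially by blast
    then show ?thesis by (intro exI[of _ "max m0 (Suc n)"]) auto
  qed
  have "\<exists>r. \<forall>k. measure M (A k (r k)) < (1/2) ^ k \<and> r k < r (Suc k)"
  proof (rule dependent_nat_choice)
    show "\<exists>x. measure M (A 0 x) < (1/2) ^ 0" using ev by blast
    show "\<exists>y. measure M (A (Suc n) y) < (1/2) ^ Suc n \<and> x < y" for x n
      using ev[of x "Suc n"] by blast
  qed
  then obtain r where r: "\<And>k. measure M (A k (r k)) < (1/2) ^ k" "\<And>k. r k < r (Suc k)"
    by blast
  have "summable (\<lambda>k. measure M (A k (r k)))"
    by (rule summable_comparison_test'[where g = "\<lambda>k. (1/2) ^ k" and N = 0])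
      (use r(1) in \<open>auto intro!: less_imp_le\<close>)
  then have "AE \<omega> in M. eventually (\<lambda>k. \<omega> \<in> space M - A k (r k)) sequentially"
    using A by (intro borel_cantelli_AE1) (auto simp: emeasure_eq_measure)
  then have "AE \<omega> in M. (\<lambda>m. X (r m) \<omega>) \<longlonglongrightarrow> Y \<omega>"
  proof eventually_elim
    case (elim \<omega>)
    have "(\<lambda>k. (1/2) ^ k :: real) \<longlonglongrightarrow> 0" by (rule LIMSEQ_power_zero) simp
    moreover have "eventually (\<lambda>k. norm (dist (X (r k) \<omega>) (Y \<omega>)) \<le> (1/2) ^ k) sequentially"
      using elim by eventually_elim (auto simp: A_def)
    ultimately have "(\<lambda>k. dist (X (r k) \<omega>) (Y \<omega>)) \<longlonglongrightarrow> 0"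
      by (rule Lim_null_comparison[rotated])
    then show ?case by (rule iffD2[OF tendsto_dist_iff])
  qed
  then show ?thesis using r(2) that unfolding strict_mono_Suc_iff by blast
qed

lemma tendsto_in_prob_subseq:
  assumes "tendsto_in_prob M X Y" "strict_mono r"
  shows "tendsto_in_prob M (\<lambda>m. X (r m)) Y"
  using assms LIMSEQ_subseq_LIMSEQ[OF _ assms(2)] unfolding tendsto_in_prob_def by (auto simp: o_def)

section \<open>Wiener increments and the isometry for simple integrands\<close>

locale wiener_basis = prob_space M + filtration "space M" F
  for M :: "'a measure" and F :: "real \<Rightarrow> 'a measure" +
  fixes W :: "real \<Rightarrow> 'a \<Rightarrow> real"
  assumes subalg: "subalgebra M (F s)"
    and wiener: "wiener_process M F W"
begin

lemma filtration_axiom: "filtration (space M) F" by unfold_locales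

lemma measurable_F_M: "f \<in> measurable (F s) N \<Longrightarrow> f \<in> measurable M N"
  by (rule measurable_from_subalg[OF subalg])

lemma wiener_measurable_F: "0 \<le> s \<Longrightarrow> s \<le> u \<Longrightarrow> W s \<in> borel_measurable (F u)"
  using wiener measurable_F_mono[of s u] by (auto simp: wiener_process_def)

lemma wiener_measurable: "0 \<le> s \<Longrightarrow> W s \<in> borel_measurable M"
  using wiener_measurable_F[of s s] measurable_F_M by blast

text \<open>The increment is independent of \<open>F s\<close> and Gaussian with mean 0 and variance
  \<open>u - s\<close>, so expectations of products factor. Integrability is the right assumption on
  \<open>Z\<close>, which will be an inner product or a squared norm of square integrable
  variables.\<close>

lemma increment_moments:
  fixes Z :: "'a \<Rightarrow> real"
  assumes s: "0 \<le> s" "s \<le> u" and Z: "Z \<in> borel_measurable (F s)" "integrable M Z"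
  shows "integrable M (\<lambda>\<omega>. (W u \<omega> - W s \<omega>) * Z \<omega>)"
    and "expectation (\<lambda>\<omega>. (W u \<omega> - W s \<omega>) * Z \<omega>) = 0"
    and "integrable M (\<lambda>\<omega>. (W u \<omega> - W s \<omega>)\<^sup>2 * Z \<omega>)"
    and "expectation (\<lambda>\<omega>. (W u \<omega> - W s \<omega>)\<^sup>2 * Z \<omega>) = (u - s) * expectation Z"
proof -
  let ?D = "\<lambda>\<omega>. W u \<omega> - W s \<omega>"
  have "integrable M (\<lambda>\<omega>. ?D \<omega> * Z \<omega>) \<and> expectation (\<lambda>\<omega>. ?D \<omega> * Z \<omega>) = 0 \<and>
    integrable M (\<lambda>\<omega>. (?D \<omega>)\<^sup>2 * Z \<omega>) \<and> expectation (\<lambda>\<omega>. (?D \<omega>)\<^sup>2 * Z \<omega>) = (u - s) * expectation Z"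
  \<comment> \<open>The Gaussian law is available for \<open>s < u\<close> only; for
    \<open>s = u\<close> the increment is 0.\<close>
  proof (cases "s = u")
    case False
    then have su: "s < u" using s by simp
    define \<sigma> where "\<sigma> = sqrt (u - s)"
    have \<sigma>: "0 < \<sigma>" using su by (simp add: \<sigma>_def)
    have dist: "distributed M lborel ?D (normal_density 0 \<sigma>)"
      and ind: "indep_set (sets (F s)) (sets (vimage_algebra (space M) ?D borel))"
      using wiener s su by (auto simp: wiener_process_def \<sigma>_def)
    have [measurable]: "?D \<in> borel_measurable M"
      using wiener_measurable s by (intro borel_measurable_diff) auto
    have nn: "\<And>x. 0 \<le> normal_density 0 \<sigma> x" by simp
    have "integrable M ?D \<and> expectation ?D = 0"
      using distributed_integrable[OF dist, of "\<lambda>x. x"] distributed_integral[OF dist, of "\<lambda>x. x"]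
        integrable_normal_moment_nz_1[OF \<sigma>, of 0] integral_normal_moment_nz_1[OF \<sigma>, of 0] by simp
    moreover have "integrable M (\<lambda>\<omega>. (?D \<omega>)\<^sup>2) \<and> expectation (\<lambda>\<omega>. (?D \<omega>)\<^sup>2) = u - s"
    proof -
      have "has_bochner_integral lborel (\<lambda>x. normal_density 0 \<sigma> x * x\<^sup>2) (\<sigma>\<^sup>2)"
        using normal_moment_even[OF \<sigma>, of 0 1] \<sigma> by simp
      then show ?thesis
        using distributed_integrable[OF dist, of "\<lambda>x. x\<^sup>2"] distributed_integral[OF dist, of "\<lambda>x. x\<^sup>2"] su
        by (simp add: has_bochner_integral_iff \<sigma>_def)
    qed
    moreover have iv: "indep_var borel Z borel ?D"
    proof (rule indep_var_if_indep_set[OF ind])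
      show "Z \<in> borel_measurable M" by (rule measurable_F_M[OF Z(1)])
      have "sigma_sets (space (F s)) {Z -` B \<inter> space M |B. B \<in> sets borel} \<subseteq> sets (F s)"
        using measurable_sets[OF Z(1)] by (intro sets.sigma_sets_subset) (auto simp: space_F)
      then show "sigma_sets (space M) {Z -` B \<inter> space M |B. B \<in> sets borel} \<subseteq> sets (F s)"
        by (simp add: space_F)
    qed simp
    moreover have iv2: "indep_var borel Z borel (\<lambda>\<omega>. (?D \<omega>)\<^sup>2)"
      using indep_var_compose[OF iv, of id borel "\<lambda>x. x\<^sup>2" borel] by (simp add: o_def id_def)
    ultimately show ?thesis
      using indep_var_integrable[OF iv] indep_var_lebesgue_integral[OF iv]
        indep_var_integrable[OF iv2] indep_var_lebesgue_integral[OF iv2] Z(2)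
      by (simp add: mult.commute)
  qed simp
  then show "integrable M (\<lambda>\<omega>. ?D \<omega> * Z \<omega>)" "expectation (\<lambda>\<omega>. ?D \<omega> * Z \<omega>) = 0"
    "integrable M (\<lambda>\<omega>. (?D \<omega>)\<^sup>2 * Z \<omega>)" "expectation (\<lambda>\<omega>. (?D \<omega>)\<^sup>2 * Z \<omega>) = (u - s) * expectation Z"
    by auto
qed

lemma sq_integrable_increment_scaleR:
  fixes Z :: "'a \<Rightarrow> 'b::euclidean_space"
  assumes s: "0 \<le> s" "s \<le> u" and Z: "Z \<in> borel_measurable (F s)" "sq_integrable M Z"
  shows "sq_integrable M (\<lambda>\<omega>. (W u \<omega> - W s \<omega>) *\<^sub>R Z \<omega>)"
    and "expectation (\<lambda>\<omega>. (norm ((W u \<omega> - W s \<omega>) *\<^sub>R Z \<omega>))\<^sup>2) = (u - s) * expectation (\<lambda>\<omega>. (norm (Z \<omega>))\<^sup>2)"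
proof -
  have [measurable]: "W u \<in> borel_measurable M" "W s \<in> borel_measurable M" "Z \<in> borel_measurable M"
    using wiener_measurable s measurable_F_M[OF Z(1)] by auto
  have "(\<lambda>\<omega>. (norm (Z \<omega>))\<^sup>2) \<in> borel_measurable (F s)" using Z(1) by measurable
  note m = increment_moments(3,4)[OF s this]
  show "sq_integrable M (\<lambda>\<omega>. (W u \<omega> - W s \<omega>) *\<^sub>R Z \<omega>)"
    unfolding sq_integrable_def using m(1) Z(2) by (auto simp: power_mult_distrib sq_integrable_def)
  show "expectation (\<lambda>\<omega>. (norm ((W u \<omega> - W s \<omega>) *\<^sub>R Z \<omega>))\<^sup>2) = (u - s) * expectation (\<lambda>\<omega>. (norm (Z \<omega>))\<^sup>2)"
    using m(2) Z(2) by (simp add: power_mult_distrib sq_integrable_def)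
qed

text \<open>Ito's isometry with an initial value. The partial sum up to a cell is known at the left
  end of that cell, so its cross term with the next increment has expectation 0. Carrying
  \<open>Y\<close> along is what later yields orthogonality to \<open>Y\<close> in the
  limit.\<close>

lemma simple_isometry_aux:
  fixes \<xi> :: "nat \<Rightarrow> 'a \<Rightarrow> 'b::euclidean_space"
  assumes "0 \<le> p 0" "\<And>i. i < N \<Longrightarrow> p i \<le> p (Suc i)"
    and "\<And>i. i < N \<Longrightarrow> \<xi> i \<in> borel_measurable (F (p i))" "\<And>i. i < N \<Longrightarrow> sq_integrable M (\<xi> i)"
    and "Y \<in> borel_measurable (F (p 0))" "sq_integrable M Y"
  defines "S \<equiv> \<lambda>n \<omega>. Y \<omega> + simple_ito_integral W n p \<xi> \<omega>"
  shows "S N \<in> borel_measurable (F (p N)) \<and> sq_integrable M (S N) \<and> integrable M (simple_energy N p \<xi>) \<and>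
    expectation (\<lambda>\<omega>. (norm (S N \<omega>))\<^sup>2) = expectation (\<lambda>\<omega>. (norm (Y \<omega>))\<^sup>2) + expectation (simple_energy N p \<xi>)"
  using assms(2-4)
proof (induction N)
  case 0
  have "simple_energy 0 p \<xi> = (\<lambda>_. 0)" by (auto simp: simple_energy_def)
  then show ?case using assms(5,6) by (simp add: S_def simple_ito_integral_def)
next
  case (Suc N)
  have pmon: "p N \<le> p (Suc N)" using Suc.prems by simp
  have p0: "0 \<le> p N"
    using partition_mono[of N p 0 N] Suc.prems(1) assms(1) by force
  have IH: "S N \<in> borel_measurable (F (p N))" "sq_integrable M (S N)" "integrable M (simple_energy N p \<xi>)"
    "expectation (\<lambda>\<omega>. (norm (S N \<omega>))\<^sup>2) = expectation (\<lambda>\<omega>. (norm (Y \<omega>))\<^sup>2) + expectation (simple_energy N p \<xi>)"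
    using Suc.IH Suc.prems by auto
  have \<xi>: "\<xi> N \<in> borel_measurable (F (p N))" "sq_integrable M (\<xi> N)" using Suc.prems by auto
  let ?D = "\<lambda>\<omega>. W (p (Suc N)) \<omega> - W (p N) \<omega>"
  have S: "S (Suc N) = (\<lambda>\<omega>. S N \<omega> + ?D \<omega> *\<^sub>R \<xi> N \<omega>)"
    by (auto simp: S_def simple_ito_integral_def add.assoc)
  have e: "simple_energy (Suc N) p \<xi> = (\<lambda>\<omega>. simple_energy N p \<xi> \<omega> + (p (Suc N) - p N) * (norm (\<xi> N \<omega>))\<^sup>2)"
    by (auto simp: simple_energy_def)
  have "(\<lambda>\<omega>. S N \<omega> \<bullet> \<xi> N \<omega>) \<in> borel_measurable (F (p N))"
    using IH(1) \<xi>(1) by measurable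
  note cross = increment_moments(1,2)[OF p0 pmon this integrable_inner_sq_integrable[OF IH(2) \<xi>(2)]]
  note sq = sq_integrable_increment_scaleR[OF p0 pmon \<xi>]
  have "(norm (S (Suc N) \<omega>))\<^sup>2 = (norm (S N \<omega>))\<^sup>2 + 2 * (?D \<omega> * (S N \<omega> \<bullet> \<xi> N \<omega>)) + (norm (?D \<omega> *\<^sub>R \<xi> N \<omega>))\<^sup>2" for \<omega>
    unfolding S power2_norm_eq_inner by (simp add: inner_add inner_commute)
  then have "expectation (\<lambda>\<omega>. (norm (S (Suc N) \<omega>))\<^sup>2)
      = expectation (\<lambda>\<omega>. (norm (S N \<omega>))\<^sup>2) + (p (Suc N) - p N) * expectation (\<lambda>\<omega>. (norm (\<xi> N \<omega>))\<^sup>2)"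
    using cross sq IH(2) by (simp add: sq_integrable_def)
  moreover have "S (Suc N) \<in> borel_measurable (F (p (Suc N)))"
  proof -
    have [measurable]: "S N \<in> borel_measurable (F (p (Suc N)))" "\<xi> N \<in> borel_measurable (F (p (Suc N)))"
      "W (p (Suc N)) \<in> borel_measurable (F (p (Suc N)))" "W (p N) \<in> borel_measurable (F (p (Suc N)))"
      using measurable_F_mono[OF pmon IH(1)] measurable_F_mono[OF pmon \<xi>(1)] wiener_measurable_F p0 pmon
      by auto
    show ?thesis unfolding S by measurable
  qed
  moreover have "sq_integrable M (S (Suc N))"
    unfolding S by (intro sq_integrable_add IH(2) sq(1))
  ultimately show ?case
    using IH(3,4) \<xi>(2) by (simp add: e sq_integrable_def)
qed

lemma simple_process_sq_integrable:
  assumes "simple_process F a b N p \<xi>" "i < N"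
  shows "sq_integrable M (\<xi> i)"
proof -
  obtain C where "\<forall>\<omega>\<in>space M. norm (\<xi> i \<omega>) \<le> C"
    using assms by (auto simp: simple_process_def space_F)
  moreover have "\<xi> i \<in> borel_measurable M"
    using assms measurable_F_M[of _ "p i"] by (auto simp: simple_process_def)
  ultimately show ?thesis
    by (intro sq_integrableI_bounded[where C = C]) (auto intro: finite_measure_axioms)
qed

lemma simple_isometry:
  fixes \<xi> :: "nat \<Rightarrow> 'a \<Rightarrow> 'b::euclidean_space"
  assumes "0 \<le> a" "simple_process F a b N p \<xi>" "Y \<in> borel_measurable (F a)" "sq_integrable M Y"
  shows "sq_integrable M (\<lambda>\<omega>. Y \<omega> + simple_ito_integral W N p \<xi> \<omega>)"
    and "integrable M (simple_energy N p \<xi>)"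
    and "expectation (\<lambda>\<omega>. (norm (Y \<omega> + simple_ito_integral W N p \<xi> \<omega>))\<^sup>2)
      = expectation (\<lambda>\<omega>. (norm (Y \<omega>))\<^sup>2) + expectation (simple_energy N p \<xi>)"
  using simple_isometry_aux[of p N \<xi> Y] simple_process_sq_integrable[OF assms(2)] assms
  by (auto simp: simple_process_def)

lemma simple_ito_integral_measurable:
  assumes "0 \<le> a" "simple_process F a b N p \<xi>"
  shows "simple_ito_integral W N p \<xi> \<in> borel_measurable M"
  using simple_isometry(1)[OF assms, of "\<lambda>_. 0"] by (simp add: sq_integrable_def)

text \<open>The integral agrees with that of the process stopped at energy \<open>\<delta>\<close>
  unless the energy exceeds \<open>\<delta>\<close>. The stopped integral has second moment at most
  \<open>\<delta>\<close>, and Markov's inequality gives the second term.\<close>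

lemma simple_ito_integral_tail:
  assumes a: "0 \<le> a" and \<xi>: "simple_process F a b N p \<xi>" and e: "0 < e" "0 \<le> \<delta>"
  shows "prob {\<omega> \<in> space M. e \<le> norm (simple_ito_integral W N p \<xi> \<omega>)}
    \<le> prob {\<omega> \<in> space M. \<delta> < simple_energy N p \<xi> \<omega>} + \<delta> / e\<^sup>2"
proof -
  let ?\<zeta> = "stop_at_energy \<delta> p \<xi>"
  have \<zeta>: "simple_process F a b N p ?\<zeta>"
    by (rule simple_process_stop_at_energy[OF filtration_axiom \<xi>])
  note iso = simple_isometry[OF a \<zeta>, of "\<lambda>_. 0"]
  have [measurable]: "simple_ito_integral W N p \<xi> \<in> borel_measurable M"
    "simple_ito_integral W N p ?\<zeta> \<in> borel_measurable M"
    "simple_energy N p \<xi> \<in> borel_measurable M"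
    using simple_ito_integral_measurable[OF a \<zeta>] simple_ito_integral_measurable[OF a \<xi>]
      simple_isometry(2)[OF a \<xi>, of "\<lambda>_. 0"] by (auto simp: sq_integrable_def)
  have "prob {\<omega> \<in> space M. e\<^sup>2 \<le> (norm (simple_ito_integral W N p ?\<zeta> \<omega>))\<^sup>2}
      \<le> expectation (\<lambda>\<omega>. (norm (simple_ito_integral W N p ?\<zeta> \<omega>))\<^sup>2) / e\<^sup>2"
    using iso(1) e by (intro integral_Markov_inequality_measure[where A = "{}"]) (auto simp: sq_integrable_def)
  also have "\<dots> = expectation (simple_energy N p ?\<zeta>) / e\<^sup>2"
    using iso(3) by (simp add: sq_integrable_def)
  also have "\<dots> \<le> \<delta> / e\<^sup>2"
  proof (rule divide_right_mono)
    have "expectation (simple_energy N p ?\<zeta>) \<le> expectation (\<lambda>_. \<delta>)"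
      using iso(2) simple_energy_stop_at_energy(1)[OF \<xi> e(2)]
      by (intro integral_mono) (auto simp: sq_integrable_def)
    then show "expectation (simple_energy N p ?\<zeta>) \<le> \<delta>" by (simp add: prob_space)
  qed simp
  finally have \<zeta>b: "prob {\<omega> \<in> space M. e\<^sup>2 \<le> (norm (simple_ito_integral W N p ?\<zeta> \<omega>))\<^sup>2} \<le> \<delta> / e\<^sup>2" .
  have "prob {\<omega> \<in> space M. e \<le> norm (simple_ito_integral W N p \<xi> \<omega>)}
    \<le> prob ({\<omega> \<in> space M. \<delta> < simple_energy N p \<xi> \<omega>} \<union> {\<omega> \<in> space M. e\<^sup>2 \<le> (norm (simple_ito_integral W N p ?\<zeta> \<omega>))\<^sup>2})"
  proof (intro finite_measure_mono subsetI)
    fix \<omega> assume \<omega>: "\<omega> \<in> {\<omega> \<in> space M. e \<le> norm (simple_ito_integral W N p \<xi> \<omega>)}"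
    show "\<omega> \<in> {\<omega> \<in> space M. \<delta> < simple_energy N p \<xi> \<omega>} \<union> {\<omega> \<in> space M. e\<^sup>2 \<le> (norm (simple_ito_integral W N p ?\<zeta> \<omega>))\<^sup>2}"
    proof (cases "simple_energy N p \<xi> \<omega> \<le> \<delta>")
      case True
      then have "simple_ito_integral W N p ?\<zeta> \<omega> = simple_ito_integral W N p \<xi> \<omega>"
        by (rule simple_ito_integral_stop_at_energy[OF \<xi>])
      then show ?thesis using \<omega> e by (auto intro!: power_mono)
    qed (use \<omega> in auto)
  qed measurable
  also have "\<dots> \<le> prob {\<omega> \<in> space M. \<delta> < simple_energy N p \<xi> \<omega>} + prob {\<omega> \<in> space M. e\<^sup>2 \<le> (norm (simple_ito_integral W N p ?\<zeta> \<omega>))\<^sup>2}"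
    by (intro measure_Un_le) measurable
  finally show ?thesis using \<zeta>b by linarith
qed

text \<open>Applied to the difference of two approximations of one integrand, this shows that both
  lead to the same stochastic integral.\<close>

lemma simple_ito_integral_null_subseq:
  assumes a: "0 \<le> a" and \<xi>: "\<And>m. simple_process F a b (N m) (p m) (\<xi> m)"
    and lim: "AE \<omega> in M. (\<lambda>m. simple_energy (N m) (p m) (\<xi> m) \<omega>) \<longlonglongrightarrow> 0"
  obtains r where "strict_mono r" "AE \<omega> in M. (\<lambda>m. simple_ito_integral W (N (r m)) (p (r m)) (\<xi> (r m)) \<omega>) \<longlonglongrightarrow> 0"
proof -
  have [measurable]: "simple_energy (N m) (p m) (\<xi> m) \<in> borel_measurable M" for m
    using simple_isometry(2)[OF a \<xi>, of "\<lambda>_. 0"] by (auto simp: sq_integrable_def)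
  have "tendsto_in_prob M (\<lambda>m. simple_ito_integral W (N m) (p m) (\<xi> m)) (\<lambda>_. 0)"
    unfolding tendsto_in_prob_def
  proof (intro conjI allI impI)
    show "simple_ito_integral W (N m) (p m) (\<xi> m) \<in> borel_measurable M" for m
      by (rule simple_ito_integral_measurable[OF a \<xi>])
    fix e :: real assume e: "0 < e"
    show "(\<lambda>m. prob {\<omega> \<in> space M. e \<le> dist (simple_ito_integral W (N m) (p m) (\<xi> m) \<omega>) 0}) \<longlonglongrightarrow> 0"
    proof (rule LIMSEQ_I)
      fix c :: real assume c: "0 < c"
      \<comment> \<open>Makes the Markov term of the tail bound equal to
        \<open>c / 2\<close>.\<close>
      define \<delta> where "\<delta> = c / 2 * e\<^sup>2"
      have \<delta>: "0 < \<delta>" using c e by (simp add: \<delta>_def)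
      have "(\<lambda>m. prob {\<omega> \<in> space M. \<delta> < simple_energy (N m) (p m) (\<xi> m) \<omega>}) \<longlonglongrightarrow> 0"
      proof -
        have "(\<lambda>m. expectation (indicator {\<omega> \<in> space M. \<delta> < simple_energy (N m) (p m) (\<xi> m) \<omega>})) \<longlonglongrightarrow> expectation (\<lambda>_. 0::real)"
        proof (rule integral_dominated_convergence[where w = "\<lambda>_. 1"])
          show "AE \<omega> in M. (\<lambda>m. indicator {\<omega> \<in> space M. \<delta> < simple_energy (N m) (p m) (\<xi> m) \<omega>} \<omega> :: real) \<longlonglongrightarrow> 0"
            using lim
          proof eventually_elim
            case (elim \<omega>)
            then have "eventually (\<lambda>m. simple_energy (N m) (p m) (\<xi> m) \<omega> < \<delta>) sequentially"
              using \<delta> by (rule order_tendstoD)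
            then have "eventually (\<lambda>m. indicator {\<omega> \<in> space M. \<delta> < simple_energy (N m) (p m) (\<xi> m) \<omega>} \<omega> = (0::real)) sequentially"
              by eventually_elim auto
            then show ?case by (rule tendsto_eventually)
          qed
        qed (auto simp: indicator_def)
        then show ?thesis by simp
      qed
      then have "eventually (\<lambda>m. prob {\<omega> \<in> space M. \<delta> < simple_energy (N m) (p m) (\<xi> m) \<omega>} < c / 2) sequentially"
        using c by (intro order_tendstoD) auto
      then obtain m0 where m0: "\<And>m. m \<ge> m0 \<Longrightarrow> prob {\<omega> \<in> space M. \<delta> < simple_energy (N m) (p m) (\<xi> m) \<omega>} < c / 2"
        unfolding eventually_sequentially by blast
      have "prob {\<omega> \<in> space M. e \<le> norm (simple_ito_integral W (N m) (p m) (\<xi> m) \<omega>)} < c" if "m \<ge> m0" for m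
      proof -
        have "\<delta> / e\<^sup>2 = c / 2" using e by (simp add: \<delta>_def)
        then show ?thesis
          using simple_ito_integral_tail[OF a \<xi> e less_imp_le[OF \<delta>], of m] m0[OF that] by linarith
      qed
      then show "\<exists>no. \<forall>m\<ge>no. norm (prob {\<omega> \<in> space M. e \<le> dist (simple_ito_integral W (N m) (p m) (\<xi> m) \<omega>) 0} - 0) < c"
        by (intro exI[of _ m0]) auto
    qed
  qed simp
  from tendsto_in_prob_AE_subseq[OF prob_space_axioms this] that show ?thesis by blast
qed

end

section \<open>Almost sure limits of simple stochastic integrals\<close>

text \<open>A nonnegative integral, so that the triangle inequality holds without integrability and
  a difference that is not square integrable is not mistaken for 0.\<close>

definition sq_dist_on :: "real set \<Rightarrow> (real \<Rightarrow> 'b::euclidean_space) \<Rightarrow> (real \<Rightarrow> 'b) \<Rightarrow> ennreal" where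
  "sq_dist_on A f g = (\<integral>\<^sup>+s\<in>A. ennreal ((norm (f s - g s))\<^sup>2) \<partial>lborel)"

lemma sq_dist_on_commute: "sq_dist_on A f g = sq_dist_on A g f"
  by (simp add: sq_dist_on_def norm_minus_commute)

lemma sq_dist_on_cong:
  "(\<And>s. s \<in> A \<Longrightarrow> f s - g s = f' s - g' s) \<Longrightarrow> sq_dist_on A f g = sq_dist_on A f' g'"
  unfolding sq_dist_on_def by (intro nn_integral_cong) (auto simp: indicator_def)

lemma sq_dist_on_mono: "A \<subseteq> B \<Longrightarrow> sq_dist_on A f g \<le> sq_dist_on B f g"
  unfolding sq_dist_on_def by (intro nn_integral_mono) (auto simp: indicator_def)

lemma sq_dist_measurable:
  fixes f g :: "real \<Rightarrow> 'b::euclidean_space"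
  assumes "set_borel_measurable borel A f" "set_borel_measurable borel A g"
  shows "(\<lambda>s. ennreal ((norm (f s - g s))\<^sup>2) * indicator A s) \<in> borel_measurable lborel"
proof -
  have [measurable]: "(\<lambda>s. indicator A s *\<^sub>R f s) \<in> borel_measurable borel" "(\<lambda>s. indicator A s *\<^sub>R g s) \<in> borel_measurable borel"
    using assms by (auto simp: set_borel_measurable_def)
  have "(\<lambda>s. ennreal ((norm (indicator A s *\<^sub>R f s - indicator A s *\<^sub>R g s))\<^sup>2)) \<in> borel_measurable lborel"
    by measurable
  then show ?thesis by (rule measurable_cong[THEN iffD1, rotated]) (auto simp: indicator_def)
qed

lemma sq_dist_on_triangle:
  fixes f g h :: "real \<Rightarrow> 'b::euclidean_space"
  assumes "set_borel_measurable borel A f" "set_borel_measurable borel A g" "set_borel_measurable borel A h"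
  shows "sq_dist_on A f h \<le> 2 * sq_dist_on A f g + 2 * sq_dist_on A g h"
proof -
  note [measurable] = sq_dist_measurable[OF assms(1,2)] sq_dist_measurable[OF assms(2,3)]
  have "sq_dist_on A f h \<le> (\<integral>\<^sup>+s. 2 * (ennreal ((norm (f s - g s))\<^sup>2) * indicator A s) + 2 * (ennreal ((norm (g s - h s))\<^sup>2) * indicator A s) \<partial>lborel)"
    unfolding sq_dist_on_def
  proof (rule nn_integral_mono)
    fix s
    have "ennreal ((norm (f s - h s))\<^sup>2) \<le> ennreal (2 * (norm (f s - g s))\<^sup>2 + 2 * (norm (g s - h s))\<^sup>2)"
      using norm_add_sq_le[of "f s - g s" "g s - h s"] by (intro ennreal_leI) simp
    also have "\<dots> = 2 * ennreal ((norm (f s - g s))\<^sup>2) + 2 * ennreal ((norm (g s - h s))\<^sup>2)"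
      by (simp add: ennreal_mult)
    finally show "ennreal ((norm (f s - h s))\<^sup>2) * indicator A s \<le> 2 * (ennreal ((norm (f s - g s))\<^sup>2) * indicator A s) + 2 * (ennreal ((norm (g s - h s))\<^sup>2) * indicator A s)"
      by (auto simp: indicator_def)
  qed
  also have "\<dots> = 2 * sq_dist_on A f g + 2 * sq_dist_on A g h"
    unfolding sq_dist_on_def by (simp add: nn_integral_add nn_integral_cmult)
  finally show ?thesis .
qed

lemma set_borel_measurable_simple_value:
  "A \<in> sets borel \<Longrightarrow> set_borel_measurable borel A (\<lambda>s. simple_value N p \<xi> s \<omega>)"
  unfolding set_borel_measurable_def
  by (intro borel_measurable_scaleR borel_measurable_indicator simple_value_measurable)

lemma sq_dist_on_simple_value_0:
  assumes "simple_process F a b N p \<xi>"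
  shows "sq_dist_on {a<..b} (\<lambda>s. simple_value N p \<xi> s \<omega>) (\<lambda>_. 0) = ennreal (simple_energy N p \<xi> \<omega>)"
  unfolding sq_dist_on_def nn_integral_simple_value_sq[OF assms, symmetric]
  using simple_value_outside[OF assms] by (intro nn_integral_cong) (auto simp: indicator_def)

lemma ennreal_tendsto_0_if_le:
  fixes f g h :: "nat \<Rightarrow> ennreal"
  assumes "\<And>n. f n \<le> 2 * g n + 2 * h n" "g \<longlonglongrightarrow> 0" "h \<longlonglongrightarrow> 0"
  shows "f \<longlonglongrightarrow> 0"
proof -
  have "(\<lambda>n. 2 * g n + 2 * h n) \<longlonglongrightarrow> 2 * 0 + 2 * 0"
    using assms by (intro tendsto_intros) auto
  then have "(\<lambda>n. 2 * g n + 2 * h n) \<longlonglongrightarrow> 0" by simp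
  then show ?thesis
    by (rule tendsto_sandwich[OF _ _ tendsto_const, rotated 2]) (use assms(1) in auto)
qed

context wiener_basis
begin

text \<open>
  Compared with \<open>is_ito_integral\<close>, the approximating sequence converges almost surely rather than in
  probability, and nothing is required of the integrand but measurable sections. This is all that
  the second moment bounds use, and it is stable under restriction of the time interval.
\<close>

definition ito_limit :: "real \<Rightarrow> real \<Rightarrow> (real \<Rightarrow> 'a \<Rightarrow> 'b::euclidean_space) \<Rightarrow> ('a \<Rightarrow> 'b) \<Rightarrow> bool" where
  "ito_limit a b H I \<longleftrightarrow>
     I \<in> borel_measurable M \<and> (\<forall>\<omega>\<in>space M. set_borel_measurable borel {a<..b} (\<lambda>s. H s \<omega>)) \<and>
     (\<exists>N p \<xi>. (\<forall>m. simple_process F a b (N m) (p m) (\<xi> m)) \<and>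
        (AE \<omega> in M. (\<lambda>m. sq_dist_on {a<..b} (\<lambda>s. simple_value (N m) (p m) (\<xi> m) s \<omega>) (\<lambda>s. H s \<omega>)) \<longlonglongrightarrow> 0) \<and>
        (AE \<omega> in M. (\<lambda>m. simple_ito_integral W (N m) (p m) (\<xi> m) \<omega>) \<longlonglongrightarrow> I \<omega>))"

text \<open>A first subsequence makes the time integrals converge almost surely, a second one inside
  it the stochastic integrals. The time integrals in the hypothesis are Bochner integrals; they
  agree with \<open>sq_dist_on\<close> because the simple processes and almost every path of
  \<open>H\<close> are square integrable.\<close>

lemma ito_limit_if_is_ito_integral:
  assumes "is_ito_integral M F W a b H I"
  shows "ito_limit a b H I"
proof -
  have H: "(\<lambda>(s, \<omega>). H s \<omega>) \<in> borel_measurable (restrict_space borel {a<..b} \<Otimes>\<^sub>M M)"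
    and Hint: "AE \<omega> in M. set_integrable lborel {a<..b} (\<lambda>s. (norm (H s \<omega>))\<^sup>2)"
    using assms by (auto simp: is_ito_integral_def)
  obtain N p \<xi> where \<xi>: "\<And>m. simple_process F a b (N m) (p m) (\<xi> m)"
    and l1: "tendsto_in_prob M (\<lambda>m \<omega>. LINT s:{a<..b}|lborel. (norm (simple_value (N m) (p m) (\<xi> m) s \<omega> - H s \<omega>))\<^sup>2) (\<lambda>_. 0)"
    and l2: "tendsto_in_prob M (\<lambda>m. simple_ito_integral W (N m) (p m) (\<xi> m)) I"
    using assms unfolding is_ito_integral_def by blast
  obtain r1 where r1: "strict_mono r1"
    and l1': "AE \<omega> in M. (\<lambda>m. LINT s:{a<..b}|lborel. (norm (simple_value (N (r1 m)) (p (r1 m)) (\<xi> (r1 m)) s \<omega> - H s \<omega>))\<^sup>2) \<longlonglongrightarrow> 0"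
    using tendsto_in_prob_AE_subseq[OF prob_space_axioms l1] by blast
  obtain r2 where r2: "strict_mono r2"
    and l2': "AE \<omega> in M. (\<lambda>m. simple_ito_integral W (N (r1 (r2 m))) (p (r1 (r2 m))) (\<xi> (r1 (r2 m))) \<omega>) \<longlonglongrightarrow> I \<omega>"
    using tendsto_in_prob_AE_subseq[OF prob_space_axioms tendsto_in_prob_subseq[OF l2 r1]] by blast
  let ?v = "\<lambda>m s \<omega>. simple_value (N (r1 (r2 m))) (p (r1 (r2 m))) (\<xi> (r1 (r2 m))) s \<omega>"
  have Hs: "set_borel_measurable borel {a<..b} (\<lambda>s. H s \<omega>)" if "\<omega> \<in> space M" for \<omega>
  proof -
    have "(\<lambda>s. (\<lambda>(s, \<omega>). H s \<omega>) (s, \<omega>)) \<in> borel_measurable (restrict_space borel {a<..b})"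
      by (rule measurable_compose[OF _ H]) (use that in measurable)
    then show ?thesis
      unfolding set_borel_measurable_def by (subst (asm) borel_measurable_restrict_space_iff) auto
  qed
  have "AE \<omega> in M. (\<lambda>m. sq_dist_on {a<..b} (\<lambda>s. ?v m s \<omega>) (\<lambda>s. H s \<omega>)) \<longlonglongrightarrow> 0"
    using Hint l1' AE_space
  proof eventually_elim
    case (elim \<omega>)
    have sd: "sq_dist_on {a<..b} (\<lambda>s. ?v m s \<omega>) (\<lambda>s. H s \<omega>)
        = ennreal (LINT s:{a<..b}|lborel. (norm (?v m s \<omega> - H s \<omega>))\<^sup>2)" for m
    proof -
      have meas: "(\<lambda>s. indicator {a<..b} s *\<^sub>R (norm (?v m s \<omega> - H s \<omega>))\<^sup>2) \<in> borel_measurable lborel"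
      proof -
        have [measurable]: "(\<lambda>s. indicator {a<..b} s *\<^sub>R H s \<omega>) \<in> borel_measurable borel"
          using Hs[OF elim(3)] by (simp add: set_borel_measurable_def)
        have "(\<lambda>s. (norm (indicator {a<..b} s *\<^sub>R ?v m s \<omega> - indicator {a<..b} s *\<^sub>R H s \<omega>))\<^sup>2) \<in> borel_measurable lborel"
          by measurable
        then show ?thesis by (rule measurable_cong[THEN iffD1, rotated]) (auto simp: indicator_def)
      qed
      have int: "integrable lborel (\<lambda>s. indicator {a<..b} s *\<^sub>R (norm (?v m s \<omega> - H s \<omega>))\<^sup>2)"
      proof (rule Bochner_Integration.integrable_bound[OF _ meas])
        have "integrable lborel (\<lambda>s. (norm (?v m s \<omega>))\<^sup>2)"
          by (rule integrableI_nn_integral_finite[OF _ _ nn_integral_simple_value_sq[OF \<xi>]]) auto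
        then show "integrable lborel (\<lambda>s. 2 * (norm (?v m s \<omega>))\<^sup>2 + 2 * (indicator {a<..b} s *\<^sub>R (norm (H s \<omega>))\<^sup>2))"
          using elim(1) unfolding set_integrable_def by (intro Bochner_Integration.integrable_add integrable_mult_right)
        have "(norm (?v m s \<omega> - H s \<omega>))\<^sup>2 \<le> 2 * (norm (?v m s \<omega>))\<^sup>2 + 2 * (norm (H s \<omega>))\<^sup>2" for s
          using norm_add_sq_le[of "?v m s \<omega>" "- H s \<omega>"] by simp
        then show "AE s in lborel. norm (indicator {a<..b} s *\<^sub>R (norm (?v m s \<omega> - H s \<omega>))\<^sup>2)
            \<le> norm (2 * (norm (?v m s \<omega>))\<^sup>2 + 2 * (indicator {a<..b} s *\<^sub>R (norm (H s \<omega>))\<^sup>2))"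
          by (auto simp: indicator_def)
      qed
      have "sq_dist_on {a<..b} (\<lambda>s. ?v m s \<omega>) (\<lambda>s. H s \<omega>)
          = (\<integral>\<^sup>+s. ennreal (indicator {a<..b} s *\<^sub>R (norm (?v m s \<omega> - H s \<omega>))\<^sup>2) \<partial>lborel)"
        unfolding sq_dist_on_def by (intro nn_integral_cong) (auto simp: indicator_def)
      also have "\<dots> = ennreal (LINT s:{a<..b}|lborel. (norm (?v m s \<omega> - H s \<omega>))\<^sup>2)"
        unfolding set_lebesgue_integral_def by (intro nn_integral_eq_integral int) auto
      finally show ?thesis .
    qed
    have "(\<lambda>m. LINT s:{a<..b}|lborel. (norm (?v m s \<omega> - H s \<omega>))\<^sup>2) \<longlonglongrightarrow> 0"
      using LIMSEQ_subseq_LIMSEQ[OF elim(2) r2] by (simp add: o_def)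
    then show ?case unfolding sd using tendsto_ennrealI by fastforce
  qed
  moreover have "I \<in> borel_measurable M" using l2 by (simp add: tendsto_in_prob_def)
  ultimately show ?thesis
    unfolding ito_limit_def using Hs \<xi> l2'
    by (intro conjI exI[of _ "\<lambda>m. N (r1 (r2 m))"] exI[of _ "\<lambda>m. p (r1 (r2 m))"] exI[of _ "\<lambda>m. \<xi> (r1 (r2 m))"]) auto
qed

text \<open>Merging with the zero process on a uniform grid refines the partition and changes
  neither the process nor its integral. The vanishing mesh lets indicators of events, evaluated at
  the left ends of cells, converge in the localized moment bound.\<close>

lemma ito_limit_mesh:
  assumes "a \<le> b" "ito_limit a b H I"
  obtains N p \<xi> where "\<And>m. simple_process F a b (N m) (p m) (\<xi> m)"
    "\<And>m i. i < N m \<Longrightarrow> p m (Suc i) - p m i \<le> (b - a) / real (Suc m)"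
    "AE \<omega> in M. (\<lambda>m. sq_dist_on {a<..b} (\<lambda>s. simple_value (N m) (p m) (\<xi> m) s \<omega>) (\<lambda>s. H s \<omega>)) \<longlonglongrightarrow> 0"
    "AE \<omega> in M. (\<lambda>m. simple_ito_integral W (N m) (p m) (\<xi> m) \<omega>) \<longlonglongrightarrow> I \<omega>"
proof -
  obtain N p \<xi> where \<xi>: "\<And>m. simple_process F a b (N m) (p m) (\<xi> m)"
    and l1: "AE \<omega> in M. (\<lambda>m. sq_dist_on {a<..b} (\<lambda>s. simple_value (N m) (p m) (\<xi> m) s \<omega>) (\<lambda>s. H s \<omega>)) \<longlonglongrightarrow> 0"
    and l2: "AE \<omega> in M. (\<lambda>m. simple_ito_integral W (N m) (p m) (\<xi> m) \<omega>) \<longlonglongrightarrow> I \<omega>"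
    using assms(2) unfolding ito_limit_def by blast
  have "\<exists>K r \<zeta>. simple_process F a b K r \<zeta> \<and> (\<forall>k<K. r (Suc k) - r k \<le> (b - a) / real (Suc m)) \<and>
      (\<forall>w \<omega>. simple_ito_integral w K r \<zeta> \<omega> = simple_ito_integral w (N m) (p m) (\<xi> m) \<omega>)" for m
  proof -
    define q where "q j = a + real j * ((b - a) / real (Suc m))" for j
    have q: "q (Suc j) - q j = (b - a) / real (Suc m)" for j
      unfolding q_def of_nat_Suc[of j] distrib_right by simp
    have qs: "simple_process F a b (Suc m) q (\<lambda>_ _. 0 :: 'b)"
      unfolding simple_process_def
    proof (intro conjI allI impI)
      show "q 0 = a" "q (Suc m) = b" by (simp_all add: q_def)
      have "0 \<le> (b - a) / real (Suc m)" using assms(1) by simp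
      then show "q i \<le> q (Suc i)" for i using q[of i] by linarith
    qed auto
    have "0 \<le> (b - a) / real (Suc m)" using assms(1) by simp
    then obtain K r \<zeta> where "simple_process F a b K r \<zeta>" "\<And>k. k < K \<Longrightarrow> r (Suc k) - r k \<le> (b - a) / real (Suc m)"
      "\<And>w \<omega>. simple_ito_integral w K r \<zeta> \<omega> = simple_ito_integral w (N m) (p m) (\<xi> m) \<omega> + simple_ito_integral w (Suc m) q (\<lambda>_ _. 0) \<omega>"
      using simple_process_merge[OF filtration_axiom \<xi>[of m] qs, of "(b - a) / real (Suc m)"] q by (metis order_refl)
    then show ?thesis by (intro exI[of _ K] exI[of _ r] exI[of _ \<zeta>]) (simp add: simple_ito_integral_def)
  qed
  then obtain K r \<zeta> where \<zeta>: "\<And>m. simple_process F a b (K m) (r m) (\<zeta> m)"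
    and mesh: "\<And>m k. k < K m \<Longrightarrow> r m (Suc k) - r m k \<le> (b - a) / real (Suc m)"
    and eq: "\<And>m w \<omega>. simple_ito_integral w (K m) (r m) (\<zeta> m) \<omega> = simple_ito_integral w (N m) (p m) (\<xi> m) \<omega>"
    by metis
  show ?thesis
    using that[OF \<zeta> mesh] l1 l2 by (simp add: eq simple_value_eq_integral[OF \<zeta>] simple_value_eq_integral[OF \<xi>])
qed

text \<open>Cut the approximations on \<open>{a<..v}\<close> at \<open>u\<close>. Their left halves
  and the approximations belonging to \<open>Iu\<close> both tend to \<open>H\<close> on
  \<open>{a<..u}\<close>, so the energy of the difference tends to 0, and along a subsequence so
  does its integral. The right halves then converge to \<open>Iv - Iu\<close>.\<close>

lemma ito_limit_diff:
  assumes a: "0 \<le> a" and u: "a \<le> u" "u \<le> v"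
    and Iv: "ito_limit a v H Iv" and Iu: "ito_limit a u H Iu"
  shows "ito_limit u v H (\<lambda>\<omega>. Iv \<omega> - Iu \<omega>)"
proof -
  obtain N p \<xi> where \<xi>: "\<And>m. simple_process F a v (N m) (p m) (\<xi> m)"
    and l1: "AE \<omega> in M. (\<lambda>m. sq_dist_on {a<..v} (\<lambda>s. simple_value (N m) (p m) (\<xi> m) s \<omega>) (\<lambda>s. H s \<omega>)) \<longlonglongrightarrow> 0"
    and l2: "AE \<omega> in M. (\<lambda>m. simple_ito_integral W (N m) (p m) (\<xi> m) \<omega>) \<longlonglongrightarrow> Iv \<omega>"
    using Iv unfolding ito_limit_def by blast
  obtain N' p' \<xi>' where \<xi>': "\<And>m. simple_process F a u (N' m) (p' m) (\<xi>' m)"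
    and l1': "AE \<omega> in M. (\<lambda>m. sq_dist_on {a<..u} (\<lambda>s. simple_value (N' m) (p' m) (\<xi>' m) s \<omega>) (\<lambda>s. H s \<omega>)) \<longlonglongrightarrow> 0"
    and l2': "AE \<omega> in M. (\<lambda>m. simple_ito_integral W (N' m) (p' m) (\<xi>' m) \<omega>) \<longlonglongrightarrow> Iu \<omega>"
    using Iu unfolding ito_limit_def by blast
  define lp where "lp m i = min u (p m i)" for m i
  define l\<xi> where "l\<xi> m i \<omega> = (if p m i \<le> u then \<xi> m i \<omega> else 0)" for m i \<omega>
  define rp where "rp m i = max u (p m i)" for m i
  note left = simple_process_restrict_left[OF filtration_axiom \<xi> u, folded lp_def l\<xi>_def]
  note right = simple_process_restrict_right[OF filtration_axiom \<xi> u, folded rp_def]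
  have "\<exists>K r \<zeta>. simple_process F a u K r \<zeta> \<and>
      (\<forall>w \<omega>. simple_ito_integral w K r \<zeta> \<omega> = simple_ito_integral w (N m) (lp m) (l\<xi> m) \<omega>
        - simple_ito_integral w (N' m) (p' m) (\<xi>' m) \<omega>)" for m
  proof -
    obtain K r \<zeta> where "simple_process F a u K r \<zeta>"
      "\<And>w \<omega>. simple_ito_integral w K r \<zeta> \<omega> = simple_ito_integral w (N m) (lp m) (l\<xi> m) \<omega>
        + simple_ito_integral w (N' m) (p' m) (\<lambda>i \<omega>. - \<xi>' m i \<omega>) \<omega>"
    proof (rule simple_process_merge[OF filtration_axiom left[of m] simple_process_uminus[OF \<xi>'[of m]], of "u - a"])
      fix j assume j: "j < N' m"
      show "p' m (Suc j) - p' m j \<le> u - a"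
        using simple_process_bounds[OF \<xi>', of "Suc j" m] simple_process_bounds[OF \<xi>', of j m] j by simp
    qed (use u in auto)
    then show ?thesis
      by (intro exI[of _ K] exI[of _ r] exI[of _ \<zeta>]) (simp add: simple_ito_integral_uminus)
  qed
  then obtain K r \<zeta> where \<zeta>: "\<And>m. simple_process F a u (K m) (r m) (\<zeta> m)"
    and \<zeta>eq: "\<And>m w \<omega>. simple_ito_integral w (K m) (r m) (\<zeta> m) \<omega> = simple_ito_integral w (N m) (lp m) (l\<xi> m) \<omega>
        - simple_ito_integral w (N' m) (p' m) (\<xi>' m) \<omega>"
    by metis
  have "AE \<omega> in M. (\<lambda>m. simple_energy (K m) (r m) (\<zeta> m) \<omega>) \<longlonglongrightarrow> 0"
    using l1 l1' AE_space
  proof eventually_elim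
    case (elim \<omega>)
    have bm: "A \<in> sets borel \<Longrightarrow> A \<subseteq> {a<..v} \<Longrightarrow> set_borel_measurable borel A (\<lambda>s. H s \<omega>)" for A
      using Iv elim(3) unfolding ito_limit_def
      by (intro set_borel_measurable_subset[of borel "{a<..v}" _ A]) auto
    have "ennreal (simple_energy (K m) (r m) (\<zeta> m) \<omega>)
        \<le> 2 * sq_dist_on {a<..v} (\<lambda>s. simple_value (N m) (p m) (\<xi> m) s \<omega>) (\<lambda>s. H s \<omega>)
        + 2 * sq_dist_on {a<..u} (\<lambda>s. simple_value (N' m) (p' m) (\<xi>' m) s \<omega>) (\<lambda>s. H s \<omega>)" for m
    proof -
      have "ennreal (simple_energy (K m) (r m) (\<zeta> m) \<omega>)
          = sq_dist_on {a<..u} (\<lambda>s. simple_value (K m) (r m) (\<zeta> m) s \<omega>) (\<lambda>_. 0)"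
        by (rule sq_dist_on_simple_value_0[OF \<zeta>, symmetric])
      also have "\<dots> = sq_dist_on {a<..u} (\<lambda>s. simple_value (N m) (lp m) (l\<xi> m) s \<omega>) (\<lambda>s. simple_value (N' m) (p' m) (\<xi>' m) s \<omega>)"
        by (rule sq_dist_on_cong) (simp add: simple_value_eq_integral[OF \<zeta>] \<zeta>eq simple_value_eq_integral[OF left] simple_value_eq_integral[OF \<xi>'])
      also have "\<dots> = sq_dist_on {a<..u} (\<lambda>s. simple_value (N m) (p m) (\<xi> m) s \<omega>) (\<lambda>s. simple_value (N' m) (p' m) (\<xi>' m) s \<omega>)"
        by (rule sq_dist_on_cong) (simp add: simple_value_restrict(1)[OF filtration_axiom \<xi> u, folded lp_def l\<xi>_def])
      also have "\<dots> \<le> 2 * sq_dist_on {a<..u} (\<lambda>s. simple_value (N m) (p m) (\<xi> m) s \<omega>) (\<lambda>s. H s \<omega>)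
          + 2 * sq_dist_on {a<..u} (\<lambda>s. H s \<omega>) (\<lambda>s. simple_value (N' m) (p' m) (\<xi>' m) s \<omega>)"
        by (intro sq_dist_on_triangle set_borel_measurable_simple_value bm) (use u in auto)
      also have "\<dots> \<le> 2 * sq_dist_on {a<..v} (\<lambda>s. simple_value (N m) (p m) (\<xi> m) s \<omega>) (\<lambda>s. H s \<omega>)
          + 2 * sq_dist_on {a<..u} (\<lambda>s. simple_value (N' m) (p' m) (\<xi>' m) s \<omega>) (\<lambda>s. H s \<omega>)"
        unfolding sq_dist_on_commute[of "{a<..u}" "\<lambda>s. H s \<omega>"]
        by (intro add_mono mult_left_mono sq_dist_on_mono order_refl) (use u in auto)
      finally show ?thesis .
    qed
    then have "(\<lambda>m. ennreal (simple_energy (K m) (r m) (\<zeta> m) \<omega>)) \<longlonglongrightarrow> 0"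
      by (rule ennreal_tendsto_0_if_le) (use elim in auto)
    then show ?case
      using simple_energy_nonneg[OF \<zeta>] by (subst (asm) ennreal_0[symmetric], subst (asm) tendsto_ennreal_iff) auto
  qed
  from simple_ito_integral_null_subseq[OF a \<zeta> this]
  obtain s where s: "strict_mono s" and l3: "AE \<omega> in M. (\<lambda>m. simple_ito_integral W (K (s m)) (r (s m)) (\<zeta> (s m)) \<omega>) \<longlonglongrightarrow> 0"
    by blast
  show ?thesis
    unfolding ito_limit_def
  proof (intro conjI exI allI ballI)
    show "(\<lambda>\<omega>. Iv \<omega> - Iu \<omega>) \<in> borel_measurable M"
      using Iv Iu unfolding ito_limit_def by (intro borel_measurable_diff) auto
    show "set_borel_measurable borel {u<..v} (\<lambda>s. H s \<omega>)" if "\<omega> \<in> space M" for \<omega>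
      using Iv that u unfolding ito_limit_def
      by (intro set_borel_measurable_subset[of borel "{a<..v}" _ "{u<..v}"]) auto
    show "simple_process F u v (N (s m)) (rp (s m)) (\<xi> (s m))" for m by (rule right)
    show "AE \<omega> in M. (\<lambda>m. sq_dist_on {u<..v} (\<lambda>t. simple_value (N (s m)) (rp (s m)) (\<xi> (s m)) t \<omega>) (\<lambda>t. H t \<omega>)) \<longlonglongrightarrow> 0"
      using l1
    proof eventually_elim
      case (elim \<omega>)
      have "(\<lambda>m. sq_dist_on {a<..v} (\<lambda>t. simple_value (N (s m)) (p (s m)) (\<xi> (s m)) t \<omega>) (\<lambda>t. H t \<omega>)) \<longlonglongrightarrow> 0"
        using LIMSEQ_subseq_LIMSEQ[OF elim s] by (simp add: o_def)
      then show ?case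
      proof (rule tendsto_sandwich[OF _ _ tendsto_const, rotated 2], simp, intro always_eventually allI)
        fix m
        have "sq_dist_on {u<..v} (\<lambda>t. simple_value (N (s m)) (rp (s m)) (\<xi> (s m)) t \<omega>) (\<lambda>t. H t \<omega>)
            = sq_dist_on {u<..v} (\<lambda>t. simple_value (N (s m)) (p (s m)) (\<xi> (s m)) t \<omega>) (\<lambda>t. H t \<omega>)"
          by (rule sq_dist_on_cong) (simp add: simple_value_restrict(2)[OF filtration_axiom \<xi> u, folded rp_def])
        also have "\<dots> \<le> sq_dist_on {a<..v} (\<lambda>t. simple_value (N (s m)) (p (s m)) (\<xi> (s m)) t \<omega>) (\<lambda>t. H t \<omega>)"
          using u by (intro sq_dist_on_mono) auto
        finally show "sq_dist_on {u<..v} (\<lambda>t. simple_value (N (s m)) (rp (s m)) (\<xi> (s m)) t \<omega>) (\<lambda>t. H t \<omega>)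
            \<le> sq_dist_on {a<..v} (\<lambda>t. simple_value (N (s m)) (p (s m)) (\<xi> (s m)) t \<omega>) (\<lambda>t. H t \<omega>)" .
      qed
    qed
    show "AE \<omega> in M. (\<lambda>m. simple_ito_integral W (N (s m)) (rp (s m)) (\<xi> (s m)) \<omega>) \<longlonglongrightarrow> Iv \<omega> - Iu \<omega>"
      using l2 l2' l3
    proof eventually_elim
      case (elim \<omega>)
      have eq: "simple_ito_integral W (N m) (rp m) (\<xi> m) \<omega> = simple_ito_integral W (N m) (p m) (\<xi> m) \<omega>
          - simple_ito_integral W (N' m) (p' m) (\<xi>' m) \<omega> - simple_ito_integral W (K m) (r m) (\<zeta> m) \<omega>" for m
        using simple_ito_integral_split[OF \<xi>, of W m \<omega> u, folded lp_def l\<xi>_def rp_def]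
        by (simp add: \<zeta>eq)
      have "(\<lambda>m. simple_ito_integral W (N (s m)) (rp (s m)) (\<xi> (s m)) \<omega>) \<longlonglongrightarrow> Iv \<omega> - Iu \<omega> - 0"
        unfolding eq using LIMSEQ_subseq_LIMSEQ[OF elim(1) s] LIMSEQ_subseq_LIMSEQ[OF elim(2) s] elim(3)
        by (intro tendsto_diff) (auto simp: o_def)
      then show ?case by simp
    qed
  qed
qed

text \<open>\<open>\<eta>\<close> is known at time \<open>u\<close> but need not be bounded, as
  simple processes are. It is truncated at level \<open>m\<close>, and at each point the truncation
  is eventually inactive. With \<open>- g (X u)\<close> for \<open>\<eta>\<close> this turns the
  integrand \<open>g (X s)\<close> into the small \<open>g (X s) - g (X u)\<close>.\<close>

lemma ito_limit_add_initial:
  assumes uv: "u < v" and I: "ito_limit u v H I" and \<eta>: "\<eta> \<in> borel_measurable (F u)" and u: "0 \<le> u"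
  shows "ito_limit u v (\<lambda>s \<omega>. H s \<omega> + \<eta> \<omega>) (\<lambda>\<omega>. I \<omega> + (W v \<omega> - W u \<omega>) *\<^sub>R \<eta> \<omega>)"
proof -
  obtain N p \<xi> where \<xi>: "\<And>m. simple_process F u v (N m) (p m) (\<xi> m)"
    and l1: "AE \<omega> in M. (\<lambda>m. sq_dist_on {u<..v} (\<lambda>s. simple_value (N m) (p m) (\<xi> m) s \<omega>) (\<lambda>s. H s \<omega>)) \<longlonglongrightarrow> 0"
    and l2: "AE \<omega> in M. (\<lambda>m. simple_ito_integral W (N m) (p m) (\<xi> m) \<omega>) \<longlonglongrightarrow> I \<omega>"
    using I unfolding ito_limit_def by blast
  define \<eta>' where "\<eta>' m \<omega> = (if norm (\<eta> \<omega>) \<le> real m then \<eta> \<omega> else 0)" for m \<omega>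
  define \<zeta> where "\<zeta> m i \<omega> = \<xi> m i \<omega> + \<eta>' m \<omega>" for m i \<omega>
  have \<eta>'m: "\<eta>' m \<in> borel_measurable (F u)" for m
    unfolding \<eta>'_def[abs_def] using \<eta> by measurable
  have \<zeta>: "simple_process F u v (N m) (p m) (\<zeta> m)" for m
    unfolding simple_process_def
  proof (intro conjI allI impI)
    show "p m 0 = u" "p m (N m) = v" using \<xi>[of m] by (auto simp: simple_process_def)
    fix i assume i: "i < N m"
    show "p m i \<le> p m (Suc i)" using \<xi>[of m] i by (auto simp: simple_process_def)
    have "\<eta>' m \<in> borel_measurable (F (p m i))"
      using i by (intro measurable_F_mono[OF _ \<eta>'m]) (auto intro: simple_process_bounds[OF \<xi>])
    moreover have "\<xi> m i \<in> borel_measurable (F (p m i))"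
      using \<xi>[of m] i by (auto simp: simple_process_def)
    ultimately show "\<zeta> m i \<in> borel_measurable (F (p m i))" unfolding \<zeta>_def[abs_def] by simp
    obtain C where C: "\<forall>\<omega>\<in>space M. norm (\<xi> m i \<omega>) \<le> C"
      using \<xi>[of m] i by (auto simp: simple_process_def space_F)
    have "norm (\<zeta> m i \<omega>) \<le> C + real m" if "\<omega> \<in> space M" for \<omega>
    proof -
      have "norm (\<eta>' m \<omega>) \<le> real m" by (simp add: \<eta>'_def)
      then show ?thesis using C that norm_triangle_ineq[of "\<xi> m i \<omega>" "\<eta>' m \<omega>"] unfolding \<zeta>_def by force
    qed
    then show "\<exists>C. \<forall>\<omega>\<in>space (F (p m i)). norm (\<zeta> m i \<omega>) \<le> C" by (auto simp: space_F)
  qed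
  have ev: "eventually (\<lambda>m. \<eta>' m \<omega> = \<eta> \<omega>) sequentially" for \<omega>
  proof -
    obtain m0 :: nat where m0: "norm (\<eta> \<omega>) \<le> real m0" using real_arch_simple by blast
    have "\<eta>' m \<omega> = \<eta> \<omega>" if "m \<ge> m0" for m using m0 that by (auto simp: \<eta>'_def)
    then show ?thesis unfolding eventually_sequentially by blast
  qed
  have val: "simple_value (N m) (p m) (\<zeta> m) s \<omega> = simple_value (N m) (p m) (\<xi> m) s \<omega> + \<eta>' m \<omega>" if "s \<in> {u<..v}" for m s \<omega>
    by (rule simple_value_exists_cell[OF \<xi>[of m] that])
      (simp add: simple_value_cell[OF \<xi>] simple_value_cell[OF \<zeta>] \<zeta>_def)
  have int: "simple_ito_integral W (N m) (p m) (\<zeta> m) \<omega> = simple_ito_integral W (N m) (p m) (\<xi> m) \<omega> + (W v \<omega> - W u \<omega>) *\<^sub>R \<eta>' m \<omega>" for m \<omega>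
  proof -
    have "(\<Sum>i<N m. (W (p m (Suc i)) \<omega> - W (p m i) \<omega>) *\<^sub>R \<eta>' m \<omega>) = (W v \<omega> - W u \<omega>) *\<^sub>R \<eta>' m \<omega>"
      unfolding scaleR_sum_left[symmetric] using \<xi>[of m]
      by (subst sum_lessThan_telescope[where f = "\<lambda>i. W (p m i) \<omega>"]) (simp add: simple_process_def)
    then show ?thesis
      by (simp add: simple_ito_integral_def \<zeta>_def scaleR_add_right sum.distrib)
  qed
  have [measurable]: "W u \<in> borel_measurable M" "W v \<in> borel_measurable M" "\<eta> \<in> borel_measurable M" "I \<in> borel_measurable M"
    using wiener_measurable u uv measurable_F_M[OF \<eta>] I by (auto simp: ito_limit_def)
  show ?thesis
    unfolding ito_limit_def
  proof (intro conjI exI[of _ N] exI[of _ p] exI[of _ \<zeta>] allI ballI, goal_cases)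
    case 1
    show ?case by measurable
  next
    case (2 \<omega>)
    then have "(\<lambda>s. indicator {u<..v} s *\<^sub>R H s \<omega>) \<in> borel_measurable borel"
      using I by (auto simp: ito_limit_def set_borel_measurable_def)
    then have "(\<lambda>s. indicator {u<..v} s *\<^sub>R H s \<omega> + indicator {u<..v} s *\<^sub>R \<eta> \<omega>) \<in> borel_measurable borel"
      by measurable
    then show ?case by (simp add: set_borel_measurable_def scaleR_add_right)
  next
    case (3 m)
    show ?case by (rule \<zeta>)
  next
    case 4
    show ?case
      using l1
    proof eventually_elim
      case (elim \<omega>)
      have "eventually (\<lambda>m. sq_dist_on {u<..v} (\<lambda>s. simple_value (N m) (p m) (\<xi> m) s \<omega>) (\<lambda>s. H s \<omega>)
        = sq_dist_on {u<..v} (\<lambda>s. simple_value (N m) (p m) (\<zeta> m) s \<omega>) (\<lambda>s. H s \<omega> + \<eta> \<omega>)) sequentially"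
        using ev[of \<omega>]
      proof eventually_elim
        case (elim m)
        then show ?case by (intro sq_dist_on_cong) (simp add: val)
      qed
      then show ?case by (rule Lim_transform_eventually[OF elim])
    qed
  next
    case 5
    show ?case
      using l2
    proof eventually_elim
      case (elim \<omega>)
      have "(\<lambda>m. simple_ito_integral W (N m) (p m) (\<xi> m) \<omega> + (W v \<omega> - W u \<omega>) *\<^sub>R \<eta>' m \<omega>) \<longlonglongrightarrow> I \<omega> + (W v \<omega> - W u \<omega>) *\<^sub>R \<eta> \<omega>"
        by (intro tendsto_add elim tendsto_scaleR tendsto_const tendsto_eventually ev)
      then show ?case by (simp add: int)
    qed
  qed
qed

end

section \<open>The localized second moment bound and orthogonality\<close>

context wiener_basis
begin

text \<open>
  Stopping the approximating simple processes at energy \<open>K\<close> turns almost sure convergence into a bound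
  on second moments by Fatou's lemma; then \<open>K\<close> tends to infinity. The decreasing events \<open>G\<close> play the
  role of \<open>{\<tau> \<ge> s}\<close> for a stopping time \<open>\<tau>\<close>.
\<close>

lemma ito_limit_bound:
  fixes H :: "real \<Rightarrow> 'a \<Rightarrow> 'b::euclidean_space"
  assumes ab: "0 \<le> a" "a \<le> b" and I: "ito_limit a b H I"
    and Y: "Y \<in> borel_measurable (F a)" "sq_integrable M Y"
    and Gm: "\<And>s. a \<le> s \<Longrightarrow> s \<le> b \<Longrightarrow> G s \<in> sets (F s)"
    and Gdec: "\<And>s t. a \<le> s \<Longrightarrow> s \<le> t \<Longrightarrow> t \<le> b \<Longrightarrow> G t \<subseteq> G s"
    and Glc: "\<And>s \<omega>. a < s \<Longrightarrow> s \<le> b \<Longrightarrow> (\<And>t. a \<le> t \<Longrightarrow> t < s \<Longrightarrow> \<omega> \<in> G t) \<Longrightarrow> \<omega> \<in> G s"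
  shows "(\<integral>\<^sup>+\<omega>\<in>G b. ennreal ((norm (Y \<omega> + I \<omega>))\<^sup>2) \<partial>M)
    \<le> (\<integral>\<^sup>+\<omega>. ennreal ((norm (Y \<omega>))\<^sup>2)
        + 2 * (\<integral>\<^sup>+s\<in>{a<..b}. ennreal ((norm (H s \<omega>))\<^sup>2) * indicator (G s) \<omega> \<partial>lborel) \<partial>M)"
proof -
  obtain N p \<xi> where \<xi>: "\<And>m. simple_process F a b (N m) (p m) (\<xi> m)"
    and mesh: "\<And>m i. i < N m \<Longrightarrow> p m (Suc i) - p m i \<le> (b - a) / real (Suc m)"
    and l1: "AE \<omega> in M. (\<lambda>m. sq_dist_on {a<..b} (\<lambda>s. simple_value (N m) (p m) (\<xi> m) s \<omega>) (\<lambda>s. H s \<omega>)) \<longlonglongrightarrow> 0"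
    and l2: "AE \<omega> in M. (\<lambda>m. simple_ito_integral W (N m) (p m) (\<xi> m) \<omega>) \<longlonglongrightarrow> I \<omega>"
    using ito_limit_mesh[OF ab(2) I] by blast
  define A where "A \<omega> = (\<integral>\<^sup>+s\<in>{a<..b}. ennreal ((norm (H s \<omega>))\<^sup>2) * indicator (G s) \<omega> \<partial>lborel)" for \<omega>
  \<comment> \<open>The indicator of the events, frozen at the left end of each cell, is itself a
    simple process; multiplication by it localizes \<open>\<xi>\<close> without looking
    ahead.\<close>
  define \<eta> where "\<eta> m i \<omega> = (indicator (G (p m i)) \<omega> :: real)" for m i \<omega>
  define \<zeta> where "\<zeta> m i \<omega> = \<eta> m i \<omega> *\<^sub>R \<xi> m i \<omega>" for m i \<omega>
  have pb: "a \<le> p m i" "p m i \<le> b" if "i \<le> N m" for m i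
    using simple_process_bounds[OF \<xi> that] by auto
  have \<eta>: "simple_process F a b (N m) (p m) (\<eta> m)" for m
    unfolding simple_process_def
  proof (intro conjI allI impI)
    show "p m 0 = a" "p m (N m) = b" using \<xi>[of m] by (auto simp: simple_process_def)
    fix i assume i: "i < N m"
    show "p m i \<le> p m (Suc i)" using \<xi>[of m] i by (auto simp: simple_process_def)
    show "\<eta> m i \<in> borel_measurable (F (p m i))"
      unfolding \<eta>_def[abs_def] using i by (intro borel_measurable_indicator Gm pb) auto
    show "\<exists>C. \<forall>\<omega>\<in>space (F (p m i)). norm (\<eta> m i \<omega>) \<le> C"
      by (intro exI[of _ 1]) (simp add: \<eta>_def indicator_def)
  qed
  have \<zeta>: "simple_process F a b (N m) (p m) (\<zeta> m)" for m
    unfolding simple_process_def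
  proof (intro conjI allI impI)
    show "p m 0 = a" "p m (N m) = b" using \<xi>[of m] by (auto simp: simple_process_def)
    fix i assume i: "i < N m"
    show "p m i \<le> p m (Suc i)" using \<xi>[of m] i by (auto simp: simple_process_def)
    show "\<zeta> m i \<in> borel_measurable (F (p m i))"
      unfolding \<zeta>_def[abs_def] using \<xi>[of m] \<eta>[of m] i
      by (intro borel_measurable_scaleR) (auto simp: simple_process_def)
    obtain C where C: "\<forall>\<omega>\<in>space M. norm (\<xi> m i \<omega>) \<le> C"
      using \<xi>[of m] i by (auto simp: simple_process_def space_F)
    then have "\<forall>\<omega>\<in>space M. norm (\<zeta> m i \<omega>) \<le> \<bar>C\<bar>" by (force simp: \<zeta>_def \<eta>_def indicator_def)
    then show "\<exists>C. \<forall>\<omega>\<in>space (F (p m i)). norm (\<zeta> m i \<omega>) \<le> C" unfolding space_F by blast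
  qed
  \<comment> \<open>For almost every \<omega> the energies of the localized processes are dominated
    by a sequence that tends to \<open>2 * A \<omega>\<close>. The 2 arises when the simple process
    is replaced by \<open>H\<close> plus the approximation error.\<close>
  have bd: "AE \<omega> in M. A \<omega> < \<infinity> \<and> (\<exists>B. (\<forall>m. ennreal (simple_energy (N m) (p m) (\<zeta> m) \<omega>) \<le> B m) \<and> B \<longlonglongrightarrow> 2 * A \<omega>)"
    using l1 AE_space
  proof eventually_elim
    case (elim \<omega>)
    define Err where "Err m = sq_dist_on {a<..b} (\<lambda>s. simple_value (N m) (p m) (\<xi> m) s \<omega>) (\<lambda>s. H s \<omega>)" for m
    define h where "h s = ennreal ((norm (H s \<omega>))\<^sup>2) * indicator {a<..b} s" for s
    define gm where "gm m s = simple_value (N m) (p m) (\<eta> m) s \<omega>" for m s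
    have Hm: "set_borel_measurable borel {a<..b} (\<lambda>s. H s \<omega>)"
      using I elim(2) by (simp add: ito_limit_def)
    have hm [measurable]: "h \<in> borel_measurable lborel"
      using sq_dist_measurable[OF Hm, of "\<lambda>_. 0"] by (simp add: h_def[abs_def] set_borel_measurable_def)
    have Errm: "(\<lambda>s. ennreal ((norm (simple_value (N m) (p m) (\<xi> m) s \<omega> - H s \<omega>))\<^sup>2) * indicator {a<..b} s) \<in> borel_measurable lborel" for m
      by (rule sq_dist_measurable[OF set_borel_measurable_simple_value Hm]) simp
    have [measurable]: "gm m \<in> borel_measurable lborel" for m
      unfolding gm_def[abs_def] measurable_lborel2 by (rule simple_value_measurable)
    have gm01: "gm m s = 0 \<or> gm m s = 1" for m s
    proof (cases "s \<in> {a<..b}")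
      case True
      show ?thesis
        by (rule simple_value_exists_cell[OF \<eta> True, of m]) (simp add: gm_def simple_value_cell[OF \<eta>] \<eta>_def indicator_def)
    qed (simp add: gm_def simple_value_outside[OF \<eta>])
    have hfin: "(\<integral>\<^sup>+s. h s \<partial>lborel) < \<infinity>"
    proof -
      have "eventually (\<lambda>m. Err m < 1) sequentially"
        using elim(1) unfolding Err_def by (rule order_tendstoD) simp
      then obtain m where m: "Err m < 1" by (auto simp: eventually_sequentially)
      have "(\<integral>\<^sup>+s. h s \<partial>lborel) = sq_dist_on {a<..b} (\<lambda>s. H s \<omega>) (\<lambda>_. 0)"
        by (simp add: sq_dist_on_def h_def)
      also have "\<dots> \<le> 2 * sq_dist_on {a<..b} (\<lambda>s. H s \<omega>) (\<lambda>s. simple_value (N m) (p m) (\<xi> m) s \<omega>)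
          + 2 * sq_dist_on {a<..b} (\<lambda>s. simple_value (N m) (p m) (\<xi> m) s \<omega>) (\<lambda>_. 0)"
        by (intro sq_dist_on_triangle Hm set_borel_measurable_simple_value) (auto simp: set_borel_measurable_def)
      also have "\<dots> = 2 * Err m + 2 * ennreal (simple_energy (N m) (p m) (\<xi> m) \<omega>)"
        by (simp add: sq_dist_on_commute[of _ "\<lambda>s. H s \<omega>"] Err_def sq_dist_on_simple_value_0[OF \<xi>])
      also have "\<dots> < \<infinity>"
        using m by (auto simp: ennreal_mult_less_top intro: order.strict_trans[of _ 1])
      finally show ?thesis .
    qed
    \<comment> \<open>The cell containing \<open>s\<close> starts strictly before \<open>s\<close>,
      at a distance that tends to 0. If \<omega> lies in \<open>G s\<close>, it lies in all earlier
      events. Otherwise \<open>Glc\<close> provides some \<open>t < s\<close> with \<omega> outside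
      \<open>G t\<close>, and fine cells start after \<open>t\<close>.\<close>
    have lim: "(\<lambda>m. gm m s) \<longlonglongrightarrow> indicator (G s) \<omega>" if s: "s \<in> {a<..b}" for s
    proof -
      have cell: "\<exists>t. a \<le> t \<and> t < s \<and> s - t \<le> (b - a) / real (Suc m) \<and> gm m s = indicator (G t) \<omega>" for m
      proof (rule simple_value_exists_cell[OF \<eta> s, of m])
        fix i assume i: "i < N m" "p m i < s" "s \<le> p m (Suc i)"
        show ?thesis
          using i mesh[OF i(1)] pb[of i m]
          by (intro exI[of _ "p m i"]) (auto simp: gm_def simple_value_cell[OF \<eta> i] \<eta>_def)
      qed
      show ?thesis
      proof (cases "\<omega> \<in> G s")
        case True
        have "gm m s = 1" for m
        proof -
          obtain t where t: "a \<le> t" "t < s" "gm m s = indicator (G t) \<omega>" using cell[of m] by blast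
          have "\<omega> \<in> G t" using Gdec[of t s] t s True by auto
          then show ?thesis using t by simp
        qed
        then show ?thesis using True by simp
      next
        case False
        then obtain t where t: "a \<le> t" "t < s" "\<omega> \<notin> G t" using Glc[of s \<omega>] s by auto
        obtain m0 where m0: "(b - a) / (s - t) < real m0" using reals_Archimedean2 by blast
        have "gm m s = 0" if "m \<ge> m0" for m
        proof -
          obtain t' where t': "a \<le> t'" "t' < s" "s - t' \<le> (b - a) / real (Suc m)" "gm m s = indicator (G t') \<omega>"
            using cell[of m] by blast
          have "(b - a) / (s - t) < real (Suc m)" using m0 that by simp
          then have "(b - a) / real (Suc m) < s - t" using t(2) by (simp add: field_simps)
          then have "t \<le> t'" using t' by linarith
          then have "\<omega> \<notin> G t'" using Gdec[of t t'] t t' s by auto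
          then show ?thesis using t' by simp
        qed
        then have "eventually (\<lambda>m. gm m s = 0) sequentially" unfolding eventually_sequentially by blast
        then show ?thesis using False by (simp add: tendsto_eventually)
      qed
    qed
    have lim': "(\<lambda>m. h s * ennreal (gm m s)) \<longlonglongrightarrow> h s * indicator (G s) \<omega>" for s
    proof (cases "s \<in> {a<..b}")
      case True
      have "(\<lambda>m. ennreal (gm m s)) \<longlonglongrightarrow> ennreal (indicator (G s) \<omega>)"
        by (intro tendsto_ennrealI lim True)
      moreover have "h s \<noteq> top" by (simp add: h_def indicator_def)
      moreover have "indicator (G s) \<omega> \<noteq> (top :: ennreal)" by (simp add: indicator_def)
      ultimately show ?thesis
        by (intro tendsto_mult_ennreal tendsto_const) (auto simp: ennreal_indicator)
    qed (simp add: h_def)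
    have Aeq: "A \<omega> = (\<integral>\<^sup>+s. h s * indicator (G s) \<omega> \<partial>lborel)"
      unfolding A_def h_def by (simp add: mult_ac)
    have Alim: "(\<lambda>m. \<integral>\<^sup>+s. h s * ennreal (gm m s) \<partial>lborel) \<longlonglongrightarrow> A \<omega>"
      unfolding Aeq
    proof (rule nn_integral_dominated_convergence[where w = h])
      show "(\<lambda>s. h s * indicator (G s) \<omega>) \<in> borel_measurable lborel"
        by (rule borel_measurable_LIMSEQ_order[OF lim']) measurable
      show "AE s in lborel. h s * ennreal (gm m s) \<le> h s" for m
      proof (rule AE_I2)
        show "h s * ennreal (gm m s) \<le> h s" for s using gm01[of m s] by auto
      qed
    qed (use hfin lim' in auto)
    have Afin: "A \<omega> < \<infinity>"
    proof -
      have "A \<omega> \<le> (\<integral>\<^sup>+s. h s \<partial>lborel)"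
        unfolding Aeq by (intro nn_integral_mono) (auto simp: indicator_def)
      then show ?thesis using hfin by simp
    qed
    have en: "ennreal (simple_energy (N m) (p m) (\<zeta> m) \<omega>) \<le> 2 * (\<integral>\<^sup>+s. h s * ennreal (gm m s) \<partial>lborel) + 2 * Err m" for m
    proof -
      have "ennreal (simple_energy (N m) (p m) (\<zeta> m) \<omega>)
          = sq_dist_on {a<..b} (\<lambda>s. simple_value (N m) (p m) (\<zeta> m) s \<omega>) (\<lambda>_. 0)"
        by (rule sq_dist_on_simple_value_0[OF \<zeta>, symmetric])
      also have "\<dots> \<le> (\<integral>\<^sup>+s. 2 * (h s * ennreal (gm m s)) + 2 * (ennreal ((norm (simple_value (N m) (p m) (\<xi> m) s \<omega> - H s \<omega>))\<^sup>2) * indicator {a<..b} s) \<partial>lborel)"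
        unfolding sq_dist_on_def
      proof (rule nn_integral_mono)
        fix s
        show "ennreal ((norm (simple_value (N m) (p m) (\<zeta> m) s \<omega> - 0))\<^sup>2) * indicator {a<..b} s
          \<le> 2 * (h s * ennreal (gm m s)) + 2 * (ennreal ((norm (simple_value (N m) (p m) (\<xi> m) s \<omega> - H s \<omega>))\<^sup>2) * indicator {a<..b} s)"
        proof (cases "s \<in> {a<..b}")
          case True
          have val: "simple_value (N m) (p m) (\<zeta> m) s \<omega> = gm m s *\<^sub>R simple_value (N m) (p m) (\<xi> m) s \<omega>"
            by (rule simple_value_exists_cell[OF \<eta> True, of m])
              (simp add: gm_def simple_value_cell[OF \<eta>] simple_value_cell[OF \<zeta>] simple_value_cell[OF \<xi>] \<zeta>_def)
          have "ennreal ((norm (simple_value (N m) (p m) (\<xi> m) s \<omega>))\<^sup>2)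
              \<le> ennreal (2 * (norm (H s \<omega>))\<^sup>2 + 2 * (norm (simple_value (N m) (p m) (\<xi> m) s \<omega> - H s \<omega>))\<^sup>2)"
            using norm_add_sq_le[of "H s \<omega>" "simple_value (N m) (p m) (\<xi> m) s \<omega> - H s \<omega>"]
            by (intro ennreal_leI) simp
          then show ?thesis
            using gm01[of m s] True by (auto simp: val h_def ennreal_mult)
        qed simp
      qed
      also have "\<dots> = 2 * (\<integral>\<^sup>+s. h s * ennreal (gm m s) \<partial>lborel) + 2 * Err m"
        unfolding Err_def sq_dist_on_def using Errm[of m] by (simp add: nn_integral_add nn_integral_cmult)
      finally show ?thesis .
    qed
    have "(\<lambda>m. 2 * (\<integral>\<^sup>+s. h s * ennreal (gm m s) \<partial>lborel) + 2 * Err m) \<longlonglongrightarrow> 2 * A \<omega> + 2 * 0"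
      using Alim elim(1) unfolding Err_def by (intro tendsto_add tendsto_mult_ennreal tendsto_const) auto
    then have "(\<lambda>m. 2 * (\<integral>\<^sup>+s. h s * ennreal (gm m s) \<partial>lborel) + 2 * Err m) \<longlonglongrightarrow> 2 * A \<omega>" by simp
    with Afin en show ?case
      by (intro conjI exI[of _ "\<lambda>m. 2 * (\<integral>\<^sup>+s. h s * ennreal (gm m s) \<partial>lborel) + 2 * Err m"]) auto
  qed
  \<comment> \<open>Stopping at energy \<open>K\<close> supplies the integrable majorant, the
    squared norm of \<open>Y\<close> plus \<open>K\<close>, for the reverse Fatou lemma in
    \<open>step2\<close>.\<close>
  define Z where "Z K m = stop_at_energy (real K) (p m) (\<zeta> m)" for K m
  have Z: "simple_process F a b (N m) (p m) (Z K m)" for K m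
    unfolding Z_def by (rule simple_process_stop_at_energy[OF filtration_axiom \<zeta>])
  note iso = simple_isometry[OF ab(1) Z Y]
  define f where "f K m \<omega> = ennreal ((norm (Y \<omega> + simple_ito_integral W (N m) (p m) (Z K m) \<omega>))\<^sup>2) * indicator (G b) \<omega>" for K m \<omega>
  have Gb: "G b \<in> sets M" using Gm[of b] ab subalg[of b] by (auto simp: subalgebra_def)
  have [measurable]: "Y \<in> borel_measurable M" "I \<in> borel_measurable M"
    "simple_ito_integral W (N m) (p m) (Z K m) \<in> borel_measurable M" for K m
    using Y(2) I simple_ito_integral_measurable[OF ab(1) Z] by (auto simp: sq_integrable_def ito_limit_def)
  have [measurable]: "f K m \<in> borel_measurable M" for K m
    unfolding f_def[abs_def] using Gb by measurable
  define u where "u K m \<omega> = ennreal ((norm (Y \<omega>))\<^sup>2) + ennreal (simple_energy (N m) (p m) (Z K m) \<omega>)" for K m \<omega>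
  have um [measurable]: "u K m \<in> borel_measurable M" for K m
  proof -
    have [measurable]: "simple_energy (N m) (p m) (Z K m) \<in> borel_measurable M"
      using iso(2) by (rule borel_measurable_integrable)
    show ?thesis unfolding u_def[abs_def] by measurable
  qed
  have fu: "(\<integral>\<^sup>+\<omega>. f K m \<omega> \<partial>M) \<le> (\<integral>\<^sup>+\<omega>. u K m \<omega> \<partial>M)" for K m
  proof -
    have "(\<integral>\<^sup>+\<omega>. f K m \<omega> \<partial>M) \<le> (\<integral>\<^sup>+\<omega>. ennreal ((norm (Y \<omega> + simple_ito_integral W (N m) (p m) (Z K m) \<omega>))\<^sup>2) \<partial>M)"
      unfolding f_def by (intro nn_integral_mono) (auto simp: indicator_def)
    also have "\<dots> = ennreal (expectation (\<lambda>\<omega>. (norm (Y \<omega> + simple_ito_integral W (N m) (p m) (Z K m) \<omega>))\<^sup>2))"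
      using iso(1) by (intro nn_integral_eq_integral) (auto simp: sq_integrable_def)
    also have "\<dots> = ennreal (expectation (\<lambda>\<omega>. (norm (Y \<omega>))\<^sup>2 + simple_energy (N m) (p m) (Z K m) \<omega>))"
      using iso(2,3) Y(2) by (simp add: sq_integrable_def)
    also have "\<dots> = (\<integral>\<^sup>+\<omega>. ennreal ((norm (Y \<omega>))\<^sup>2 + simple_energy (N m) (p m) (Z K m) \<omega>) \<partial>M)"
      using iso(2) Y(2) simple_energy_nonneg[OF Z]
      by (intro nn_integral_eq_integral[symmetric]) (auto simp: sq_integrable_def)
    also have "\<dots> = (\<integral>\<^sup>+\<omega>. u K m \<omega> \<partial>M)"
      unfolding u_def using simple_energy_nonneg[OF Z] by (intro nn_integral_cong ennreal_plus) auto
    finally show ?thesis .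
  qed
  have step2: "liminf (\<lambda>m. \<integral>\<^sup>+\<omega>. f K m \<omega> \<partial>M) \<le> (\<integral>\<^sup>+\<omega>. ennreal ((norm (Y \<omega>))\<^sup>2) + 2 * A \<omega> \<partial>M)" for K
  proof -
    have "liminf (\<lambda>m. \<integral>\<^sup>+\<omega>. f K m \<omega> \<partial>M) \<le> limsup (\<lambda>m. \<integral>\<^sup>+\<omega>. f K m \<omega> \<partial>M)"
      by (rule Liminf_le_Limsup) simp
    also have "\<dots> \<le> limsup (\<lambda>m. \<integral>\<^sup>+\<omega>. u K m \<omega> \<partial>M)"
      by (intro Limsup_mono always_eventually allI fu)
    also have "\<dots> \<le> (\<integral>\<^sup>+\<omega>. limsup (\<lambda>m. u K m \<omega>) \<partial>M)"
    proof (rule nn_integral_limsup[where w = "\<lambda>\<omega>. ennreal ((norm (Y \<omega>))\<^sup>2 + real K)"])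
      show "AE \<omega> in M. u K m \<omega> \<le> ennreal ((norm (Y \<omega>))\<^sup>2 + real K)" for m
      proof (rule AE_I2)
        fix \<omega>
        have "simple_energy (N m) (p m) (Z K m) \<omega> \<le> real K"
          unfolding Z_def by (rule simple_energy_stop_at_energy(1)[OF \<zeta>]) simp
        then show "u K m \<omega> \<le> ennreal ((norm (Y \<omega>))\<^sup>2 + real K)"
          using simple_energy_nonneg[OF Z, of m K \<omega>]
          unfolding u_def by (subst ennreal_plus[symmetric]) (auto intro: ennreal_leI)
      qed
      have "integrable M (\<lambda>\<omega>. (norm (Y \<omega>))\<^sup>2 + real K)"
        using Y(2) by (auto simp: sq_integrable_def)
      then show "(\<integral>\<^sup>+\<omega>. ennreal ((norm (Y \<omega>))\<^sup>2 + real K) \<partial>M) < \<infinity>"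
        by (subst nn_integral_eq_integral) auto
    qed measurable
    also have "\<dots> \<le> (\<integral>\<^sup>+\<omega>. ennreal ((norm (Y \<omega>))\<^sup>2) + 2 * A \<omega> \<partial>M)"
    proof (rule nn_integral_mono_AE)
      show "AE \<omega> in M. limsup (\<lambda>m. u K m \<omega>) \<le> ennreal ((norm (Y \<omega>))\<^sup>2) + 2 * A \<omega>"
        using bd
      proof eventually_elim
        case (elim \<omega>)
        then obtain B where B: "\<And>m. ennreal (simple_energy (N m) (p m) (\<zeta> m) \<omega>) \<le> B m" "B \<longlonglongrightarrow> 2 * A \<omega>"
          by blast
        have "limsup (\<lambda>m. u K m \<omega>) \<le> limsup (\<lambda>m. ennreal ((norm (Y \<omega>))\<^sup>2) + B m)"
        proof (intro Limsup_mono always_eventually allI)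
          fix m
          have "simple_energy (N m) (p m) (Z K m) \<omega> \<le> simple_energy (N m) (p m) (\<zeta> m) \<omega>"
            unfolding Z_def by (rule simple_energy_stop_at_energy(2)[OF \<zeta>]) simp
          then show "u K m \<omega> \<le> ennreal ((norm (Y \<omega>))\<^sup>2) + B m"
            unfolding u_def by (intro add_left_mono order_trans[OF ennreal_leI B(1)])
        qed
        also have "\<dots> = ennreal ((norm (Y \<omega>))\<^sup>2) + 2 * A \<omega>"
          by (intro lim_imp_Limsup tendsto_add tendsto_const B(2)) simp
        finally show ?case .
      qed
    qed
    finally show ?thesis .
  qed
  \<comment> \<open>The limit in \<open>m\<close> is taken for fixed \<open>K\<close>, then
    \<open>K\<close> grows; Fatou's lemma is applied once for each.\<close>
  have "(\<integral>\<^sup>+\<omega>\<in>G b. ennreal ((norm (Y \<omega> + I \<omega>))\<^sup>2) \<partial>M) \<le> (\<integral>\<^sup>+\<omega>. liminf (\<lambda>K. liminf (\<lambda>m. f K m \<omega>)) \<partial>M)"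
  proof (rule nn_integral_mono_AE)
    show "AE \<omega> in M. ennreal ((norm (Y \<omega> + I \<omega>))\<^sup>2) * indicator (G b) \<omega> \<le> liminf (\<lambda>K. liminf (\<lambda>m. f K m \<omega>))"
      using bd l2
    proof eventually_elim
      case (elim \<omega>)
      show ?case
      proof (cases "\<omega> \<in> G b")
        case True
        obtain B where B: "\<And>m. ennreal (simple_energy (N m) (p m) (\<zeta> m) \<omega>) \<le> B m" "B \<longlonglongrightarrow> 2 * A \<omega>" and Afin: "A \<omega> < \<infinity>"
          using elim(1) by blast
        have "2 * A \<omega> < \<infinity>" using Afin by (simp add: ennreal_mult_less_top)
        then obtain K0 :: nat where K0: "2 * A \<omega> < of_nat K0"
          using ennreal_Ex_less_of_nat[of "2 * A \<omega>"] by auto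
        \<comment> \<open>Once \<open>K\<close> exceeds \<open>2 * A \<omega>\<close>, stopping is
          inactive for all large \<open>m\<close>. On \<open>G b\<close> all the indicators are 1
          because the events decrease. So the original integrals reappear, and they converge to
          \<open>I \<omega>\<close>.\<close>
        have lK: "liminf (\<lambda>m. f K m \<omega>) = ennreal ((norm (Y \<omega> + I \<omega>))\<^sup>2)" if K: "K \<ge> K0" for K
        proof (rule lim_imp_Liminf)
          have "(\<lambda>m. ennreal ((norm (Y \<omega> + simple_ito_integral W (N m) (p m) (\<xi> m) \<omega>))\<^sup>2)) \<longlonglongrightarrow> ennreal ((norm (Y \<omega> + I \<omega>))\<^sup>2)"
            by (intro tendsto_ennrealI tendsto_power tendsto_norm tendsto_add tendsto_const elim(2))
          moreover have "eventually (\<lambda>m. ennreal ((norm (Y \<omega> + simple_ito_integral W (N m) (p m) (\<xi> m) \<omega>))\<^sup>2) = f K m \<omega>) sequentially"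
          proof -
            have "eventually (\<lambda>m. B m < of_nat K0) sequentially"
              by (rule order_tendstoD(2)[OF B(2) K0])
            then show ?thesis
            proof eventually_elim
              case (elim m)
              have "ennreal (simple_energy (N m) (p m) (\<zeta> m) \<omega>) < ennreal (real K0)"
                using B(1)[of m] elim by (simp add: ennreal_of_nat_eq_real_of_nat)
              then have "simple_energy (N m) (p m) (\<zeta> m) \<omega> \<le> real K"
                using K by (simp add: ennreal_less_iff simple_energy_nonneg[OF \<zeta>])
              then have "simple_ito_integral W (N m) (p m) (Z K m) \<omega> = simple_ito_integral W (N m) (p m) (\<zeta> m) \<omega>"
                unfolding Z_def by (rule simple_ito_integral_stop_at_energy[OF \<zeta>])
              also have "\<dots> = simple_ito_integral W (N m) (p m) (\<xi> m) \<omega>"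
                unfolding simple_ito_integral_def
              proof (rule sum.cong[OF refl])
                fix i assume "i \<in> {..<N m}"
                then have "\<omega> \<in> G (p m i)" using True Gdec[of "p m i" b] pb[of i m] by auto
                then show "(W (p m (Suc i)) \<omega> - W (p m i) \<omega>) *\<^sub>R \<zeta> m i \<omega> = (W (p m (Suc i)) \<omega> - W (p m i) \<omega>) *\<^sub>R \<xi> m i \<omega>"
                  by (simp add: \<zeta>_def \<eta>_def)
              qed
              finally show ?case using True by (simp add: f_def)
            qed
          qed
          ultimately show "(\<lambda>m. f K m \<omega>) \<longlonglongrightarrow> ennreal ((norm (Y \<omega> + I \<omega>))\<^sup>2)"
            by (rule Lim_transform_eventually)
        qed simp
        have "(\<lambda>K. liminf (\<lambda>m. f K m \<omega>)) \<longlonglongrightarrow> ennreal ((norm (Y \<omega> + I \<omega>))\<^sup>2)"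
          using lK by (intro tendsto_eventually) (auto simp: eventually_sequentially)
        then have "liminf (\<lambda>K. liminf (\<lambda>m. f K m \<omega>)) = ennreal ((norm (Y \<omega> + I \<omega>))\<^sup>2)"
          by (intro lim_imp_Liminf) auto
        then show ?thesis using True by simp
      qed simp
    qed
  qed
  also have "\<dots> \<le> liminf (\<lambda>K. \<integral>\<^sup>+\<omega>. liminf (\<lambda>m. f K m \<omega>) \<partial>M)"
    by (rule nn_integral_liminf) measurable
  also have "\<dots> \<le> liminf (\<lambda>K::nat. \<integral>\<^sup>+\<omega>. ennreal ((norm (Y \<omega>))\<^sup>2) + 2 * A \<omega> \<partial>M)"
  proof (intro Liminf_mono always_eventually allI)
    fix K
    have "(\<integral>\<^sup>+\<omega>. liminf (\<lambda>m. f K m \<omega>) \<partial>M) \<le> liminf (\<lambda>m. \<integral>\<^sup>+\<omega>. f K m \<omega> \<partial>M)"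
      by (rule nn_integral_liminf) measurable
    also note step2
    finally show "(\<integral>\<^sup>+\<omega>. liminf (\<lambda>m. f K m \<omega>) \<partial>M) \<le> (\<integral>\<^sup>+\<omega>. ennreal ((norm (Y \<omega>))\<^sup>2) + 2 * A \<omega> \<partial>M)" .
  qed
  also have "\<dots> = (\<integral>\<^sup>+\<omega>. ennreal ((norm (Y \<omega>))\<^sup>2) + 2 * A \<omega> \<partial>M)"
    by (simp add: Liminf_const)
  finally show ?thesis unfolding A_def .
qed

text \<open>The localized bound with every event equal to \<open>space M\<close>. The excess
  \<open>2 * C\<close> over the second moment of \<open>Y\<close> does not depend on
  \<open>Y\<close>; this uniformity forces orthogonality and stands in for an exact
  isometry.\<close>

lemma ito_limit_sq_integrable:
  fixes H :: "real \<Rightarrow> 'a \<Rightarrow> 'b::euclidean_space"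
  assumes ab: "0 \<le> a" "a \<le> b" and I: "ito_limit a b H I"
    and J: "(\<lambda>\<omega>. \<integral>\<^sup>+s\<in>{a<..b}. ennreal ((norm (H s \<omega>))\<^sup>2) \<partial>lborel) \<in> borel_measurable M"
    and C: "0 \<le> C" "(\<integral>\<^sup>+\<omega>. (\<integral>\<^sup>+s\<in>{a<..b}. ennreal ((norm (H s \<omega>))\<^sup>2) \<partial>lborel) \<partial>M) \<le> ennreal C"
  shows "sq_integrable M I" and "expectation (\<lambda>\<omega>. (norm (I \<omega>))\<^sup>2) \<le> 2 * C"
    and "\<And>Y. Y \<in> borel_measurable (F a) \<Longrightarrow> sq_integrable M Y \<Longrightarrow> expectation (\<lambda>\<omega>. Y \<omega> \<bullet> I \<omega>) = 0"
proof -
  have [measurable]: "I \<in> borel_measurable M" using I by (simp add: ito_limit_def)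
  have bound: "(\<integral>\<^sup>+\<omega>. ennreal ((norm (Y \<omega> + I \<omega>))\<^sup>2) \<partial>M) \<le> ennreal (expectation (\<lambda>\<omega>. (norm (Y \<omega>))\<^sup>2) + 2 * C)"
    if Y: "Y \<in> borel_measurable (F a)" "sq_integrable M Y" for Y
  proof -
    have [measurable]: "Y \<in> borel_measurable M" using Y(2) by (simp add: sq_integrable_def)
    have "(\<integral>\<^sup>+\<omega>. ennreal ((norm (Y \<omega> + I \<omega>))\<^sup>2) \<partial>M) = (\<integral>\<^sup>+\<omega>\<in>space M. ennreal ((norm (Y \<omega> + I \<omega>))\<^sup>2) \<partial>M)"
      by (intro nn_integral_cong) simp
    also have "\<dots> \<le> (\<integral>\<^sup>+\<omega>. ennreal ((norm (Y \<omega>))\<^sup>2)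
        + 2 * (\<integral>\<^sup>+s\<in>{a<..b}. ennreal ((norm (H s \<omega>))\<^sup>2) * indicator (space M) \<omega> \<partial>lborel) \<partial>M)"
      using sets.top[of "F _"] by (intro ito_limit_bound[OF ab I Y, of "\<lambda>_. space M"]) (auto simp: space_F)
    also have "\<dots> = (\<integral>\<^sup>+\<omega>. ennreal ((norm (Y \<omega>))\<^sup>2)
        + 2 * (\<integral>\<^sup>+s\<in>{a<..b}. ennreal ((norm (H s \<omega>))\<^sup>2) \<partial>lborel) \<partial>M)"
      by (intro nn_integral_cong) simp
    also have "\<dots> = (\<integral>\<^sup>+\<omega>. ennreal ((norm (Y \<omega>))\<^sup>2) \<partial>M)
        + 2 * (\<integral>\<^sup>+\<omega>. (\<integral>\<^sup>+s\<in>{a<..b}. ennreal ((norm (H s \<omega>))\<^sup>2) \<partial>lborel) \<partial>M)"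
      using J by (simp add: nn_integral_add nn_integral_cmult)
    also have "\<dots> \<le> ennreal (expectation (\<lambda>\<omega>. (norm (Y \<omega>))\<^sup>2)) + 2 * ennreal C"
      using Y(2) C(2) by (intro add_mono mult_left_mono) (auto simp: sq_integrable_def nn_integral_eq_integral)
    also have "\<dots> = ennreal (expectation (\<lambda>\<omega>. (norm (Y \<omega>))\<^sup>2) + 2 * C)"
      using C(1) by (simp add: ennreal_mult)
    finally show ?thesis .
  qed
  show sqI: "sq_integrable M I"
    unfolding sq_integrable_def
  proof (intro conjI integrableI_bounded)
    show "(\<integral>\<^sup>+\<omega>. ennreal (norm ((norm (I \<omega>))\<^sup>2)) \<partial>M) < \<infinity>"
      using bound[of "\<lambda>_. 0"] by (auto simp: sq_integrable_def intro: order.strict_trans1)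
  qed measurable
  have bound': "expectation (\<lambda>\<omega>. (norm (Y \<omega> + I \<omega>))\<^sup>2) \<le> expectation (\<lambda>\<omega>. (norm (Y \<omega>))\<^sup>2) + 2 * C"
    if Y: "Y \<in> borel_measurable (F a)" "sq_integrable M Y" for Y
  proof -
    have "ennreal (expectation (\<lambda>\<omega>. (norm (Y \<omega> + I \<omega>))\<^sup>2)) = (\<integral>\<^sup>+\<omega>. ennreal ((norm (Y \<omega> + I \<omega>))\<^sup>2) \<partial>M)"
      using sq_integrable_add[OF Y(2) sqI] by (intro nn_integral_eq_integral[symmetric]) (auto simp: sq_integrable_def)
    also note bound[OF Y]
    finally show ?thesis using C(1) by (subst (asm) ennreal_le_iff) auto
  qed
  show "expectation (\<lambda>\<omega>. (norm (I \<omega>))\<^sup>2) \<le> 2 * C"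
    using bound'[of "\<lambda>_. 0"] by (simp add: sq_integrable_def)
  fix Y :: "'a \<Rightarrow> 'b" assume Y: "Y \<in> borel_measurable (F a)" "sq_integrable M Y"
  define e where "e = expectation (\<lambda>\<omega>. Y \<omega> \<bullet> I \<omega>)"
  note int = integrable_inner_sq_integrable[OF Y(2) sqI]
  \<comment> \<open>The bound for all multiples of \<open>Y\<close> forces the linear term to vanish.\<close>
  have lin: "c * e \<le> C" for c
  proof -
    have "(norm (c *\<^sub>R Y \<omega> + I \<omega>))\<^sup>2 = c\<^sup>2 * (norm (Y \<omega>))\<^sup>2 + 2 * c * (Y \<omega> \<bullet> I \<omega>) + (norm (I \<omega>))\<^sup>2" for \<omega>
      unfolding power2_norm_eq_inner by (simp add: inner_add inner_commute power2_eq_square)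
    then have "expectation (\<lambda>\<omega>. (norm (c *\<^sub>R Y \<omega> + I \<omega>))\<^sup>2)
        = c\<^sup>2 * expectation (\<lambda>\<omega>. (norm (Y \<omega>))\<^sup>2) + 2 * c * e + expectation (\<lambda>\<omega>. (norm (I \<omega>))\<^sup>2)"
      using Y(2) sqI int by (simp add: sq_integrable_def e_def)
    moreover have "expectation (\<lambda>\<omega>. (norm (c *\<^sub>R Y \<omega> + I \<omega>))\<^sup>2) \<le> c\<^sup>2 * expectation (\<lambda>\<omega>. (norm (Y \<omega>))\<^sup>2) + 2 * C"
      using bound'[of "\<lambda>\<omega>. c *\<^sub>R Y \<omega>"] Y sq_integrable_scaleR[OF Y(2)] by (simp add: power_mult_distrib)
    moreover have "0 \<le> expectation (\<lambda>\<omega>. (norm (I \<omega>))\<^sup>2)" by (rule Bochner_Integration.integral_nonneg) simp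
    ultimately show ?thesis by linarith
  qed
  show "expectation (\<lambda>\<omega>. Y \<omega> \<bullet> I \<omega>) = 0"
  proof (rule ccontr)
    assume "expectation (\<lambda>\<omega>. Y \<omega> \<bullet> I \<omega>) \<noteq> 0"
    then have "e \<noteq> 0" by (simp add: e_def)
    \<comment> \<open>This multiple would give \<open>C + 1 \<le> C\<close>.\<close>
    then show False using lin[of "(C + 1) / e"] by simp
  qed
qed

end

section \<open>Linear stochastic differential equations\<close>

text \<open>Let \<open>m\<close> be the supremum of \<open>\<phi> s\<close> weighted by
  \<open>exp (- (2 * B * (s - a)))\<close>. Inserting the resulting bound for \<open>\<phi>\<close>
  into its own integral inequality gives \<open>m \<le> A + m / 2\<close>; the doubled rate is what
  produces the one half. The bound \<open>K\<close> makes \<open>m\<close> finite, so that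
  \<open>m / 2\<close> may be subtracted, and it leaves no trace in the conclusion: bounds that
  depend on a truncation level become uniform.\<close>

lemma gronwall_ennreal:
  fixes \<phi> :: "real \<Rightarrow> ennreal"
  assumes le: "\<And>s. s \<in> {a<..b} \<Longrightarrow> \<phi> s \<le> ennreal A + ennreal B * (\<integral>\<^sup>+u\<in>{a<..s}. \<phi> u \<partial>lborel)"
    and bd: "\<And>s. s \<in> {a<..b} \<Longrightarrow> \<phi> s \<le> ennreal K" and A: "0 \<le> A" and B: "0 < B"
    and s: "s \<in> {a<..b}"
  shows "\<phi> s \<le> ennreal (2 * A * exp (2 * B * (s - a)))"
proof -
  define m where "m = (SUP s\<in>{a<..b}. \<phi> s * ennreal (exp (- (2 * B * (s - a)))))"
  have "m \<le> ennreal K"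
    unfolding m_def
  proof (rule SUP_least)
    fix s assume s: "s \<in> {a<..b}"
    have "\<phi> s * ennreal (exp (- (2 * B * (s - a)))) \<le> \<phi> s * 1"
      using s B by (intro mult_left_mono) (auto simp flip: ennreal_1 intro!: ennreal_leI)
    then show "\<phi> s * ennreal (exp (- (2 * B * (s - a)))) \<le> ennreal K"
      using bd[OF s] by simp
  qed
  then have "m < top" by (rule order.strict_trans1) simp
  then obtain r where r: "m = ennreal r" "0 \<le> r" by (cases m) auto
  have up: "\<phi> u \<le> ennreal (r * exp (2 * B * (u - a)))" if u: "u \<in> {a<..b}" for u
  proof -
    have "\<phi> u = (\<phi> u * ennreal (exp (- (2 * B * (u - a))))) * ennreal (exp (2 * B * (u - a)))"
      by (simp add: mult.assoc ennreal_mult[symmetric] exp_add[symmetric])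
    also have "\<dots> \<le> m * ennreal (exp (2 * B * (u - a)))"
      unfolding m_def using u by (intro mult_right_mono SUP_upper) auto
    finally show ?thesis using r by (simp add: ennreal_mult)
  qed
  have main: "\<phi> s \<le> ennreal (A + r / 2 * exp (2 * B * (s - a)))" if s: "s \<in> {a<..b}" for s
  proof -
    have "(\<integral>\<^sup>+u\<in>{a<..s}. \<phi> u \<partial>lborel) \<le> (\<integral>\<^sup>+u. ennreal (r * exp (2 * B * (u - a))) * indicator {a..s} u \<partial>lborel)"
      using up s by (intro nn_integral_mono) (auto simp: indicator_def)
    also have "\<dots> = ennreal (r * exp (2 * B * (s - a)) / (2 * B) - r * exp (2 * B * (a - a)) / (2 * B))"
    proof (rule nn_integral_FTC_Icc)
      show "DERIV (\<lambda>x. r * exp (2 * B * (x - a)) / (2 * B)) x :> r * exp (2 * B * (x - a))" for x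
        using B by (auto intro!: derivative_eq_intros)
    qed (use s r in auto)
    also have "\<dots> \<le> ennreal (r * exp (2 * B * (s - a)) / (2 * B))"
      using r(2) B by (intro ennreal_leI) simp
    finally have "\<phi> s \<le> ennreal A + ennreal B * ennreal (r * exp (2 * B * (s - a)) / (2 * B))"
      using order_trans[OF le[OF s]] by (meson add_left_mono mult_left_mono zero_le)
    also have "\<dots> = ennreal (A + r / 2 * exp (2 * B * (s - a)))"
      using A B r(2) by (simp add: ennreal_mult[symmetric] ennreal_plus[symmetric] del: ennreal_plus)
    finally show ?thesis .
  qed
  have "m \<le> ennreal (A + r / 2)"
    unfolding m_def
  proof (rule SUP_least)
    fix s assume s: "s \<in> {a<..b}"
    have "\<phi> s * ennreal (exp (- (2 * B * (s - a)))) \<le> ennreal (A + r / 2 * exp (2 * B * (s - a))) * ennreal (exp (- (2 * B * (s - a))))"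
      by (intro mult_right_mono main s) simp
    also have "\<dots> = ennreal (A * exp (- (2 * B * (s - a))) + r / 2)"
      using A r(2) by (subst ennreal_mult[symmetric]) (auto simp: distrib_right mult.assoc exp_add[symmetric])
    also have "\<dots> \<le> ennreal (A + r / 2)"
      using A B s by (intro ennreal_leI add_right_mono mult_left_le) auto
    finally show "\<phi> s * ennreal (exp (- (2 * B * (s - a)))) \<le> ennreal (A + r / 2)" .
  qed
  then have "r \<le> A + r / 2" using r A by (simp add: ennreal_plus[symmetric] del: ennreal_plus)
  then have "r * exp (2 * B * (s - a)) \<le> 2 * A * exp (2 * B * (s - a))"
    by (intro mult_right_mono) auto
  then show ?thesis using up[OF s] by (meson ennreal_leI order_trans)
qed

text \<open>Cauchy-Schwarz against the indicator of the interval.\<close>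

lemma set_integral_norm_sq_le:
  fixes h :: "real \<Rightarrow> 'b::euclidean_space"
  assumes h: "set_integrable lborel {u<..v} h" and uv: "u \<le> v"
  shows "ennreal ((norm (LINT s:{u<..v}|lborel. h s))\<^sup>2) \<le> ennreal (v - u) * (\<integral>\<^sup>+s\<in>{u<..v}. ennreal ((norm (h s))\<^sup>2) \<partial>lborel)"
proof -
  have int: "integrable lborel (\<lambda>s. indicator {u<..v} s *\<^sub>R h s)" using h by (simp add: set_integrable_def)
  then have [measurable]: "(\<lambda>s. indicator {u<..v} s *\<^sub>R h s) \<in> borel_measurable lborel" by simp
  have "ennreal (norm (LINT s:{u<..v}|lborel. h s)) \<le> (\<integral>\<^sup>+s. ennreal (norm (indicator {u<..v} s *\<^sub>R h s)) \<partial>lborel)"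
    unfolding set_lebesgue_integral_def by (rule integral_norm_bound_ennreal[OF int])
  also have "\<dots> = (\<integral>\<^sup>+s. indicator {u<..v} s * ennreal (norm (indicator {u<..v} s *\<^sub>R h s)) \<partial>lborel)"
    by (intro nn_integral_cong) (auto simp: indicator_def)
  finally have "(ennreal (norm (LINT s:{u<..v}|lborel. h s)))\<^sup>2
      \<le> (\<integral>\<^sup>+s. indicator {u<..v} s * ennreal (norm (indicator {u<..v} s *\<^sub>R h s)) \<partial>lborel)\<^sup>2"
    by (rule power_mono) simp
  also have "\<dots> \<le> (\<integral>\<^sup>+s. (indicator {u<..v} s)\<^sup>2 \<partial>lborel) * (\<integral>\<^sup>+s. (ennreal (norm (indicator {u<..v} s *\<^sub>R h s)))\<^sup>2 \<partial>lborel)"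
    by (rule Cauchy_Schwarz_nn_integral) measurable
  also have "(\<integral>\<^sup>+s. (indicator {u<..v} s)\<^sup>2 \<partial>lborel) = (\<integral>\<^sup>+s. indicator {u<..v} s \<partial>lborel)"
    by (intro nn_integral_cong) (auto simp: indicator_def)
  also have "\<dots> = ennreal (v - u)" using uv by simp
  also have "(\<integral>\<^sup>+s. (ennreal (norm (indicator {u<..v} s *\<^sub>R h s)))\<^sup>2 \<partial>lborel) = (\<integral>\<^sup>+s\<in>{u<..v}. ennreal ((norm (h s))\<^sup>2) \<partial>lborel)"
    by (intro nn_integral_cong) (auto simp: indicator_def ennreal_power)
  finally show ?thesis by (simp add: ennreal_power)
qed

text \<open>Time is rounded up to a grid point and capped at \<open>b\<close>; rounding up keeps it
  greater than \<open>a\<close>, where \<open>X\<close> is controlled. The rounded time takes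
  countably many values, so each approximation is measurable, and continuity gives the
  limit.\<close>

lemma jointly_measurable_if_continuous:
  fixes X :: "real \<Rightarrow> 'a \<Rightarrow> 'b::euclidean_space"
  assumes meas: "\<And>s. s \<in> {a<..b} \<Longrightarrow> X s \<in> borel_measurable M"
    and cont: "\<And>\<omega>. \<omega> \<in> space M \<Longrightarrow> continuous_on {a<..b} (\<lambda>s. X s \<omega>)"
  shows "(\<lambda>(\<omega>, s). indicator {a<..b} s *\<^sub>R X s \<omega>) \<in> borel_measurable (M \<Otimes>\<^sub>M borel)"
proof -
  define t where "t n i = min b (a + real_of_int i / real (Suc n))" for n i
  define Y where "Y n i \<omega> = (if a < t n i then X (t n i) \<omega> else 0)" for n i \<omega>
  have Ym [measurable]: "Y n i \<in> borel_measurable M" for n i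
    unfolding Y_def[abs_def] using meas[of "t n i"] by (cases "a < t n i") (auto simp: t_def)
  define f where "f n z = indicator {a<..b} (snd z) *\<^sub>R Y n \<lceil>(snd z - a) * real (Suc n)\<rceil> (fst z)" for n and z :: "'a \<times> real"
  have "f n \<in> borel_measurable (M \<Otimes>\<^sub>M borel)" for n
  proof -
    have "(\<lambda>z. Y n \<lceil>(snd z - a) * real (Suc n)\<rceil> (fst z)) \<in> borel_measurable (M \<Otimes>\<^sub>M borel)"
      by (rule measurable_compose_countable[where f = "\<lambda>i z. Y n i (fst z)"]) measurable
    then show ?thesis unfolding f_def[abs_def] by measurable
  qed
  then show ?thesis
  proof (rule borel_measurable_LIMSEQ_metric)
    fix z assume "z \<in> space (M \<Otimes>\<^sub>M (borel :: real measure))"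
    then obtain \<omega> s where z: "z = (\<omega>, s)" "\<omega> \<in> space M" by (auto simp: space_pair_measure)
    show "(\<lambda>n. f n z) \<longlonglongrightarrow> (case z of (\<omega>, s) \<Rightarrow> indicator {a<..b} s *\<^sub>R X s \<omega>)"
    proof (cases "s \<in> {a<..b}")
      case True
      define k where "k n = t n \<lceil>(s - a) * real (Suc n)\<rceil>" for n
      have ks: "s \<le> k n" "k n \<le> s + 1 / real (Suc n)" "k n \<le> b" for n
      proof -
        let ?i = "real_of_int \<lceil>(s - a) * real (Suc n)\<rceil>"
        have i: "(s - a) * real (Suc n) \<le> ?i" "?i \<le> (s - a) * real (Suc n) + 1" by linarith+
        have "s - a \<le> ?i / real (Suc n)" using i(1) by (simp add: pos_le_divide_eq)
        then show "s \<le> k n" using True by (simp add: k_def t_def)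
        have "?i / real (Suc n) \<le> ((s - a) * real (Suc n) + 1) / real (Suc n)" using i(2) by (intro divide_right_mono) auto
        also have "\<dots> = s - a + 1 / real (Suc n)" by (simp add: add_divide_distrib)
        finally show "k n \<le> s + 1 / real (Suc n)" unfolding k_def t_def by linarith
        show "k n \<le> b" by (simp add: k_def t_def)
      qed
      have lim: "(\<lambda>n. s + 1 / real (Suc n)) \<longlonglongrightarrow> s"
        using tendsto_add[OF tendsto_const[of s] lim_inverse_n', THEN LIMSEQ_Suc] by simp
      have "k \<longlonglongrightarrow> s"
        by (rule tendsto_sandwich[OF _ _ tendsto_const lim]) (use ks in auto)
      then have "(\<lambda>n. X (k n) \<omega>) \<longlonglongrightarrow> X s \<omega>"
      proof (rule continuous_on_tendsto_compose[OF cont[OF z(2)]])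
        show "s \<in> {a<..b}" by (rule True)
        show "eventually (\<lambda>n. k n \<in> {a<..b}) sequentially"
          using ks True by (intro always_eventually) (auto intro: less_le_trans)
      qed
      moreover have "f n z = X (k n) \<omega>" for n
        using ks(1)[of n] True by (simp add: f_def z Y_def k_def)
      ultimately show ?thesis using True z by simp
    qed (simp add: z f_def)
  qed
qed

text \<open>The state space is an arbitrary Euclidean space, because the same results serve the
  matrix equation of \<open>\<Phi>\<close> and the vector equation between two impulses.
  \<open>\<xi>\<close> may involve \<open>\<nu> k\<close>, hence the absence of adaptedness at time
  \<open>a\<close>.\<close>

locale linear_sde = wiener_basis M F W
  for M :: "'a measure" and F :: "real \<Rightarrow> 'a measure" and W :: "real \<Rightarrow> 'a \<Rightarrow> real" +
  fixes f g :: "'b::euclidean_space \<Rightarrow> 'b" and a b :: real and \<xi> :: "'a \<Rightarrow> 'b" and X :: "real \<Rightarrow> 'a \<Rightarrow> 'b"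
  assumes a_nonneg: "0 \<le> a" and a_less_b: "a < b"
    and f: "bounded_linear f" and g: "bounded_linear g"
    and sde: "ito_sde_on M F W f g a b \<xi> X"
    and initial: "sq_integrable M \<xi>"
begin

definition c where "c = onorm f + onorm g"

lemma c_nonneg: "0 \<le> c" and norm_f: "norm (f x) \<le> c * norm x" and norm_g: "norm (g x) \<le> c * norm x"
proof -
  have nn: "0 \<le> onorm f" "0 \<le> onorm g" by (simp_all add: onorm_pos_le f g)
  then show "0 \<le> c" by (simp add: c_def)
  show "norm (f x) \<le> c * norm x"
    using onorm[OF f, of x] nn mult_right_mono[of "onorm f" c "norm x"] by (simp add: c_def)
  show "norm (g x) \<le> c * norm x"
    using onorm[OF g, of x] nn mult_right_mono[of "onorm g" c "norm x"] by (simp add: c_def)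
qed

lemma X_measurable_F: "s \<in> {a<..b} \<Longrightarrow> X s \<in> borel_measurable (F s)"
  using sde unfolding ito_sde_on_def by blast

lemma X_measurable: "s \<in> {a<..b} \<Longrightarrow> X s \<in> borel_measurable M"
  by (rule measurable_F_M[OF X_measurable_F])

lemma X_continuous: "\<omega> \<in> space M \<Longrightarrow> continuous_on {a<..b} (\<lambda>s. X s \<omega>)"
  using sde unfolding ito_sde_on_def by blast

text \<open>The half-open interval is not compact; the right limit at \<open>a\<close> takes care of
  times close to \<open>a\<close>.\<close>

lemma X_bounded:
  assumes \<omega>: "\<omega> \<in> space M"
  obtains K where "\<And>s. s \<in> {a<..b} \<Longrightarrow> norm (X s \<omega>) \<le> K"
proof -
  obtain l where l: "((\<lambda>s. X s \<omega>) \<longlongrightarrow> l) (at_right a)"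
    using sde \<omega> unfolding ito_sde_on_def by blast
  then have "eventually (\<lambda>s. dist (X s \<omega>) l < 1) (at_right a)"
    by (rule tendstoD) simp
  then obtain d where d: "a < d" "\<And>s. a < s \<Longrightarrow> s < d \<Longrightarrow> dist (X s \<omega>) l < 1"
    unfolding eventually_at_right[OF a_less_b] by blast
  have "compact ((\<lambda>s. X s \<omega>) ` {d..b})"
    using d(1) by (intro compact_continuous_image continuous_on_subset[OF X_continuous[OF \<omega>]]) auto
  then have "bounded ((\<lambda>s. X s \<omega>) ` {d..b})" by (rule compact_imp_bounded)
  then obtain K where K: "\<forall>s\<in>{d..b}. norm (X s \<omega>) \<le> K" by (auto simp: bounded_iff)
  have "norm (X s \<omega>) \<le> max K (norm l + 1)" if "s \<in> {a<..b}" for s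
  proof (cases "s < d")
    case True
    then have "norm (X s \<omega> - l) < 1" using d that by (auto simp: dist_norm)
    then show ?thesis using norm_triangle_ineq2[of "X s \<omega>" l] by linarith
  next
    case False
    then have "norm (X s \<omega>) \<le> K" using K that by auto
    then show ?thesis by simp
  qed
  then show ?thesis using that by blast
qed

lemma X_jointly_measurable:
  "(\<lambda>(\<omega>, s). indicator {a<..b} s *\<^sub>R X s \<omega>) \<in> borel_measurable (M \<Otimes>\<^sub>M borel)"
  by (rule jointly_measurable_if_continuous[OF X_measurable X_continuous])

lemma set_integrable_X:
  fixes L :: "'b \<Rightarrow> 'c::euclidean_space"
  assumes "bounded_linear L" "\<omega> \<in> space M" "a \<le> u" "v \<le> b" and uv: "u \<le> v"
  shows "set_integrable lborel {u<..v} (\<lambda>s. L (X s \<omega>))"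
proof -
  obtain K where K: "\<And>s. s \<in> {a<..b} \<Longrightarrow> norm (X s \<omega>) \<le> K" using X_bounded[OF assms(2)] by blast
  obtain k where k: "\<And>x. norm (L x) \<le> norm x * k" "0 \<le> k"
    using bounded_linear.nonneg_bounded[OF assms(1)] by blast
  have "continuous_on {u<..v} (\<lambda>s. L (X s \<omega>))"
    using assms by (intro bounded_linear.continuous_on[OF assms(1)] continuous_on_subset[OF X_continuous[OF assms(2)]]) auto
  then have m: "(\<lambda>s. indicator {u<..v} s *\<^sub>R L (X s \<omega>)) \<in> borel_measurable borel"
    by (intro borel_measurable_continuous_on_indicator) auto
  have bnd: "norm (L (X s \<omega>)) \<le> K * k" if "s \<in> {u<..v}" for s
    using k K[of s] that assms by (intro order_trans[OF k(1)] mult_right_mono) auto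
  show ?thesis
    unfolding set_integrable_def
  proof (rule Bochner_Integration.integrable_bound[where f = "\<lambda>s. indicator {u<..v} s * (K * k)"])
    show "integrable lborel (\<lambda>s. indicator {u<..v} s * (K * k))"
      by (rule integrable_mult_left) (simp add: uv)
    show "AE s in lborel. norm (indicator {u<..v} s *\<^sub>R L (X s \<omega>)) \<le> norm (indicator {u<..v} s * (K * k))"
      using bnd by (intro AE_I2) (auto simp: indicator_def intro: order_trans[OF _ abs_ge_self])
  qed (use m in simp)
qed

text \<open>Fubini's theorem converts a bound on second moments that is uniform in time into a bound
  on the expected energy. \<open>\<eta>\<close> will be 0 or the value at the left end
  \<open>u\<close>, and \<open>L\<close> will be \<open>f\<close> or \<open>g\<close>.\<close>

lemma X_energy:
  fixes \<eta> :: "'a \<Rightarrow> 'b"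
  assumes L: "bounded_linear L" "\<And>x. norm (L x) \<le> c * norm x" and K: "0 \<le> K"
    and \<eta>: "\<eta> \<in> borel_measurable M" and uv: "a \<le> u" "u \<le> v" "v \<le> b"
    and bd: "\<And>s. s \<in> {u<..v} \<Longrightarrow> (\<integral>\<^sup>+\<omega>. ennreal ((norm (X s \<omega> - \<eta> \<omega>))\<^sup>2) \<partial>M) \<le> ennreal K"
  shows "(\<lambda>\<omega>. \<integral>\<^sup>+s\<in>{u<..v}. ennreal ((norm (L (X s \<omega> - \<eta> \<omega>)))\<^sup>2) \<partial>lborel) \<in> borel_measurable M"
    and "(\<integral>\<^sup>+\<omega>. (\<integral>\<^sup>+s\<in>{u<..v}. ennreal ((norm (L (X s \<omega> - \<eta> \<omega>)))\<^sup>2) \<partial>lborel) \<partial>M) \<le> ennreal (c\<^sup>2 * K * (v - u))"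
proof -
  interpret P: pair_sigma_finite M lborel ..
  have [measurable]: "L \<in> borel_measurable borel"
    by (intro borel_measurable_continuous_onI linear_continuous_on L)
  note \<eta>[measurable] X_jointly_measurable[measurable]
  have "(\<lambda>(\<omega>, s). ennreal ((norm (L ((case (\<omega>, s) of (\<omega>, s) \<Rightarrow> indicator {a<..b} s *\<^sub>R X s \<omega>) - \<eta> \<omega>)))\<^sup>2) * indicator {u<..v} s)
      \<in> borel_measurable (M \<Otimes>\<^sub>M lborel)"
    by measurable
  then have joint [measurable]: "(\<lambda>(\<omega>, s). ennreal ((norm (L (X s \<omega> - \<eta> \<omega>)))\<^sup>2) * indicator {u<..v} s) \<in> borel_measurable (M \<Otimes>\<^sub>M lborel)"
    by (rule measurable_cong[THEN iffD1, rotated]) (use uv in \<open>auto simp: indicator_def\<close>)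
  show "(\<lambda>\<omega>. \<integral>\<^sup>+s\<in>{u<..v}. ennreal ((norm (L (X s \<omega> - \<eta> \<omega>)))\<^sup>2) \<partial>lborel) \<in> borel_measurable M"
    by measurable
  have "(\<integral>\<^sup>+\<omega>. (\<integral>\<^sup>+s\<in>{u<..v}. ennreal ((norm (L (X s \<omega> - \<eta> \<omega>)))\<^sup>2) \<partial>lborel) \<partial>M)
      = (\<integral>\<^sup>+s. (\<integral>\<^sup>+\<omega>. ennreal ((norm (L (X s \<omega> - \<eta> \<omega>)))\<^sup>2) * indicator {u<..v} s \<partial>M) \<partial>lborel)"
    by (rule P.Fubini'[symmetric, OF joint])
  also have "\<dots> \<le> (\<integral>\<^sup>+s. ennreal (c\<^sup>2 * K) * indicator {u<..v} s \<partial>lborel)"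
  proof (rule nn_integral_mono)
    fix s
    show "(\<integral>\<^sup>+\<omega>. ennreal ((norm (L (X s \<omega> - \<eta> \<omega>)))\<^sup>2) * indicator {u<..v} s \<partial>M) \<le> ennreal (c\<^sup>2 * K) * indicator {u<..v} s"
    proof (cases "s \<in> {u<..v}")
      case True
      then have [measurable]: "X s \<in> borel_measurable M" using uv by (intro X_measurable) auto
      have "(\<integral>\<^sup>+\<omega>. ennreal ((norm (L (X s \<omega> - \<eta> \<omega>)))\<^sup>2) \<partial>M) \<le> (\<integral>\<^sup>+\<omega>. ennreal (c\<^sup>2) * ennreal ((norm (X s \<omega> - \<eta> \<omega>))\<^sup>2) \<partial>M)"
      proof (rule nn_integral_mono)
        fix \<omega>
        have "(norm (L (X s \<omega> - \<eta> \<omega>)))\<^sup>2 \<le> (c * norm (X s \<omega> - \<eta> \<omega>))\<^sup>2" by (intro power_mono L) auto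
        then show "ennreal ((norm (L (X s \<omega> - \<eta> \<omega>)))\<^sup>2) \<le> ennreal (c\<^sup>2) * ennreal ((norm (X s \<omega> - \<eta> \<omega>))\<^sup>2)"
          by (simp add: ennreal_mult[symmetric] power_mult_distrib ennreal_leI)
      qed
      also have "\<dots> = ennreal (c\<^sup>2) * (\<integral>\<^sup>+\<omega>. ennreal ((norm (X s \<omega> - \<eta> \<omega>))\<^sup>2) \<partial>M)"
        by (rule nn_integral_cmult) measurable
      also have "\<dots> \<le> ennreal (c\<^sup>2) * ennreal K" by (intro mult_left_mono bd True) simp
      finally show ?thesis using True K by (simp add: ennreal_mult)
    qed simp
  qed
  also have "\<dots> = ennreal (c\<^sup>2 * K * (v - u))"
    using uv K by (simp add: nn_integral_cmult_indicator ennreal_mult)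
  finally show "(\<integral>\<^sup>+\<omega>. (\<integral>\<^sup>+s\<in>{u<..v}. ennreal ((norm (L (X s \<omega> - \<eta> \<omega>)))\<^sup>2) \<partial>lborel) \<partial>M) \<le> ennreal (c\<^sup>2 * K * (v - u))" .
qed

lemma X_decomposition:
  assumes s: "s \<in> {a<..b}"
  obtains I where "ito_limit a s (\<lambda>u \<omega>. g (X u \<omega>)) I"
    "AE \<omega> in M. X s \<omega> = \<xi> \<omega> + (LINT u:{a<..s}|lborel. f (X u \<omega>)) + I \<omega>"
proof -
  from sde s obtain I where "is_ito_integral M F W a s (\<lambda>u \<omega>. g (X u \<omega>)) I"
    "AE \<omega> in M. X s \<omega> = \<xi> \<omega> + (LINT u:{a<..s}|lborel. f (X u \<omega>)) + I \<omega>"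
    unfolding ito_sde_on_def by blast
  then show ?thesis using that ito_limit_if_is_ito_integral by blast
qed

text \<open>
  Rational times make the event measurable; by continuity of the paths \<open>X\<close> is then bounded at all
  times up to and including \<open>s\<close>.
\<close>

definition bounded_until :: "nat \<Rightarrow> real \<Rightarrow> 'a set" where
  "bounded_until n s = {\<omega>\<in>space M. \<forall>q::rat. a < of_rat q \<and> of_rat q \<le> b \<and> of_rat q < s \<longrightarrow> norm (X (of_rat q) \<omega>) \<le> real n}"

lemma bounded_until_sets:
  assumes "s \<le> b"
  shows "bounded_until n s \<in> sets (F s)"
proof -
  have "Measurable.pred (F s) (\<lambda>\<omega>. a < of_rat q \<and> of_rat q \<le> b \<and> of_rat q < s \<longrightarrow> norm (X (of_rat q) \<omega>) \<le> real n)" for q :: rat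
  proof (cases "a < (of_rat q :: real) \<and> of_rat q \<le> b \<and> of_rat q < s")
    case True
    then have [measurable]: "X (of_rat q) \<in> borel_measurable (F s)"
      by (intro measurable_F_mono[OF _ X_measurable_F]) auto
    show ?thesis by measurable
  next
    case False
    then have "(\<lambda>\<omega>. a < of_rat q \<and> of_rat q \<le> b \<and> of_rat q < s \<longrightarrow> norm (X (of_rat q) \<omega>) \<le> real n) = (\<lambda>_. True)"
      by auto
    then show ?thesis by simp
  qed
  then have "Measurable.pred (F s) (\<lambda>\<omega>. \<forall>q::rat. a < of_rat q \<and> of_rat q \<le> b \<and> of_rat q < s \<longrightarrow> norm (X (of_rat q) \<omega>) \<le> real n)"
    by (rule pred_intros_countable)
  from predE[OF this] show ?thesis
    by (simp only: bounded_until_def space_F)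
qed

lemma bounded_until_antimono: "s \<le> t \<Longrightarrow> bounded_until n t \<subseteq> bounded_until n s"
  unfolding bounded_until_def by fastforce

lemma bounded_until_left_continuous:
  assumes "a < s" "\<And>t. a \<le> t \<Longrightarrow> t < s \<Longrightarrow> \<omega> \<in> bounded_until n t"
  shows "\<omega> \<in> bounded_until n s"
proof -
  have "norm (X (of_rat q) \<omega>) \<le> real n" if q: "a < (of_rat q :: real)" "(of_rat q :: real) \<le> b" "of_rat q < s" for q :: rat
  proof -
    obtain t where "of_rat q < t" "t < s" using dense[OF q(3)] by blast
    then show ?thesis using assms(2)[of t] q by (auto simp: bounded_until_def)
  qed
  moreover have "\<omega> \<in> space M" using assms(2)[of a] assms(1) by (simp add: bounded_until_def)
  ultimately show ?thesis by (auto simp: bounded_until_def)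
qed

lemma bounded_untilD:
  assumes "\<omega> \<in> bounded_until n s" "s \<in> {a<..b}" "v \<in> {a<..s}"
  shows "norm (X v \<omega>) \<le> real n"
proof (rule ccontr)
  assume "\<not> norm (X v \<omega>) \<le> real n"
  then have pos: "0 < norm (X v \<omega>) - real n" by simp
  have "continuous_on {a<..b} (\<lambda>s. norm (X s \<omega>))"
    using assms(1) by (intro continuous_on_norm X_continuous) (simp add: bounded_until_def)
  moreover have "v \<in> {a<..b}" using assms(2,3) by auto
  ultimately obtain d where d: "0 < d" "\<And>w. w \<in> {a<..b} \<Longrightarrow> dist w v < d \<Longrightarrow> dist (norm (X w \<omega>)) (norm (X v \<omega>)) < norm (X v \<omega>) - real n"
    using pos unfolding continuous_on_iff by blast
  have "max a (v - d) < v" using d(1) assms(3) by simp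
  from of_rat_dense[OF this] obtain q :: rat where q: "max a (v - d) < of_rat q" "of_rat q < v"
    by blast
  then have "norm (X (of_rat q) \<omega>) > real n"
    using d(2)[of "of_rat q"] assms(2,3) by (auto simp: dist_real_def)
  moreover have "norm (X (of_rat q) \<omega>) \<le> real n"
    using assms q by (auto simp: bounded_until_def)
  ultimately show False by simp
qed

text \<open>Prepares Fubini's theorem for integrals in which the event varies with the time of
  integration.\<close>

lemma bounded_until_jointly_measurable:
  "(\<lambda>(\<omega>, u). indicator (bounded_until n u) \<omega> :: ennreal) \<in> borel_measurable (M \<Otimes>\<^sub>M borel)"
proof -
  have "Measurable.pred (M \<Otimes>\<^sub>M borel) (\<lambda>z. a < of_rat q \<and> of_rat q \<le> b \<and> (of_rat q :: real) < snd z \<longrightarrow> norm (X (of_rat q) (fst z)) \<le> real n)" for q :: rat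
  proof (cases "a < (of_rat q :: real) \<and> of_rat q \<le> b")
    case True
    then have [measurable]: "X (of_rat q) \<in> borel_measurable M" by (intro X_measurable) auto
    have "Measurable.pred (M \<Otimes>\<^sub>M borel) (\<lambda>z. (of_rat q :: real) < snd z \<longrightarrow> norm (X (of_rat q) (fst z)) \<le> real n)"
      by measurable
    then show ?thesis using True by simp
  next
    case False
    then have "(\<lambda>z. a < of_rat q \<and> of_rat q \<le> b \<and> (of_rat q :: real) < snd z \<longrightarrow> norm (X (of_rat q) (fst z)) \<le> real n) = (\<lambda>_. True)"
      by auto
    then show ?thesis by simp
  qed
  then have "Measurable.pred (M \<Otimes>\<^sub>M borel) (\<lambda>z. \<forall>q::rat. a < of_rat q \<and> of_rat q \<le> b \<and> (of_rat q :: real) < snd z \<longrightarrow> norm (X (of_rat q) (fst z)) \<le> real n)"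
    by (rule pred_intros_countable)
  then have "{z\<in>space (M \<Otimes>\<^sub>M borel). \<forall>q::rat. a < of_rat q \<and> of_rat q \<le> b \<and> (of_rat q :: real) < snd z \<longrightarrow> norm (X (of_rat q) (fst z)) \<le> real n} \<in> sets (M \<Otimes>\<^sub>M borel)"
    by (rule predE)
  then have "(indicator {z\<in>space (M \<Otimes>\<^sub>M borel). \<forall>q::rat. a < of_rat q \<and> of_rat q \<le> b \<and> (of_rat q :: real) < snd z \<longrightarrow> norm (X (of_rat q) (fst z)) \<le> real n} :: _ \<Rightarrow> ennreal)
      \<in> borel_measurable (M \<Otimes>\<^sub>M borel)"
    by (rule borel_measurable_indicator)
  then show ?thesis
    by (rule measurable_cong[THEN iffD1, rotated])
      (auto simp: bounded_until_def indicator_def space_pair_measure)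
qed

end

lemma norm_add3_sq_le:
  "(norm (x + y + z :: 'b::real_normed_vector))\<^sup>2 \<le> 3 * (norm x)\<^sup>2 + 3 * (norm y)\<^sup>2 + 3 * (norm z)\<^sup>2"
proof -
  have "norm (x + y + z) \<le> norm x + norm y + norm z"
    using norm_triangle_ineq[of "x + y" z] norm_triangle_ineq[of x y] by linarith
  then have "(norm (x + y + z))\<^sup>2 \<le> (norm x + norm y + norm z)\<^sup>2"
    by (intro power_mono) auto
  also have "\<dots> \<le> 3 * (norm x)\<^sup>2 + 3 * (norm y)\<^sup>2 + 3 * (norm z)\<^sup>2"
    using sum_squares_bound[of "norm x" "norm y"] sum_squares_bound[of "norm x" "norm z"] sum_squares_bound[of "norm y" "norm z"]
    by (simp add: power2_eq_square algebra_simps)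
  finally show ?thesis .
qed

lemma sq_integrableI_nn_integral:
  assumes "Y \<in> borel_measurable M" "(\<integral>\<^sup>+\<omega>. ennreal ((norm (Y \<omega>))\<^sup>2) \<partial>M) \<le> ennreal C" "0 \<le> C"
  shows "sq_integrable M Y" "(\<integral>\<omega>. (norm (Y \<omega>))\<^sup>2 \<partial>M) \<le> C"
proof -
  show s: "sq_integrable M Y"
    unfolding sq_integrable_def
  proof (intro conjI integrableI_bounded)
    show "(\<integral>\<^sup>+\<omega>. ennreal (norm ((norm (Y \<omega>))\<^sup>2)) \<partial>M) < \<infinity>"
      using assms(2) by (auto intro: order.strict_trans1)
  qed (use assms(1) in measurable)
  have "ennreal (\<integral>\<omega>. (norm (Y \<omega>))\<^sup>2 \<partial>M) = (\<integral>\<^sup>+\<omega>. ennreal ((norm (Y \<omega>))\<^sup>2) \<partial>M)"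
    using s by (intro nn_integral_eq_integral[symmetric]) (auto simp: sq_integrable_def)
  also note assms(2)
  finally show "(\<integral>\<omega>. (norm (Y \<omega>))\<^sup>2 \<partial>M) \<le> C" using assms(3) by (simp add: ennreal_le_iff)
qed

lemma nn_integral_sq_integrable:
  "sq_integrable M Y \<Longrightarrow> (\<integral>\<^sup>+\<omega>. ennreal ((norm (Y \<omega>))\<^sup>2) \<partial>M) = ennreal (\<integral>\<omega>. (norm (Y \<omega>))\<^sup>2 \<partial>M)"
  by (rule nn_integral_eq_integral) (auto simp: sq_integrable_def)

text \<open>Cauchy-Schwarz through a weighted arithmetic-geometric mean: with the weights
  \<open>\<beta> / (2 * \<alpha>)\<close> and \<open>\<alpha> / (2 * \<beta>)\<close> both terms
  integrate to at most half of \<open>\<alpha> * \<beta>\<close>. The bounds are written as squares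
  so that orders of magnitude multiply directly.\<close>

lemma integral_bilinear_le:
  fixes B :: "'b::euclidean_space \<Rightarrow> 'c::euclidean_space \<Rightarrow> real"
  assumes x: "sq_integrable M x" "(\<integral>\<omega>. (norm (x \<omega>))\<^sup>2 \<partial>M) \<le> \<alpha>\<^sup>2" "0 < \<alpha>"
    and y: "sq_integrable M y" "(\<integral>\<omega>. (norm (y \<omega>))\<^sup>2 \<partial>M) \<le> \<beta>\<^sup>2" "0 < \<beta>"
    and B: "bounded_bilinear B" "\<And>x y. norm (B x y) \<le> norm x * norm y * K" "0 \<le> K"
  shows "\<bar>\<integral>\<omega>. B (x \<omega>) (y \<omega>) \<partial>M\<bar> \<le> K * \<alpha> * \<beta>"
proof -
  let ?b = "\<lambda>\<omega>. K * (\<beta> / (2 * \<alpha>) * (norm (x \<omega>))\<^sup>2 + \<alpha> / (2 * \<beta>) * (norm (y \<omega>))\<^sup>2)"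
  have bi: "integrable M ?b" using x(1) y(1) by (auto simp: sq_integrable_def)
  have pt: "norm (B (x \<omega>) (y \<omega>)) \<le> ?b \<omega>" for \<omega>
  proof -
    have "0 \<le> (\<beta> * norm (x \<omega>) - \<alpha> * norm (y \<omega>))\<^sup>2 / (2 * \<alpha> * \<beta>)" using x(3) y(3) by simp
    also have "\<dots> = \<beta> / (2 * \<alpha>) * (norm (x \<omega>))\<^sup>2 + \<alpha> / (2 * \<beta>) * (norm (y \<omega>))\<^sup>2 - norm (x \<omega>) * norm (y \<omega>)"
      using x(3) y(3) by (simp add: field_simps power2_eq_square)
    finally have "norm (x \<omega>) * norm (y \<omega>) \<le> \<beta> / (2 * \<alpha>) * (norm (x \<omega>))\<^sup>2 + \<alpha> / (2 * \<beta>) * (norm (y \<omega>))\<^sup>2" by simp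
    from order_trans[OF B(2) mult_right_mono[OF this B(3)]] show ?thesis by (simp add: mult.commute)
  qed
  have "\<bar>\<integral>\<omega>. B (x \<omega>) (y \<omega>) \<partial>M\<bar> \<le> (\<integral>\<omega>. norm (B (x \<omega>) (y \<omega>)) \<partial>M)"
    using integral_norm_bound[of M "\<lambda>\<omega>. B (x \<omega>) (y \<omega>)"] by simp
  also have "\<dots> \<le> (\<integral>\<omega>. ?b \<omega> \<partial>M)"
    using integrable_norm[OF integrable_bilinear_sq_integrable[OF x(1) y(1) B(1)]] bi pt by (intro integral_mono) auto
  also have "\<dots> = K * (\<beta> / (2 * \<alpha>) * (\<integral>\<omega>. (norm (x \<omega>))\<^sup>2 \<partial>M) + \<alpha> / (2 * \<beta>) * (\<integral>\<omega>. (norm (y \<omega>))\<^sup>2 \<partial>M))"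
    using x(1) y(1) by (simp add: sq_integrable_def)
  also have "\<dots> \<le> K * (\<beta> / (2 * \<alpha>) * \<alpha>\<^sup>2 + \<alpha> / (2 * \<beta>) * \<beta>\<^sup>2)"
    using x y B(3) by (intro mult_left_mono add_mono) auto
  also have "\<dots> = K * \<alpha> * \<beta>" using x(3) y(3) by (simp add: field_simps power2_eq_square)
  finally show ?thesis .
qed

section \<open>Finite second moments and increments of the solution\<close>

context linear_sde
begin

text \<open>On the event that the path has stayed below \<open>n\<close> the second moment is finite
  beforehand, so Gronwall's argument applies, and its result is independent of \<open>n\<close>. In
  the rate, 3 comes from squaring a sum of three terms, \<open>(b - a) * c\<^sup>2\<close> from the
  drift, twice \<open>c\<^sup>2\<close> from the stochastic integral, and 1 makes the rate
  positive.\<close>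

lemma localized_moment:
  assumes s: "s \<in> {a<..b}"
  shows "(\<integral>\<^sup>+\<omega>\<in>bounded_until n s. ennreal ((norm (X s \<omega>))\<^sup>2) \<partial>M)
    \<le> ennreal (2 * (3 * expectation (\<lambda>\<omega>. (norm (\<xi> \<omega>))\<^sup>2)) * exp (2 * (3 * (b - a) * c\<^sup>2 + 6 * c\<^sup>2 + 1) * (s - a)))"
proof (rule gronwall_ennreal[where \<phi> = "\<lambda>s. \<integral>\<^sup>+\<omega>\<in>bounded_until n s. ennreal ((norm (X s \<omega>))\<^sup>2) \<partial>M", OF _ _ _ _ s])
  let ?\<phi> = "\<lambda>s. \<integral>\<^sup>+\<omega>\<in>bounded_until n s. ennreal ((norm (X s \<omega>))\<^sup>2) \<partial>M"
  interpret P: pair_sigma_finite M lborel ..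
  show "?\<phi> s \<le> ennreal ((real n)\<^sup>2)" if s: "s \<in> {a<..b}" for s
  proof -
    have "?\<phi> s \<le> (\<integral>\<^sup>+\<omega>. ennreal ((real n)\<^sup>2) \<partial>M)"
    proof (rule nn_integral_mono)
      fix \<omega>
      show "ennreal ((norm (X s \<omega>))\<^sup>2) * indicator (bounded_until n s) \<omega> \<le> ennreal ((real n)\<^sup>2)"
      proof (cases "\<omega> \<in> bounded_until n s")
        case True
        then have "(norm (X s \<omega>))\<^sup>2 \<le> (real n)\<^sup>2"
          using bounded_untilD[OF True s, of s] s by (intro power_mono) auto
        then show ?thesis using True by (simp add: ennreal_leI)
      qed simp
    qed
    then show ?thesis by (simp add: emeasure_space_1)
  qed
  show "0 \<le> 3 * expectation (\<lambda>\<omega>. (norm (\<xi> \<omega>))\<^sup>2)" by simp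
  show "0 < 3 * (b - a) * c\<^sup>2 + 6 * c\<^sup>2 + 1"
    using a_less_b by (intro add_nonneg_pos add_nonneg_nonneg) auto
  fix s assume s: "s \<in> {a<..b}"
  obtain I where I: "ito_limit a s (\<lambda>u \<omega>. g (X u \<omega>)) I"
    and eq: "AE \<omega> in M. X s \<omega> = \<xi> \<omega> + (LINT u:{a<..s}|lborel. f (X u \<omega>)) + I \<omega>"
    using X_decomposition[OF s] by blast
  define h where "h \<omega> u = ennreal ((norm (X u \<omega>))\<^sup>2) * indicator (bounded_until n u) \<omega> * indicator {a<..s} u" for \<omega> u
  define R where "R \<omega> = (\<integral>\<^sup>+u. h \<omega> u \<partial>lborel)" for \<omega>
  note X_jointly_measurable[measurable] bounded_until_jointly_measurable[measurable]
  have "(\<lambda>(\<omega>, u). ennreal ((norm (case (\<omega>, u) of (\<omega>, s) \<Rightarrow> indicator {a<..b} s *\<^sub>R X s \<omega>))\<^sup>2)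
      * (case (\<omega>, u) of (\<omega>, u) \<Rightarrow> indicator (bounded_until n u) \<omega>) * indicator {a<..s} u) \<in> borel_measurable (M \<Otimes>\<^sub>M lborel)"
    by measurable
  then have hm [measurable]: "(\<lambda>(\<omega>, u). h \<omega> u) \<in> borel_measurable (M \<Otimes>\<^sub>M lborel)"
    by (rule measurable_cong[THEN iffD1, rotated]) (use s in \<open>auto simp: indicator_def h_def\<close>)
  have hs: "h \<omega> \<in> borel_measurable lborel" if "\<omega> \<in> space M" for \<omega>
  proof -
    have "(\<lambda>u. (\<lambda>(\<omega>, u). h \<omega> u) (\<omega>, u)) \<in> borel_measurable lborel"
      by (rule measurable_compose[OF measurable_Pair1'[OF that] hm])
    then show ?thesis by simp
  qed
  have [measurable]: "R \<in> borel_measurable M" unfolding R_def[abs_def] by measurable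
  have [measurable]: "\<xi> \<in> borel_measurable M" "I \<in> borel_measurable M"
    using initial I by (auto simp: sq_integrable_def ito_limit_def)
  have Gs [measurable]: "bounded_until n s \<in> sets M"
    using bounded_until_sets[of s n] s subalg[of s] by (auto simp: subalgebra_def)
  have RF: "(\<integral>\<^sup>+\<omega>. R \<omega> \<partial>M) = (\<integral>\<^sup>+u\<in>{a<..s}. ?\<phi> u \<partial>lborel)"
  proof -
    have "(\<integral>\<^sup>+\<omega>. R \<omega> \<partial>M) = (\<integral>\<^sup>+u. (\<integral>\<^sup>+\<omega>. h \<omega> u \<partial>M) \<partial>lborel)"
      unfolding R_def by (rule P.Fubini'[symmetric, OF hm])
    also have "\<dots> = (\<integral>\<^sup>+u\<in>{a<..s}. ?\<phi> u \<partial>lborel)"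
      by (intro nn_integral_cong) (auto simp: h_def indicator_def)
    finally show ?thesis .
  qed
  have lin: "(\<integral>\<^sup>+u\<in>{a<..s}. ennreal ((norm (L (X u \<omega>)))\<^sup>2) * indicator (bounded_until n u) \<omega> \<partial>lborel) \<le> ennreal (c\<^sup>2) * R \<omega>"
    if \<omega>: "\<omega> \<in> space M" and L: "\<And>x. norm (L x) \<le> c * norm x" for L :: "'b \<Rightarrow> 'b" and \<omega>
  proof -
    have "(\<integral>\<^sup>+u\<in>{a<..s}. ennreal ((norm (L (X u \<omega>)))\<^sup>2) * indicator (bounded_until n u) \<omega> \<partial>lborel)
        \<le> (\<integral>\<^sup>+u. ennreal (c\<^sup>2) * h \<omega> u \<partial>lborel)"
    proof (rule nn_integral_mono)
      fix u
      have "(norm (L (X u \<omega>)))\<^sup>2 \<le> (c * norm (X u \<omega>))\<^sup>2" by (intro power_mono L) auto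
      then have "ennreal ((norm (L (X u \<omega>)))\<^sup>2) \<le> ennreal (c\<^sup>2) * ennreal ((norm (X u \<omega>))\<^sup>2)"
        by (simp add: ennreal_mult[symmetric] power_mult_distrib ennreal_leI)
      then show "ennreal ((norm (L (X u \<omega>)))\<^sup>2) * indicator (bounded_until n u) \<omega> * indicator {a<..s} u \<le> ennreal (c\<^sup>2) * h \<omega> u"
        by (auto simp: h_def indicator_def)
    qed
    also have "\<dots> = ennreal (c\<^sup>2) * R \<omega>"
      unfolding R_def by (rule nn_integral_cmult[OF hs[OF \<omega>]])
    finally show ?thesis .
  qed
  have "?\<phi> s \<le> (\<integral>\<^sup>+\<omega>. 3 * ennreal ((norm (\<xi> \<omega>))\<^sup>2) + ennreal (3 * (b - a) * c\<^sup>2) * R \<omega>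
      + 3 * (ennreal ((norm (0 + I \<omega>))\<^sup>2) * indicator (bounded_until n s) \<omega>) \<partial>M)"
  proof (rule nn_integral_mono_AE)
    show "AE \<omega> in M. ennreal ((norm (X s \<omega>))\<^sup>2) * indicator (bounded_until n s) \<omega>
      \<le> 3 * ennreal ((norm (\<xi> \<omega>))\<^sup>2) + ennreal (3 * (b - a) * c\<^sup>2) * R \<omega>
        + 3 * (ennreal ((norm (0 + I \<omega>))\<^sup>2) * indicator (bounded_until n s) \<omega>)"
      using eq AE_space
    proof eventually_elim
      case (elim \<omega>)
      show ?case
      proof (cases "\<omega> \<in> bounded_until n s")
        case True
        let ?D = "LINT u:{a<..s}|lborel. f (X u \<omega>)"
        have "ennreal ((norm ?D)\<^sup>2) \<le> ennreal (s - a) * (\<integral>\<^sup>+u\<in>{a<..s}. ennreal ((norm (f (X u \<omega>)))\<^sup>2) \<partial>lborel)"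
          using s elim(2) by (intro set_integral_norm_sq_le set_integrable_X f) auto
        also have "(\<integral>\<^sup>+u\<in>{a<..s}. ennreal ((norm (f (X u \<omega>)))\<^sup>2) \<partial>lborel)
            = (\<integral>\<^sup>+u\<in>{a<..s}. ennreal ((norm (f (X u \<omega>)))\<^sup>2) * indicator (bounded_until n u) \<omega> \<partial>lborel)"
        proof (rule nn_integral_cong)
          fix u
          show "ennreal ((norm (f (X u \<omega>)))\<^sup>2) * indicator {a<..s} u
              = ennreal ((norm (f (X u \<omega>)))\<^sup>2) * indicator (bounded_until n u) \<omega> * indicator {a<..s} u"
            using bounded_until_antimono[of u s n] True by (cases "u \<in> {a<..s}") (auto simp: indicator_def)
        qed
        also have "ennreal (s - a) * \<dots> \<le> ennreal (b - a) * (ennreal (c\<^sup>2) * R \<omega>)"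
          using s by (intro mult_mono lin elim norm_f ennreal_leI) auto
        finally have D: "ennreal ((norm ?D)\<^sup>2) \<le> ennreal ((b - a) * c\<^sup>2) * R \<omega>"
          using a_less_b by (simp add: ennreal_mult mult.assoc)
        have "ennreal ((norm (X s \<omega>))\<^sup>2) \<le> ennreal (3 * (norm (\<xi> \<omega>))\<^sup>2 + 3 * (norm ?D)\<^sup>2 + 3 * (norm (I \<omega>))\<^sup>2)"
          unfolding elim(1) by (intro ennreal_leI norm_add3_sq_le)
        also have "\<dots> = 3 * ennreal ((norm (\<xi> \<omega>))\<^sup>2) + 3 * ennreal ((norm ?D)\<^sup>2) + 3 * ennreal ((norm (I \<omega>))\<^sup>2)"
          by (simp add: ennreal_mult)
        also have "\<dots> \<le> 3 * ennreal ((norm (\<xi> \<omega>))\<^sup>2) + 3 * (ennreal ((b - a) * c\<^sup>2) * R \<omega>) + 3 * ennreal ((norm (I \<omega>))\<^sup>2)"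
          by (intro add_mono mult_left_mono D order_refl) auto
        also have "3 * (ennreal ((b - a) * c\<^sup>2) * R \<omega>) = ennreal (3 * (b - a) * c\<^sup>2) * R \<omega>"
        proof -
          have "ennreal (3 * ((b - a) * c\<^sup>2)) = 3 * ennreal ((b - a) * c\<^sup>2)"
            using a_less_b by (subst ennreal_mult) auto
          then show ?thesis by (simp only: mult.assoc)
        qed
        finally show ?thesis using True by simp
      qed simp
    qed
  qed
  also have "\<dots> = 3 * ennreal (expectation (\<lambda>\<omega>. (norm (\<xi> \<omega>))\<^sup>2)) + ennreal (3 * (b - a) * c\<^sup>2) * (\<integral>\<^sup>+\<omega>. R \<omega> \<partial>M)
      + 3 * (\<integral>\<^sup>+\<omega>\<in>bounded_until n s. ennreal ((norm (0 + I \<omega>))\<^sup>2) \<partial>M)"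
    by (simp add: nn_integral_add nn_integral_cmult nn_integral_sq_integrable[OF initial])
  \<comment> \<open>The bound is used with \<open>Y = 0\<close>. As \<open>\<xi>\<close> need not be
    known at time \<open>a\<close>, it was split off beforehand by the estimate for three
    summands.\<close>
  also have "(\<integral>\<^sup>+\<omega>\<in>bounded_until n s. ennreal ((norm (0 + I \<omega>))\<^sup>2) \<partial>M)
      \<le> (\<integral>\<^sup>+\<omega>. ennreal ((norm (0::'b))\<^sup>2)
        + 2 * (\<integral>\<^sup>+u\<in>{a<..s}. ennreal ((norm (g (X u \<omega>)))\<^sup>2) * indicator (bounded_until n u) \<omega> \<partial>lborel) \<partial>M)"
    using s a_nonneg
    by (intro ito_limit_bound[OF _ _ I]) (auto simp: sq_integrable_def intro: bounded_until_sets bounded_until_left_continuous dest: subsetD[OF bounded_until_antimono])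
  also have "\<dots> \<le> (\<integral>\<^sup>+\<omega>. ennreal (2 * c\<^sup>2) * R \<omega> \<partial>M)"
  proof (rule nn_integral_mono)
    fix \<omega> assume "\<omega> \<in> space M"
    from mult_left_mono[OF lin[OF this norm_g], of 2]
    show "ennreal ((norm (0::'b))\<^sup>2) + 2 * (\<integral>\<^sup>+u\<in>{a<..s}. ennreal ((norm (g (X u \<omega>)))\<^sup>2) * indicator (bounded_until n u) \<omega> \<partial>lborel)
        \<le> ennreal (2 * c\<^sup>2) * R \<omega>"
      by (simp add: ennreal_mult mult.assoc)
  qed
  also have "\<dots> = ennreal (2 * c\<^sup>2) * (\<integral>\<^sup>+\<omega>. R \<omega> \<partial>M)"
    by (rule nn_integral_cmult) measurable
  finally have "?\<phi> s \<le> 3 * ennreal (expectation (\<lambda>\<omega>. (norm (\<xi> \<omega>))\<^sup>2)) + ennreal (3 * (b - a) * c\<^sup>2) * (\<integral>\<^sup>+\<omega>. R \<omega> \<partial>M)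
      + 3 * (ennreal (2 * c\<^sup>2) * (\<integral>\<^sup>+\<omega>. R \<omega> \<partial>M))"
    by (simp add: mult_left_mono)
  also have "\<dots> = ennreal (3 * expectation (\<lambda>\<omega>. (norm (\<xi> \<omega>))\<^sup>2)) + ennreal (3 * (b - a) * c\<^sup>2 + 6 * c\<^sup>2) * (\<integral>\<^sup>+\<omega>. R \<omega> \<partial>M)"
    using a_less_b by (simp add: ennreal_mult distrib_right mult.assoc[symmetric] add.assoc)
  also have "\<dots> \<le> ennreal (3 * expectation (\<lambda>\<omega>. (norm (\<xi> \<omega>))\<^sup>2)) + ennreal (3 * (b - a) * c\<^sup>2 + 6 * c\<^sup>2 + 1) * (\<integral>\<^sup>+\<omega>. R \<omega> \<partial>M)"
    by (intro add_left_mono mult_right_mono ennreal_leI) auto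
  finally show "?\<phi> s \<le> ennreal (3 * expectation (\<lambda>\<omega>. (norm (\<xi> \<omega>))\<^sup>2))
      + ennreal (3 * (b - a) * c\<^sup>2 + 6 * c\<^sup>2 + 1) * (\<integral>\<^sup>+u\<in>{a<..s}. ?\<phi> u \<partial>lborel)"
    unfolding RF .
qed

text \<open>Every path is bounded, so each \<omega> belongs to \<open>bounded_until n s\<close> for
  large \<open>n\<close>; Fatou's lemma carries the localized bound to the limit.\<close>

lemma X_second_moment:
  obtains C where "0 \<le> C" "\<And>s. s \<in> {a<..b} \<Longrightarrow> sq_integrable M (X s)"
    "\<And>s. s \<in> {a<..b} \<Longrightarrow> expectation (\<lambda>\<omega>. (norm (X s \<omega>))\<^sup>2) \<le> C"
proof -
  define B where "B = 3 * (b - a) * c\<^sup>2 + 6 * c\<^sup>2 + 1"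
  have B: "0 \<le> B" using a_less_b by (auto simp: B_def)
  define C where "C = 2 * (3 * expectation (\<lambda>\<omega>. (norm (\<xi> \<omega>))\<^sup>2)) * exp (2 * B * (b - a))"
  have C: "0 \<le> C" by (simp add: C_def)
  have bd: "(\<integral>\<^sup>+\<omega>. ennreal ((norm (X s \<omega>))\<^sup>2) \<partial>M) \<le> ennreal C" if s: "s \<in> {a<..b}" for s
  proof -
    have [measurable]: "X s \<in> borel_measurable M" "bounded_until n s \<in> sets M" for n
      using X_measurable[OF s] bounded_until_sets[of s n] s subalg[of s] by (auto simp: subalgebra_def)
    have "(\<integral>\<^sup>+\<omega>. ennreal ((norm (X s \<omega>))\<^sup>2) \<partial>M)
        \<le> (\<integral>\<^sup>+\<omega>. liminf (\<lambda>n. ennreal ((norm (X s \<omega>))\<^sup>2) * indicator (bounded_until n s) \<omega>) \<partial>M)"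
    proof (rule nn_integral_mono)
      fix \<omega> assume \<omega>: "\<omega> \<in> space M"
      obtain K where K: "\<And>s. s \<in> {a<..b} \<Longrightarrow> norm (X s \<omega>) \<le> K" using X_bounded[OF \<omega>] by blast
      obtain n0 :: nat where n0: "K \<le> real n0" using real_arch_simple by blast
      have "\<omega> \<in> bounded_until n s" if "n \<ge> n0" for n
      proof -
        have "K \<le> real n" using n0 that by linarith
        then show ?thesis using K \<omega> by (force simp: bounded_until_def)
      qed
      then have "eventually (\<lambda>n. ennreal ((norm (X s \<omega>))\<^sup>2) * indicator (bounded_until n s) \<omega> = ennreal ((norm (X s \<omega>))\<^sup>2)) sequentially"
        unfolding eventually_sequentially by (intro exI[of _ n0]) auto
      then have "(\<lambda>n. ennreal ((norm (X s \<omega>))\<^sup>2) * indicator (bounded_until n s) \<omega>) \<longlonglongrightarrow> ennreal ((norm (X s \<omega>))\<^sup>2)"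
        by (rule tendsto_eventually)
      then have "liminf (\<lambda>n. ennreal ((norm (X s \<omega>))\<^sup>2) * indicator (bounded_until n s) \<omega>) = ennreal ((norm (X s \<omega>))\<^sup>2)"
        by (intro lim_imp_Liminf) auto
      then show "ennreal ((norm (X s \<omega>))\<^sup>2) \<le> liminf (\<lambda>n. ennreal ((norm (X s \<omega>))\<^sup>2) * indicator (bounded_until n s) \<omega>)"
        by simp
    qed
    also have "\<dots> \<le> liminf (\<lambda>n. \<integral>\<^sup>+\<omega>\<in>bounded_until n s. ennreal ((norm (X s \<omega>))\<^sup>2) \<partial>M)"
      by (rule nn_integral_liminf) measurable
    also have "\<dots> \<le> liminf (\<lambda>n::nat. ennreal C)"
    proof (intro Liminf_mono always_eventually allI)
      fix n
      have "exp (2 * B * (s - a)) \<le> exp (2 * B * (b - a))" using s B by (simp add: mult_left_mono)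
      then show "(\<integral>\<^sup>+\<omega>\<in>bounded_until n s. ennreal ((norm (X s \<omega>))\<^sup>2) \<partial>M) \<le> ennreal C"
        unfolding C_def
        by (intro order_trans[OF localized_moment[OF s]] ennreal_leI, fold B_def, intro mult_left_mono) auto
    qed
    also have "\<dots> = ennreal C" by (simp add: Liminf_const)
    finally show ?thesis .
  qed
  show ?thesis
    using that[OF C] sq_integrableI_nn_integral[OF X_measurable bd C] by blast
qed

text \<open>The solution with its right limit as value at \<open>a\<close>, where \<open>X\<close>
  itself may hold the value before the jump. It makes second moments continuous on the closed
  interval.\<close>

definition Xe :: "real \<Rightarrow> 'a \<Rightarrow> 'b" where
  "Xe s = (if s \<le> a then \<xi> else X s)"

lemma Xe_eq: "a < s \<Longrightarrow> Xe s = X s" and Xe_a: "Xe a = \<xi>"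
  by (auto simp: Xe_def)

lemma Xe_second_moment:
  obtains C where "0 < C" "\<And>s. s \<in> {a..b} \<Longrightarrow> sq_integrable M (Xe s)"
    "\<And>s. s \<in> {a..b} \<Longrightarrow> expectation (\<lambda>\<omega>. (norm (Xe s \<omega>))\<^sup>2) \<le> C\<^sup>2"
proof -
  obtain C0 where C0: "0 \<le> C0" "\<And>s. s \<in> {a<..b} \<Longrightarrow> sq_integrable M (X s)"
    "\<And>s. s \<in> {a<..b} \<Longrightarrow> expectation (\<lambda>\<omega>. (norm (X s \<omega>))\<^sup>2) \<le> C0"
    using X_second_moment by blast
  define e where "e = expectation (\<lambda>\<omega>. (norm (\<xi> \<omega>))\<^sup>2)"
  have e: "0 \<le> e" by (simp add: e_def)
  have sq: "C0 + e \<le> (sqrt (C0 + e) + 1)\<^sup>2" using C0(1) e by (simp add: power2_sum)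
  show ?thesis
  proof (rule that[of "sqrt (C0 + e) + 1"])
    show "0 < sqrt (C0 + e) + 1" using C0(1) e by (intro add_nonneg_pos) auto
    fix s assume s: "s \<in> {a..b}"
    show "sq_integrable M (Xe s)" using C0(2)[of s] s initial by (auto simp: Xe_def)
    have "expectation (\<lambda>\<omega>. (norm (Xe s \<omega>))\<^sup>2) \<le> C0 + e"
      using C0(1) C0(3)[of s] e s by (cases "s = a") (auto simp: Xe_def e_def[symmetric])
    then show "expectation (\<lambda>\<omega>. (norm (Xe s \<omega>))\<^sup>2) \<le> (sqrt (C0 + e) + 1)\<^sup>2" using sq by linarith
  qed
qed

text \<open>The integrals up to \<open>u\<close> and up to \<open>v\<close> come from separate
  existence statements; \<open>ito_limit_diff\<close> recognizes their difference as an integral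
  over \<open>{u<..v}\<close>.\<close>

lemma Xe_increment:
  assumes uv: "a \<le> u" "u < v" "v \<le> b"
  obtains Q where "ito_limit u v (\<lambda>s \<omega>. g (X s \<omega>)) Q"
    "AE \<omega> in M. Xe v \<omega> = Xe u \<omega> + (LINT s:{u<..v}|lborel. f (X s \<omega>)) + Q \<omega>"
proof -
  obtain Iv where Iv: "ito_limit a v (\<lambda>s \<omega>. g (X s \<omega>)) Iv"
    "AE \<omega> in M. X v \<omega> = \<xi> \<omega> + (LINT s:{a<..v}|lborel. f (X s \<omega>)) + Iv \<omega>"
    using X_decomposition[of v] uv by auto
  show ?thesis
  proof (cases "u = a")
    case True
    then show ?thesis using that[of Iv] Iv uv by (simp add: Xe_def)
  next
    case False
    then have u: "a < u" using uv by simp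
    obtain Iu where Iu: "ito_limit a u (\<lambda>s \<omega>. g (X s \<omega>)) Iu"
      "AE \<omega> in M. X u \<omega> = \<xi> \<omega> + (LINT s:{a<..u}|lborel. f (X s \<omega>)) + Iu \<omega>"
      using X_decomposition[of u] uv u by auto
    show ?thesis
    proof (rule that[of "\<lambda>\<omega>. Iv \<omega> - Iu \<omega>"])
      show "ito_limit u v (\<lambda>s \<omega>. g (X s \<omega>)) (\<lambda>\<omega>. Iv \<omega> - Iu \<omega>)"
        using uv by (intro ito_limit_diff[OF a_nonneg _ _ Iv(1) Iu(1)]) auto
      show "AE \<omega> in M. Xe v \<omega> = Xe u \<omega> + (LINT s:{u<..v}|lborel. f (X s \<omega>)) + (Iv \<omega> - Iu \<omega>)"
        using Iv(2) Iu(2) AE_space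
      proof eventually_elim
        case (elim \<omega>)
        have "(LINT s:{a<..u} \<union> {u<..v}|lborel. f (X s \<omega>)) = (LINT s:{a<..u}|lborel. f (X s \<omega>)) + (LINT s:{u<..v}|lborel. f (X s \<omega>))"
          using uv elim(3) by (intro set_integral_Un set_integrable_X f) auto
        moreover have "{a<..u} \<union> {u<..v} = {a<..v}" using uv by auto
        ultimately show ?case using elim u uv by (simp add: Xe_eq)
      qed
    qed
  qed
qed

text \<open>This bound and its companion for the diffusion are used twice: with
  \<open>\<eta> = 0\<close> for a crude estimate of increments, then with
  \<open>\<eta> = X u\<close> for the remainders of the expansion, where the crude estimate supplies
  a \<open>K\<close> proportional to \<open>v - u\<close>.\<close>

lemma drift_bound:
  assumes uv: "a \<le> u" "u \<le> v" "v \<le> b" and K: "0 \<le> K"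
    and \<eta>: "\<eta> \<in> borel_measurable M" and R: "R \<in> borel_measurable M"
    and eq: "AE \<omega> in M. R \<omega> = (LINT s:{u<..v}|lborel. f (X s \<omega>)) - (v - u) *\<^sub>R f (\<eta> \<omega>)"
    and bd: "\<And>s. s \<in> {u<..v} \<Longrightarrow> (\<integral>\<^sup>+\<omega>. ennreal ((norm (X s \<omega> - \<eta> \<omega>))\<^sup>2) \<partial>M) \<le> ennreal K"
  shows "sq_integrable M R" and "expectation (\<lambda>\<omega>. (norm (R \<omega>))\<^sup>2) \<le> c\<^sup>2 * K * (v - u)\<^sup>2"
proof -
  note en = X_energy[OF f norm_f K \<eta> uv bd]
  have "(\<integral>\<^sup>+\<omega>. ennreal ((norm (R \<omega>))\<^sup>2) \<partial>M)
      \<le> (\<integral>\<^sup>+\<omega>. ennreal (v - u) * (\<integral>\<^sup>+s\<in>{u<..v}. ennreal ((norm (f (X s \<omega> - \<eta> \<omega>)))\<^sup>2) \<partial>lborel) \<partial>M)"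
  proof (rule nn_integral_mono_AE)
    show "AE \<omega> in M. ennreal ((norm (R \<omega>))\<^sup>2) \<le> ennreal (v - u) * (\<integral>\<^sup>+s\<in>{u<..v}. ennreal ((norm (f (X s \<omega> - \<eta> \<omega>)))\<^sup>2) \<partial>lborel)"
      using eq AE_space
    proof eventually_elim
      case (elim \<omega>)
      have i1: "set_integrable lborel {u<..v} (\<lambda>s. f (X s \<omega>))"
        using uv elim(2) by (intro set_integrable_X f) auto
      have i2: "set_integrable lborel {u<..v} (\<lambda>s. f (\<eta> \<omega>))"
        unfolding set_integrable_def by (rule integrable_scaleR_left) (use uv in simp)
      have "(LINT s:{u<..v}|lborel. f (\<eta> \<omega>)) = (v - u) *\<^sub>R f (\<eta> \<omega>)"
        using uv by (simp add: set_lebesgue_integral_def)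
      then have "R \<omega> = (LINT s:{u<..v}|lborel. f (X s \<omega>) - f (\<eta> \<omega>))"
        using set_integral_diff(2)[OF i1 i2] elim(1) by simp
      then have "R \<omega> = (LINT s:{u<..v}|lborel. f (X s \<omega> - \<eta> \<omega>))"
        by (simp add: linear_diff[OF bounded_linear.linear[OF f]])
      moreover have "set_integrable lborel {u<..v} (\<lambda>s. f (X s \<omega> - \<eta> \<omega>))"
        using set_integral_diff(1)[OF i1 i2] by (simp add: linear_diff[OF bounded_linear.linear[OF f]])
      ultimately show ?case using set_integral_norm_sq_le uv by simp
    qed
  qed
  also have "\<dots> = ennreal (v - u) * (\<integral>\<^sup>+\<omega>. (\<integral>\<^sup>+s\<in>{u<..v}. ennreal ((norm (f (X s \<omega> - \<eta> \<omega>)))\<^sup>2) \<partial>lborel) \<partial>M)"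
    by (rule nn_integral_cmult[OF en(1)])
  also have "\<dots> \<le> ennreal (v - u) * ennreal (c\<^sup>2 * K * (v - u))"
    by (intro mult_left_mono en(2) zero_le)
  also have "\<dots> = ennreal (c\<^sup>2 * K * (v - u)\<^sup>2)"
    using uv K by (simp add: ennreal_mult[symmetric] power2_eq_square mult_ac)
  finally have "(\<integral>\<^sup>+\<omega>. ennreal ((norm (R \<omega>))\<^sup>2) \<partial>M) \<le> ennreal (c\<^sup>2 * K * (v - u)\<^sup>2)" .
  from sq_integrableI_nn_integral[OF R this] K
  show "sq_integrable M R" "expectation (\<lambda>\<omega>. (norm (R \<omega>))\<^sup>2) \<le> c\<^sup>2 * K * (v - u)\<^sup>2" by auto
qed

lemma diffusion_bound:
  assumes uv: "a \<le> u" "u \<le> v" "v \<le> b" and K: "0 \<le> K"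
    and \<eta>: "\<eta> \<in> borel_measurable M" and Q: "ito_limit u v (\<lambda>s \<omega>. g (X s \<omega> - \<eta> \<omega>)) Q"
    and bd: "\<And>s. s \<in> {u<..v} \<Longrightarrow> (\<integral>\<^sup>+\<omega>. ennreal ((norm (X s \<omega> - \<eta> \<omega>))\<^sup>2) \<partial>M) \<le> ennreal K"
  shows "sq_integrable M Q" and "expectation (\<lambda>\<omega>. (norm (Q \<omega>))\<^sup>2) \<le> 2 * (c\<^sup>2 * K * (v - u))"
    and "\<And>Y. Y \<in> borel_measurable (F u) \<Longrightarrow> sq_integrable M Y \<Longrightarrow> expectation (\<lambda>\<omega>. Y \<omega> \<bullet> Q \<omega>) = 0"
proof -
  note en = X_energy[OF g norm_g K \<eta> uv bd]
  have "0 \<le> u" "0 \<le> c\<^sup>2 * K * (v - u)" using a_nonneg uv K by auto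
  note r = ito_limit_sq_integrable[OF this(1) uv(2) Q en(1) this(2) en(2)]
  show "sq_integrable M Q" "expectation (\<lambda>\<omega>. (norm (Q \<omega>))\<^sup>2) \<le> 2 * (c\<^sup>2 * K * (v - u))"
    using r(1,2) by blast+
  show "\<And>Y. Y \<in> borel_measurable (F u) \<Longrightarrow> sq_integrable M Y \<Longrightarrow> expectation (\<lambda>\<omega>. Y \<omega> \<bullet> Q \<omega>) = 0"
    by (rule r(3))
qed

text \<open>The diffusion contributes the order \<open>v - u\<close>. The drift contributes the
  square of that, one factor of which is absorbed by \<open>b - a\<close>. The left end
  \<open>u = a\<close> is included, which later gives continuity there.\<close>

lemma Xe_increment_bound:
  obtains C where "0 < C" "\<And>u v. a \<le> u \<Longrightarrow> u < v \<Longrightarrow> v \<le> b \<Longrightarrow> expectation (\<lambda>\<omega>. (norm (Xe v \<omega> - Xe u \<omega>))\<^sup>2) \<le> C * (v - u)"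
proof -
  obtain C0 where C0: "0 < C0" "\<And>s. s \<in> {a..b} \<Longrightarrow> sq_integrable M (Xe s)"
    "\<And>s. s \<in> {a..b} \<Longrightarrow> expectation (\<lambda>\<omega>. (norm (Xe s \<omega>))\<^sup>2) \<le> C0\<^sup>2"
    using Xe_second_moment by blast
  define C where "C = 2 * (c\<^sup>2 * C0\<^sup>2 * (b - a)) + 2 * (2 * (c\<^sup>2 * C0\<^sup>2)) + 1"
  have C: "0 < C" using a_less_b by (auto simp: C_def intro!: add_nonneg_pos add_nonneg_nonneg)
  have "expectation (\<lambda>\<omega>. (norm (Xe v \<omega> - Xe u \<omega>))\<^sup>2) \<le> C * (v - u)" if uv: "a \<le> u" "u < v" "v \<le> b" for u v
  proof -
    obtain Q where Q: "ito_limit u v (\<lambda>s \<omega>. g (X s \<omega>)) Q"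
      and eq: "AE \<omega> in M. Xe v \<omega> = Xe u \<omega> + (LINT s:{u<..v}|lborel. f (X s \<omega>)) + Q \<omega>"
      using Xe_increment[OF uv] by blast
    have bd: "(\<integral>\<^sup>+\<omega>. ennreal ((norm (X s \<omega> - 0))\<^sup>2) \<partial>M) \<le> ennreal (C0\<^sup>2)" if "s \<in> {u<..v}" for s
      using C0(2,3)[of s] nn_integral_sq_integrable[of M "Xe s"] that uv by (simp add: Xe_eq ennreal_leI)
    have Q': "ito_limit u v (\<lambda>s \<omega>. g (X s \<omega> - 0)) Q" using Q by simp
    note q = diffusion_bound[OF uv(1) less_imp_le[OF uv(2)] uv(3) zero_le_power2 _ Q' bd, simplified]
    define R where "R \<omega> = Xe v \<omega> - Xe u \<omega> - Q \<omega>" for \<omega>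
    have "sq_integrable M R"
      unfolding R_def using uv by (intro sq_integrable_diff C0 q) auto
    then have Rm: "R \<in> borel_measurable M" by (simp add: sq_integrable_def)
    have "AE \<omega> in M. R \<omega> = (LINT s:{u<..v}|lborel. f (X s \<omega>)) - (v - u) *\<^sub>R f 0"
      using eq by eventually_elim (simp add: R_def linear_0[OF bounded_linear.linear[OF f]])
    note r = drift_bound[OF uv(1) less_imp_le[OF uv(2)] uv(3) zero_le_power2 _ Rm this bd, simplified]
    have "expectation (\<lambda>\<omega>. (norm (Xe v \<omega> - Xe u \<omega>))\<^sup>2) \<le> expectation (\<lambda>\<omega>. 2 * (norm (R \<omega>))\<^sup>2 + 2 * (norm (Q \<omega>))\<^sup>2)"
    proof (rule integral_mono)
      have "sq_integrable M (\<lambda>\<omega>. Xe v \<omega> - Xe u \<omega>)" using uv by (intro sq_integrable_diff C0) auto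
      then show "integrable M (\<lambda>\<omega>. (norm (Xe v \<omega> - Xe u \<omega>))\<^sup>2)" by (simp add: sq_integrable_def)
      show "integrable M (\<lambda>\<omega>. 2 * (norm (R \<omega>))\<^sup>2 + 2 * (norm (Q \<omega>))\<^sup>2)"
        using r(1) q(1) by (simp add: sq_integrable_def)
      show "(norm (Xe v \<omega> - Xe u \<omega>))\<^sup>2 \<le> 2 * (norm (R \<omega>))\<^sup>2 + 2 * (norm (Q \<omega>))\<^sup>2" for \<omega>
        using norm_add_sq_le[of "R \<omega>" "Q \<omega>"] by (simp add: R_def)
    qed
    also have "\<dots> = 2 * expectation (\<lambda>\<omega>. (norm (R \<omega>))\<^sup>2) + 2 * expectation (\<lambda>\<omega>. (norm (Q \<omega>))\<^sup>2)"
      using r(1) q(1) by (simp add: sq_integrable_def)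
    also have "\<dots> \<le> 2 * (c\<^sup>2 * C0\<^sup>2 * (v - u)\<^sup>2) + 2 * (2 * (c\<^sup>2 * C0\<^sup>2 * (v - u)))"
      using r(2) q(2) by simp
    also have "\<dots> \<le> 2 * (c\<^sup>2 * C0\<^sup>2 * ((b - a) * (v - u))) + 2 * (2 * (c\<^sup>2 * C0\<^sup>2 * (v - u)))"
      unfolding power2_eq_square[of "v - u"] using uv by (intro add_right_mono mult_left_mono mult_right_mono) auto
    also have "\<dots> \<le> C * (v - u)"
      unfolding C_def using uv by (simp add: algebra_simps)
    finally show ?thesis .
  qed
  then show ?thesis using that C by blast
qed

end

section \<open>The differential equation of the second moments\<close>

text \<open>The rate refers to \<open>k'\<close> at the left end of each increment. For increments
  that end at \<open>s\<close> this is \<open>k' u\<close> with \<open>u < s\<close>, and continuity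
  of \<open>k'\<close> moves it to \<open>s\<close>.\<close>

lemma has_real_derivative_if_rate:
  fixes k k' :: "real \<Rightarrow> real"
  assumes rate: "\<And>u v. a \<le> u \<Longrightarrow> u < v \<Longrightarrow> v \<le> b \<Longrightarrow> \<bar>k v - k u - (v - u) * k' u\<bar> \<le> C * (v - u) * sqrt (v - u)"
    and cont: "continuous_on {a..b} k'" and s: "s \<in> {a..b}"
  shows "(k has_real_derivative k' s) (at s within {a..b})"
proof -
  have bound: "\<bar>(k t - k s) / (t - s) - k' s\<bar> \<le> \<bar>C\<bar> * sqrt \<bar>t - s\<bar> + \<bar>k' t - k' s\<bar>" if t: "t \<in> {a..b}" "t \<noteq> s" for t
  proof -
    define u v where "u = min s t" and "v = max s t"
    have uv: "a \<le> u" "u < v" "v \<le> b" using s t by (auto simp: u_def v_def)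
    have q: "(k t - k s) / (t - s) = (k v - k u) / (v - u)"
      using t(2) by (auto simp: u_def v_def min_def max_def) (simp add: divide_simps, simp add: algebra_simps)
    have "\<bar>(k v - k u) / (v - u) - k' u\<bar> = \<bar>k v - k u - (v - u) * k' u\<bar> / (v - u)"
    proof -
      have "(k v - k u) / (v - u) - k' u = (k v - k u - (v - u) * k' u) / (v - u)"
        using uv by (simp add: diff_divide_distrib)
      then show ?thesis using uv by simp
    qed
    also have "\<dots> \<le> C * (v - u) * sqrt (v - u) / (v - u)"
      using uv by (intro divide_right_mono rate) auto
    also have "\<dots> \<le> \<bar>C\<bar> * sqrt (v - u)"
      using uv by (simp add: mult_right_mono)
    finally have "\<bar>(k v - k u) / (v - u) - k' u\<bar> \<le> \<bar>C\<bar> * sqrt (v - u)" .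
    moreover have "\<bar>C\<bar> * sqrt (v - u) = \<bar>C\<bar> * sqrt \<bar>t - s\<bar>" by (auto simp: u_def v_def)
    moreover have "\<bar>k' u - k' s\<bar> \<le> \<bar>k' t - k' s\<bar>" by (auto simp: u_def min_def)
    ultimately show ?thesis unfolding q by linarith
  qed
  have "((\<lambda>t. \<bar>C\<bar> * sqrt \<bar>t - s\<bar> + \<bar>k' t - k' s\<bar>) \<longlongrightarrow> \<bar>C\<bar> * sqrt \<bar>s - s\<bar> + \<bar>k' s - k' s\<bar>) (at s within {a..b})"
    using cont s by (intro tendsto_intros) (auto simp: continuous_on_def)
  then have "((\<lambda>t. \<bar>C\<bar> * sqrt \<bar>t - s\<bar> + \<bar>k' t - k' s\<bar>) \<longlongrightarrow> 0) (at s within {a..b})" by simp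
  then have "((\<lambda>t. (k t - k s) / (t - s) - k' s) \<longlongrightarrow> 0) (at s within {a..b})"
  proof (rule Lim_null_comparison[rotated])
    show "\<forall>\<^sub>F t in at s within {a..b}. norm ((k t - k s) / (t - s) - k' s) \<le> \<bar>C\<bar> * sqrt \<bar>t - s\<bar> + \<bar>k' t - k' s\<bar>"
      using bound by (auto simp: eventually_at_filter intro!: always_eventually)
  qed
  then show ?thesis by (simp add: has_field_derivative_iff LIM_zero_iff)
qed

section \<open>Expansion over a short interval and the derivative of the second moment\<close>

context linear_sde
begin

text \<open>One Euler-Maruyama step: \<open>R\<close> is the time integral of
  \<open>f (X s) - f (X u)\<close>, \<open>Q\<close> the stochastic integral of
  \<open>g (X s) - g (X u)\<close>. As the increments of \<open>X\<close> have second moments of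
  order \<open>v - u\<close>, the root mean square of \<open>R\<close> has order 3/2 in
  \<open>v - u\<close>. That of \<open>Q\<close> has only order 1, too large to be neglected against
  \<open>X u\<close>; orthogonality disposes of this product. The condition \<open>a < u\<close>
  makes \<open>X u\<close> known at time \<open>u\<close>.\<close>

lemma local_expansion:
  obtains C where "0 < C" "\<And>u v. a < u \<Longrightarrow> u < v \<Longrightarrow> v \<le> b \<Longrightarrow>
    \<exists>Q R. sq_integrable M Q \<and> sq_integrable M R \<and>
      expectation (\<lambda>\<omega>. (norm (Q \<omega>))\<^sup>2) \<le> (C * (v - u))\<^sup>2 \<and>
      expectation (\<lambda>\<omega>. (norm (R \<omega>))\<^sup>2) \<le> (C * ((v - u) * sqrt (v - u)))\<^sup>2 \<and>
      (\<forall>Y. Y \<in> borel_measurable (F u) \<longrightarrow> sq_integrable M Y \<longrightarrow> expectation (\<lambda>\<omega>. Y \<omega> \<bullet> Q \<omega>) = 0) \<and>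
      (AE \<omega> in M. X v \<omega> = (X u \<omega> + (v - u) *\<^sub>R f (X u \<omega>)) + (W v \<omega> - W u \<omega>) *\<^sub>R g (X u \<omega>) + Q \<omega> + R \<omega>)"
proof -
  obtain C1 where C1: "0 < C1" "\<And>u v. a \<le> u \<Longrightarrow> u < v \<Longrightarrow> v \<le> b \<Longrightarrow> expectation (\<lambda>\<omega>. (norm (Xe v \<omega> - Xe u \<omega>))\<^sup>2) \<le> C1 * (v - u)"
    using Xe_increment_bound by blast
  have C0: "\<And>s. s \<in> {a..b} \<Longrightarrow> sq_integrable M (Xe s)"
    using Xe_second_moment by blast
  define C where "C = sqrt (2 * c\<^sup>2 * C1) + 1"
  have C: "0 < C" using C1(1) by (auto simp: C_def intro!: add_nonneg_pos)
  have C2: "2 * c\<^sup>2 * C1 \<le> C\<^sup>2" using C1(1) by (simp add: C_def power2_sum)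
  show ?thesis
  proof (rule that[OF C])
    fix u v assume uv: "a < u" "u < v" "v \<le> b"
    let ?h = "v - u"
    have uv': "a \<le> u" "u \<le> v" using uv by auto
    have sqX: "sq_integrable M (X s)" if "s \<in> {u..v}" for s using C0[of s] that uv by (simp add: Xe_eq)
    have Xu: "X u \<in> borel_measurable M" "X u \<in> borel_measurable (F u)" "sq_integrable M (X u)"
      using X_measurable X_measurable_F sqX uv by auto
    have K: "0 \<le> C1 * ?h" using C1(1) uv by simp
    have bd: "(\<integral>\<^sup>+\<omega>. ennreal ((norm (X s \<omega> - X u \<omega>))\<^sup>2) \<partial>M) \<le> ennreal (C1 * ?h)" if s: "s \<in> {u<..v}" for s
    proof -
      have "expectation (\<lambda>\<omega>. (norm (X s \<omega> - X u \<omega>))\<^sup>2) \<le> C1 * (s - u)"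
        using C1(2)[of u s] s uv by (simp add: Xe_eq)
      also have "\<dots> \<le> C1 * ?h" using C1(1) s by simp
      finally show ?thesis
        using nn_integral_sq_integrable[OF sq_integrable_diff[OF sqX Xu(3)], of s] s by (simp add: ennreal_leI)
    qed
    obtain Q0 where Q0: "ito_limit u v (\<lambda>s \<omega>. g (X s \<omega>)) Q0"
      and eq: "AE \<omega> in M. Xe v \<omega> = Xe u \<omega> + (LINT s:{u<..v}|lborel. f (X s \<omega>)) + Q0 \<omega>"
      using Xe_increment[of u v] uv by auto
    have gm: "(\<lambda>\<omega>. - g (X u \<omega>)) \<in> borel_measurable (F u)"
      using measurable_compose[OF Xu(2) borel_measurable_continuous_onI[OF linear_continuous_on[OF g]]]
      by (rule borel_measurable_uminus)
    define Q where "Q \<omega> = Q0 \<omega> + (W v \<omega> - W u \<omega>) *\<^sub>R (- g (X u \<omega>))" for \<omega>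
    have "ito_limit u v (\<lambda>s \<omega>. g (X s \<omega>) + (- g (X u \<omega>))) Q"
      unfolding Q_def using uv a_nonneg by (intro ito_limit_add_initial Q0 gm) auto
    then have Q: "ito_limit u v (\<lambda>s \<omega>. g (X s \<omega> - X u \<omega>)) Q"
      by (simp add: linear_diff[OF bounded_linear.linear[OF g]])
    note q = diffusion_bound[OF uv' uv(3) K Xu(1) Q bd]
    define R where "R \<omega> = X v \<omega> - X u \<omega> - Q0 \<omega> - ?h *\<^sub>R f (X u \<omega>)" for \<omega>
    have "f \<in> borel_measurable borel" by (intro borel_measurable_continuous_onI linear_continuous_on f)
    moreover have "X v \<in> borel_measurable M" "Q0 \<in> borel_measurable M"
      using X_measurable[of v] uv Q0 by (auto simp: ito_limit_def)
    ultimately have Rm: "R \<in> borel_measurable M" unfolding R_def using Xu(1) by measurable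
    have "AE \<omega> in M. R \<omega> = (LINT s:{u<..v}|lborel. f (X s \<omega>)) - ?h *\<^sub>R f (X u \<omega>)"
      using eq by eventually_elim (use uv in \<open>simp add: R_def Xe_eq\<close>)
    note r = drift_bound[OF uv' uv(3) K Xu(1) Rm this bd]
    have "c\<^sup>2 * (C1 * ?h) * ?h\<^sup>2 \<le> (C * (?h * sqrt ?h))\<^sup>2"
    proof -
      have "0 \<le> c\<^sup>2 * C1" using C1(1) by simp
      then have "c\<^sup>2 * C1 \<le> C\<^sup>2" using C2 by linarith
      then have "(c\<^sup>2 * C1) * (?h * ?h\<^sup>2) \<le> C\<^sup>2 * (?h * ?h\<^sup>2)" using uv by (intro mult_right_mono) auto
      then show ?thesis using uv by (simp add: power_mult_distrib mult_ac)
    qed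
    with r(2) have r2: "expectation (\<lambda>\<omega>. (norm (R \<omega>))\<^sup>2) \<le> (C * (?h * sqrt ?h))\<^sup>2" by linarith
    have "2 * (c\<^sup>2 * (C1 * ?h) * ?h) \<le> (C * ?h)\<^sup>2"
    proof -
      have "(2 * c\<^sup>2 * C1) * ?h\<^sup>2 \<le> C\<^sup>2 * ?h\<^sup>2" using C2 by (intro mult_right_mono) auto
      then show ?thesis by (simp add: power_mult_distrib power2_eq_square mult_ac)
    qed
    with q(2) have q2: "expectation (\<lambda>\<omega>. (norm (Q \<omega>))\<^sup>2) \<le> (C * ?h)\<^sup>2" by linarith
    have "X v \<omega> = (X u \<omega> + ?h *\<^sub>R f (X u \<omega>)) + (W v \<omega> - W u \<omega>) *\<^sub>R g (X u \<omega>) + Q \<omega> + R \<omega>" for \<omega>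
      by (simp add: Q_def R_def)
    then show "\<exists>Q R. sq_integrable M Q \<and> sq_integrable M R \<and>
      expectation (\<lambda>\<omega>. (norm (Q \<omega>))\<^sup>2) \<le> (C * ?h)\<^sup>2 \<and>
      expectation (\<lambda>\<omega>. (norm (R \<omega>))\<^sup>2) \<le> (C * (?h * sqrt ?h))\<^sup>2 \<and>
      (\<forall>Y. Y \<in> borel_measurable (F u) \<longrightarrow> sq_integrable M Y \<longrightarrow> expectation (\<lambda>\<omega>. Y \<omega> \<bullet> Q \<omega>) = 0) \<and>
      (AE \<omega> in M. X v \<omega> = (X u \<omega> + ?h *\<^sub>R f (X u \<omega>)) + (W v \<omega> - W u \<omega>) *\<^sub>R g (X u \<omega>) + Q \<omega> + R \<omega>)"
      using q(1,3) r(1) q2 r2 by (intro exI[of _ Q] exI[of _ R]) auto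
  qed
qed

definition second_moment :: "('b \<Rightarrow> 'b \<Rightarrow> real) \<Rightarrow> real \<Rightarrow> real" where
  "second_moment B s = expectation (\<lambda>\<omega>. B (Xe s \<omega>) (Xe s \<omega>))"

text \<open>The drift in Ito's formula for \<open>B (X s) (X s)\<close>, polarized, so that it is
  again a bilinear form to which the results on \<open>second_moment\<close> apply.\<close>

definition generator :: "('b \<Rightarrow> 'b \<Rightarrow> real) \<Rightarrow> 'b \<Rightarrow> 'b \<Rightarrow> real" where
  "generator B x y = B (f x) y + B x (f y) + B (g x) (g y)"

lemma bounded_bilinear_generator:
  assumes "bounded_bilinear B"
  shows "bounded_bilinear (generator B)"
proof -
  interpret B: bounded_bilinear B by fact
  note lin = linear_add[OF bounded_linear.linear[OF f]] linear_add[OF bounded_linear.linear[OF g]]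
    linear_scale[OF bounded_linear.linear[OF f]] linear_scale[OF bounded_linear.linear[OF g]]
  have "bilinear (generator B)"
    unfolding bilinear_def generator_def
    by (intro conjI allI linearI)
      (simp_all add: lin B.add_left B.add_right B.scaleR_left B.scaleR_right algebra_simps)
  then show ?thesis by (simp add: bilinear_conv_bounded_bilinear)
qed

text \<open>Weaker than the expansion but valid from \<open>u = a\<close> on, since it rests on
  increments alone and asks nothing of the filtration at \<open>u\<close>.\<close>

lemma second_moment_Hoelder:
  assumes B: "bounded_bilinear B"
  obtains C where "\<And>u v. a \<le> u \<Longrightarrow> u < v \<Longrightarrow> v \<le> b \<Longrightarrow> \<bar>second_moment B v - second_moment B u\<bar> \<le> C * sqrt (v - u)"
proof -
  interpret B: bounded_bilinear B by fact
  obtain K where K: "\<And>x y. norm (B x y) \<le> norm x * norm y * K" "0 \<le> K"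
    using B.nonneg_bounded by blast
  obtain C1 where C1: "0 < C1" "\<And>u v. a \<le> u \<Longrightarrow> u < v \<Longrightarrow> v \<le> b \<Longrightarrow> expectation (\<lambda>\<omega>. (norm (Xe v \<omega> - Xe u \<omega>))\<^sup>2) \<le> C1 * (v - u)"
    using Xe_increment_bound by blast
  obtain m where m: "0 < m" "\<And>s. s \<in> {a..b} \<Longrightarrow> sq_integrable M (Xe s)"
    "\<And>s. s \<in> {a..b} \<Longrightarrow> expectation (\<lambda>\<omega>. (norm (Xe s \<omega>))\<^sup>2) \<le> m\<^sup>2"
    using Xe_second_moment by blast
  show ?thesis
  proof (rule that)
    fix u v assume uv: "a \<le> u" "u < v" "v \<le> b"
    have uin: "u \<in> {a..b}" "v \<in> {a..b}" using uv by auto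
    let ?d = "\<lambda>\<omega>. Xe v \<omega> - Xe u \<omega>"
    have sq: "sq_integrable M ?d" using m(2) uin by (intro sq_integrable_diff) auto
    have ds: "expectation (\<lambda>\<omega>. (norm (?d \<omega>))\<^sup>2) \<le> (sqrt (C1 * (v - u)))\<^sup>2"
      using C1 uv by simp
    have pos: "0 < sqrt (C1 * (v - u))" using C1(1) uv by simp
    have "second_moment B v - second_moment B u = expectation (\<lambda>\<omega>. B (Xe v \<omega>) (Xe v \<omega>) - B (Xe u \<omega>) (Xe u \<omega>))"
      unfolding second_moment_def using uin m(2)
      by (intro Bochner_Integration.integral_diff[symmetric] integrable_bilinear_sq_integrable B) auto
    also have "\<dots> = expectation (\<lambda>\<omega>. B (?d \<omega>) (Xe v \<omega>) + B (Xe u \<omega>) (?d \<omega>))"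
      by (simp add: B.diff_left B.diff_right)
    also have "\<dots> = expectation (\<lambda>\<omega>. B (?d \<omega>) (Xe v \<omega>)) + expectation (\<lambda>\<omega>. B (Xe u \<omega>) (?d \<omega>))"
      using uin m(2) sq by (intro Bochner_Integration.integral_add integrable_bilinear_sq_integrable B) auto
    finally have "\<bar>second_moment B v - second_moment B u\<bar> \<le> K * sqrt (C1 * (v - u)) * m + K * m * sqrt (C1 * (v - u))"
      using integral_bilinear_le[OF sq ds pos m(2)[OF uin(2)] m(3)[OF uin(2)] m(1) B K]
        integral_bilinear_le[OF m(2)[OF uin(1)] m(3)[OF uin(1)] m(1) sq ds pos B K] by linarith
    also have "\<dots> = (2 * K * m * sqrt C1) * sqrt (v - u)" by (simp add: real_sqrt_mult)
    finally show "\<bar>second_moment B v - second_moment B u\<bar> \<le> (2 * K * m * sqrt C1) * sqrt (v - u)" .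
  qed
qed

lemma second_moment_continuous:
  assumes "bounded_bilinear B"
  shows "continuous_on {a..b} (second_moment B)"
proof -
  obtain C where C: "\<And>u v. a \<le> u \<Longrightarrow> u < v \<Longrightarrow> v \<le> b \<Longrightarrow> \<bar>second_moment B v - second_moment B u\<bar> \<le> C * sqrt (v - u)"
    using second_moment_Hoelder[OF assms] by blast
  have bound: "norm (second_moment B t - second_moment B s) \<le> C * sqrt \<bar>t - s\<bar>" if "s \<in> {a..b}" "t \<in> {a..b}" for s t
  proof -
    consider "s < t" | "t < s" | "s = t" by linarith
    then show ?thesis using C[of s t] C[of t s] that by cases (auto simp: abs_minus_commute)
  qed
  show ?thesis
    unfolding continuous_on_def
  proof
    fix s assume s: "s \<in> {a..b}"
    have "((\<lambda>t. C * sqrt \<bar>t - s\<bar>) \<longlongrightarrow> C * sqrt \<bar>s - s\<bar>) (at s within {a..b})"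
      by (intro tendsto_intros)
    then have "((\<lambda>t. C * sqrt \<bar>t - s\<bar>) \<longlongrightarrow> 0) (at s within {a..b})" by simp
    then have "((\<lambda>t. second_moment B t - second_moment B s) \<longlongrightarrow> 0) (at s within {a..b})"
      by (rule Lim_null_comparison[rotated]) (use bound s in \<open>auto simp: eventually_at_filter intro!: always_eventually\<close>)
    then show "(second_moment B \<longlongrightarrow> second_moment B s) (at s within {a..b})"
      by (simp add: LIM_zero_iff)
  qed
qed

text \<open>Write \<open>X v = y + z + T\<close> with \<open>y = X u + h f (X u)\<close>,
  \<open>z = (W v - W u) g (X u)\<close> and \<open>T = Q + R\<close>, of root mean square orders 0,
  1/2 and 1 in \<open>h\<close>. The products of \<open>y\<close> with itself and of
  \<open>z\<close> with itself give the old moment, \<open>h\<close> times the generator and a term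
  of order 2. The mixed products of \<open>y\<close> and \<open>z\<close> vanish by independence,
  those of \<open>y\<close> and \<open>Q\<close> by orthogonality. All the others have order 3/2 or
  more.\<close>

lemma second_moment_rate_interior:
  assumes B: "bounded_bilinear B"
  obtains C where "\<And>u v. a < u \<Longrightarrow> u < v \<Longrightarrow> v \<le> b \<Longrightarrow>
    \<bar>second_moment B v - second_moment B u - (v - u) * second_moment (generator B) u\<bar> \<le> C * (v - u) * sqrt (v - u)"
proof -
  interpret B: bounded_bilinear B by fact
  obtain K where K: "\<And>x y. norm (B x y) \<le> norm x * norm y * K" "0 \<le> K"
    using B.nonneg_bounded by blast
  obtain C where C: "0 < C" and exp: "\<And>u v. a < u \<Longrightarrow> u < v \<Longrightarrow> v \<le> b \<Longrightarrow>
    \<exists>Q R. sq_integrable M Q \<and> sq_integrable M R \<and>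
      expectation (\<lambda>\<omega>. (norm (Q \<omega>))\<^sup>2) \<le> (C * (v - u))\<^sup>2 \<and>
      expectation (\<lambda>\<omega>. (norm (R \<omega>))\<^sup>2) \<le> (C * ((v - u) * sqrt (v - u)))\<^sup>2 \<and>
      (\<forall>Y. Y \<in> borel_measurable (F u) \<longrightarrow> sq_integrable M Y \<longrightarrow> expectation (\<lambda>\<omega>. Y \<omega> \<bullet> Q \<omega>) = 0) \<and>
      (AE \<omega> in M. X v \<omega> = (X u \<omega> + (v - u) *\<^sub>R f (X u \<omega>)) + (W v \<omega> - W u \<omega>) *\<^sub>R g (X u \<omega>) + Q \<omega> + R \<omega>)"
    using local_expansion by blast
  obtain m where m: "0 < m" "\<And>s. s \<in> {a..b} \<Longrightarrow> sq_integrable M (Xe s)"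
    "\<And>s. s \<in> {a..b} \<Longrightarrow> expectation (\<lambda>\<omega>. (norm (Xe s \<omega>))\<^sup>2) \<le> m\<^sup>2"
    using Xe_second_moment by blast
  define L where "L = b - a"
  have L: "0 < L" using a_less_b by (simp add: L_def)
  \<comment> \<open>\<open>c + 1\<close> in place of \<open>c\<close>, because the Cauchy-Schwarz
    estimate wants strictly positive bounds.\<close>
  define c1 where "c1 = (c + 1) * m"
  have c1: "0 < c1" using c_nonneg m(1) by (simp add: c1_def)
  define \<alpha> where "\<alpha> = (1 + L * c) * m"
  have \<alpha>: "0 < \<alpha>" using L c_nonneg m(1) by (auto simp: \<alpha>_def intro!: mult_pos_pos add_pos_nonneg)
  \<comment> \<open>A root bound for \<open>T = Q + R\<close>; the factor is justified by
    \<open>2 * (1 + h) \<le> (2 * (1 + L))\<^sup>2\<close>.\<close>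
  define C' where "C' = 2 * C * (1 + L)"
  have C': "0 < C'" using C L by (simp add: C'_def)
  define D where "D = sqrt L * (K * c1 * c1) + 2 * (K * \<alpha> * C) + 2 * (K * c1 * C') + sqrt L * (K * C' * C')"
  show ?thesis
  proof (rule that)
    fix u v assume uv: "a < u" "u < v" "v \<le> b"
    define h where "h = v - u"
    define r where "r = sqrt h"
    have h: "0 < h" "h \<le> L" using uv by (auto simp: h_def L_def)
    have r: "0 < r" "r * r = h" "r \<le> sqrt L" using h by (auto simp: r_def)
    obtain Q R where Q: "sq_integrable M Q" "expectation (\<lambda>\<omega>. (norm (Q \<omega>))\<^sup>2) \<le> (C * h)\<^sup>2"
      and R: "sq_integrable M R" "expectation (\<lambda>\<omega>. (norm (R \<omega>))\<^sup>2) \<le> (C * (h * r))\<^sup>2"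
      and orth: "\<And>Y. Y \<in> borel_measurable (F u) \<Longrightarrow> sq_integrable M Y \<Longrightarrow> expectation (\<lambda>\<omega>. Y \<omega> \<bullet> Q \<omega>) = 0"
      and eq: "AE \<omega> in M. X v \<omega> = (X u \<omega> + h *\<^sub>R f (X u \<omega>)) + (W v \<omega> - W u \<omega>) *\<^sub>R g (X u \<omega>) + Q \<omega> + R \<omega>"
      using exp[OF uv] unfolding h_def[symmetric] r_def[symmetric] by blast
    define x where "x = X u"
    define fx where "fx \<omega> = f (x \<omega>)" for \<omega>
    define gx where "gx \<omega> = g (x \<omega>)" for \<omega>
    define y where "y \<omega> = x \<omega> + h *\<^sub>R fx \<omega>" for \<omega>
    define z where "z \<omega> = (W v \<omega> - W u \<omega>) *\<^sub>R gx \<omega>" for \<omega>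
    define T where "T \<omega> = Q \<omega> + R \<omega>" for \<omega>
    have lin_m: "\<And>l. bounded_linear l \<Longrightarrow> (\<lambda>\<omega>. l (Z \<omega>)) \<in> borel_measurable (F u)"
      if "Z \<in> borel_measurable (F u)" for Z :: "'a \<Rightarrow> 'b" and l :: "'b \<Rightarrow> 'b"
      by (rule measurable_compose[OF that borel_measurable_continuous_onI[OF linear_continuous_on]])
    have xm: "x \<in> borel_measurable (F u)" using X_measurable_F[of u] uv by (simp add: x_def)
    have fxm: "fx \<in> borel_measurable (F u)" and gxm: "gx \<in> borel_measurable (F u)"
      unfolding fx_def[abs_def] gx_def[abs_def] by (rule lin_m[OF xm f], rule lin_m[OF xm g])
    have ym: "y \<in> borel_measurable (F u)" unfolding y_def[abs_def] using xm fxm by measurable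
    have xs: "sq_integrable M x" and xb: "expectation (\<lambda>\<omega>. (norm (x \<omega>))\<^sup>2) \<le> m\<^sup>2"
      using m(2,3)[of u] uv by (simp_all add: x_def Xe_eq)
    have fs: "sq_integrable M fx" and gs: "sq_integrable M gx"
      unfolding fx_def[abs_def] gx_def[abs_def]
      by (rule sq_integrable_bounded_linear[OF xs f], rule sq_integrable_bounded_linear[OF xs g])
    have ys: "sq_integrable M y" unfolding y_def[abs_def] by (intro sq_integrable_add sq_integrable_scaleR xs fs)
    have scale: "expectation (\<lambda>\<omega>. (norm (Z \<omega>))\<^sup>2) \<le> (k * m)\<^sup>2"
      if "sq_integrable M Z" "\<And>\<omega>. norm (Z \<omega>) \<le> k * norm (x \<omega>)" for Z :: "'a \<Rightarrow> 'b" and k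
    proof -
      have "expectation (\<lambda>\<omega>. (norm (Z \<omega>))\<^sup>2) \<le> expectation (\<lambda>\<omega>. k\<^sup>2 * (norm (x \<omega>))\<^sup>2)"
      proof (rule integral_mono)
        show "(norm (Z \<omega>))\<^sup>2 \<le> k\<^sup>2 * (norm (x \<omega>))\<^sup>2" for \<omega>
          using power_mono[OF that(2), of \<omega> 2] by (simp add: power_mult_distrib)
      qed (use that(1) xs in \<open>auto simp: sq_integrable_def\<close>)
      also have "\<dots> \<le> k\<^sup>2 * m\<^sup>2" using xb by (simp add: mult_left_mono)
      finally show ?thesis by (simp add: power_mult_distrib)
    qed
    have le_c1: "norm (f w) \<le> (c + 1) * norm w" "norm (g w) \<le> (c + 1) * norm w" for w
      using norm_f[of w] norm_g[of w] norm_ge_zero[of w] by (auto simp: distrib_right intro: order_trans)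
    have fb: "expectation (\<lambda>\<omega>. (norm (fx \<omega>))\<^sup>2) \<le> c1\<^sup>2" and gb: "expectation (\<lambda>\<omega>. (norm (gx \<omega>))\<^sup>2) \<le> c1\<^sup>2"
      unfolding c1_def by (intro scale fs gs, simp add: fx_def gx_def le_c1)+
    have yb: "expectation (\<lambda>\<omega>. (norm (y \<omega>))\<^sup>2) \<le> \<alpha>\<^sup>2"
      unfolding \<alpha>_def
    proof (rule scale[OF ys])
      fix \<omega>
      have "norm (y \<omega>) \<le> norm (x \<omega>) + h * norm (fx \<omega>)"
        unfolding y_def using norm_triangle_ineq[of "x \<omega>" "h *\<^sub>R fx \<omega>"] h by simp
      also have "h * norm (fx \<omega>) \<le> L * (c * norm (x \<omega>))"
        using h L by (intro mult_mono) (auto simp: fx_def norm_f)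
      finally show "norm (y \<omega>) \<le> (1 + L * c) * norm (x \<omega>)" by (simp add: distrib_right mult.assoc)
    qed
    have u0: "0 \<le> u" "u \<le> v" using uv a_nonneg by auto
    have zs: "sq_integrable M z" and zb: "expectation (\<lambda>\<omega>. (norm (z \<omega>))\<^sup>2) \<le> (r * c1)\<^sup>2"
    proof -
      note zz = sq_integrable_increment_scaleR[OF u0 gxm gs]
      show "sq_integrable M z" unfolding z_def[abs_def] by (rule zz(1))
      have "expectation (\<lambda>\<omega>. (norm (z \<omega>))\<^sup>2) = h * expectation (\<lambda>\<omega>. (norm (gx \<omega>))\<^sup>2)"
        unfolding z_def using zz(2) by (simp add: h_def)
      also have "\<dots> \<le> h * c1\<^sup>2" using gb h by (intro mult_left_mono) auto
      also have "\<dots> = (r * c1)\<^sup>2" by (simp add: power_mult_distrib power2_eq_square r(2)[symmetric] mult_ac)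
      finally show "expectation (\<lambda>\<omega>. (norm (z \<omega>))\<^sup>2) \<le> (r * c1)\<^sup>2" .
    qed
    have Ts: "sq_integrable M T" unfolding T_def[abs_def] by (intro sq_integrable_add Q R)
    have Tb: "expectation (\<lambda>\<omega>. (norm (T \<omega>))\<^sup>2) \<le> (C' * h)\<^sup>2"
    proof -
      have "expectation (\<lambda>\<omega>. (norm (T \<omega>))\<^sup>2) \<le> expectation (\<lambda>\<omega>. 2 * (norm (Q \<omega>))\<^sup>2 + 2 * (norm (R \<omega>))\<^sup>2)"
        using Ts Q(1) R(1) norm_add_sq_le by (intro integral_mono) (auto simp: sq_integrable_def T_def)
      also have "\<dots> \<le> 2 * (C * h)\<^sup>2 + 2 * (C * (h * r))\<^sup>2"
        using Q R by (simp add: sq_integrable_def)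
      also have "\<dots> = 2 * (1 + h) * (C * h)\<^sup>2"
        by (simp add: power_mult_distrib power2_eq_square[of r] r(2) algebra_simps)
      also have "\<dots> \<le> (2 * (1 + L))\<^sup>2 * (C * h)\<^sup>2"
      proof (rule mult_right_mono)
        have "2 * (1 + h) \<le> 2 * (1 + L)" using h by simp
        also have "\<dots> \<le> (2 * (1 + L))\<^sup>2" using L by (simp add: power2_eq_square)
        finally show "2 * (1 + h) \<le> (2 * (1 + L))\<^sup>2" .
      qed simp
      also have "\<dots> = (C' * h)\<^sup>2" by (simp add: C'_def power_mult_distrib mult_ac)
      finally show ?thesis .
    qed
    note ib = integrable_bilinear_sq_integrable[OF _ _ B]
    have i: "integrable M (\<lambda>\<omega>. B (y \<omega>) (y \<omega>))" "integrable M (\<lambda>\<omega>. B (y \<omega>) (z \<omega>))" "integrable M (\<lambda>\<omega>. B (z \<omega>) (y \<omega>))"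
      "integrable M (\<lambda>\<omega>. B (z \<omega>) (z \<omega>))" "integrable M (\<lambda>\<omega>. B (y \<omega>) (Q \<omega>))" "integrable M (\<lambda>\<omega>. B (Q \<omega>) (y \<omega>))"
      "integrable M (\<lambda>\<omega>. B (y \<omega>) (R \<omega>))" "integrable M (\<lambda>\<omega>. B (R \<omega>) (y \<omega>))" "integrable M (\<lambda>\<omega>. B (z \<omega>) (T \<omega>))"
      "integrable M (\<lambda>\<omega>. B (T \<omega>) (z \<omega>))" "integrable M (\<lambda>\<omega>. B (T \<omega>) (T \<omega>))"
      by (intro ib ys zs Q(1) R(1) Ts)+
    have ix: "integrable M (\<lambda>\<omega>. B (x \<omega>) (x \<omega>))" "integrable M (\<lambda>\<omega>. B (fx \<omega>) (x \<omega>))" "integrable M (\<lambda>\<omega>. B (x \<omega>) (fx \<omega>))"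
      "integrable M (\<lambda>\<omega>. B (fx \<omega>) (fx \<omega>))" "integrable M (\<lambda>\<omega>. B (gx \<omega>) (gx \<omega>))"
      by (intro ib xs fs gs)+
    have "second_moment B v = expectation (\<lambda>\<omega>. B (y \<omega>) (y \<omega>) + B (y \<omega>) (z \<omega>) + B (z \<omega>) (y \<omega>) + B (z \<omega>) (z \<omega>)
        + B (y \<omega>) (Q \<omega>) + B (Q \<omega>) (y \<omega>) + B (y \<omega>) (R \<omega>) + B (R \<omega>) (y \<omega>)
        + B (z \<omega>) (T \<omega>) + B (T \<omega>) (z \<omega>) + B (T \<omega>) (T \<omega>))"
      unfolding second_moment_def
    proof (rule integral_cong_AE)
      have "sq_integrable M (Xe v)" using m(2) uv by auto
      then show "(\<lambda>\<omega>. B (Xe v \<omega>) (Xe v \<omega>)) \<in> borel_measurable M"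
        using ib by blast
      show "AE \<omega> in M. B (Xe v \<omega>) (Xe v \<omega>) = B (y \<omega>) (y \<omega>) + B (y \<omega>) (z \<omega>) + B (z \<omega>) (y \<omega>) + B (z \<omega>) (z \<omega>)
        + B (y \<omega>) (Q \<omega>) + B (Q \<omega>) (y \<omega>) + B (y \<omega>) (R \<omega>) + B (R \<omega>) (y \<omega>)
        + B (z \<omega>) (T \<omega>) + B (T \<omega>) (z \<omega>) + B (T \<omega>) (T \<omega>)"
        using eq
      proof eventually_elim
        case (elim \<omega>)
        then have "Xe v \<omega> = y \<omega> + z \<omega> + T \<omega>"
          using uv by (simp add: Xe_eq y_def z_def T_def fx_def gx_def x_def)
        moreover have "B (y \<omega>) (T \<omega>) = B (y \<omega>) (Q \<omega>) + B (y \<omega>) (R \<omega>)" "B (T \<omega>) (y \<omega>) = B (Q \<omega>) (y \<omega>) + B (R \<omega>) (y \<omega>)"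
          by (simp_all add: T_def B.add_left B.add_right)
        ultimately show ?case by (simp add: B.add_left B.add_right)
      qed
    qed (use i in measurable)
    also have "\<dots> = expectation (\<lambda>\<omega>. B (y \<omega>) (y \<omega>)) + expectation (\<lambda>\<omega>. B (y \<omega>) (z \<omega>)) + expectation (\<lambda>\<omega>. B (z \<omega>) (y \<omega>))
        + expectation (\<lambda>\<omega>. B (z \<omega>) (z \<omega>)) + expectation (\<lambda>\<omega>. B (y \<omega>) (Q \<omega>)) + expectation (\<lambda>\<omega>. B (Q \<omega>) (y \<omega>))
        + expectation (\<lambda>\<omega>. B (y \<omega>) (R \<omega>)) + expectation (\<lambda>\<omega>. B (R \<omega>) (y \<omega>))
        + expectation (\<lambda>\<omega>. B (z \<omega>) (T \<omega>)) + expectation (\<lambda>\<omega>. B (T \<omega>) (z \<omega>)) + expectation (\<lambda>\<omega>. B (T \<omega>) (T \<omega>))"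
      using i by simp
    finally have e1: "second_moment B v = \<dots>" .
    have "(\<lambda>\<omega>. B (y \<omega>) (y \<omega>)) = (\<lambda>\<omega>. B (x \<omega>) (x \<omega>) + h * (B (fx \<omega>) (x \<omega>) + B (x \<omega>) (fx \<omega>)) + h\<^sup>2 * B (fx \<omega>) (fx \<omega>))"
      by (auto simp: y_def B.add_left B.add_right B.scaleR_left B.scaleR_right power2_eq_square algebra_simps)
    then have e2: "expectation (\<lambda>\<omega>. B (y \<omega>) (y \<omega>)) = expectation (\<lambda>\<omega>. B (x \<omega>) (x \<omega>))
        + h * (expectation (\<lambda>\<omega>. B (fx \<omega>) (x \<omega>)) + expectation (\<lambda>\<omega>. B (x \<omega>) (fx \<omega>))) + h\<^sup>2 * expectation (\<lambda>\<omega>. B (fx \<omega>) (fx \<omega>))"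
      using ix by simp
    have Bm: "(\<lambda>\<omega>. B (Z \<omega>) (Z' \<omega>)) \<in> borel_measurable (F u)"
      if "Z \<in> borel_measurable (F u)" "Z' \<in> borel_measurable (F u)" for Z Z'
    proof -
      have "continuous_on UNIV (\<lambda>z. B (fst z) (snd z))"
        by (intro B.continuous_on continuous_intros)
      then have [measurable]: "(\<lambda>z. B (fst z) (snd z)) \<in> borel_measurable borel"
        by (rule borel_measurable_continuous_onI)
      note that[measurable]
      have "(\<lambda>\<omega>. (\<lambda>z. B (fst z) (snd z)) (Z \<omega>, Z' \<omega>)) \<in> borel_measurable (F u)"
        by measurable
      then show ?thesis by simp
    qed
    have e3: "expectation (\<lambda>\<omega>. B (y \<omega>) (z \<omega>)) = 0"
      using increment_moments(2)[OF u0 Bm[OF ym gxm] ib[OF ys gs]] by (simp add: z_def B.scaleR_right)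
    have e4: "expectation (\<lambda>\<omega>. B (z \<omega>) (y \<omega>)) = 0"
      using increment_moments(2)[OF u0 Bm[OF gxm ym] ib[OF gs ys]] by (simp add: z_def B.scaleR_left)
    have e5: "expectation (\<lambda>\<omega>. B (z \<omega>) (z \<omega>)) = h * expectation (\<lambda>\<omega>. B (gx \<omega>) (gx \<omega>))"
      using increment_moments(4)[OF u0 Bm[OF gxm gxm] ix(5)]
      by (simp add: z_def B.scaleR_left B.scaleR_right power2_eq_square h_def mult.assoc)
    \<comment> \<open>Orthogonality of \<open>Q\<close> is available for inner products.
      \<open>B (y \<omega>)\<close> is therefore represented by a vector, which depends linearly on
      \<open>y \<omega>\<close> and so is still known at time \<open>u\<close> and square
      integrable.\<close>
    have riesz: "l w = (\<Sum>i\<in>Basis. l i *\<^sub>R i) \<bullet> w" if "linear l" for l :: "'b \<Rightarrow> real" and w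
    proof -
      have "l w = l (\<Sum>i\<in>Basis. (w \<bullet> i) *\<^sub>R i)" by (simp add: euclidean_representation)
      also have "\<dots> = (\<Sum>i\<in>Basis. l i *\<^sub>R i) \<bullet> w"
        using that by (simp add: linear_sum linear_scale inner_sum_left inner_commute[of w] mult.commute)
      finally show ?thesis .
    qed
    have e6: "expectation (\<lambda>\<omega>. B (y \<omega>) (Q \<omega>)) = 0"
    proof -
      have l: "bounded_linear (\<lambda>x. \<Sum>i\<in>Basis. B x i *\<^sub>R i)"
        by (intro bounded_linear_sum bounded_linear_compose[OF bounded_linear_scaleR_left] B.bounded_linear_left)
      have "B (y \<omega>) (Q \<omega>) = (\<Sum>i\<in>Basis. B (y \<omega>) i *\<^sub>R i) \<bullet> Q \<omega>" for \<omega>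
        by (rule riesz[OF bounded_linear.linear[OF B.bounded_linear_right]])
      then show ?thesis using orth[OF lin_m[OF ym l] sq_integrable_bounded_linear[OF ys l]] by simp
    qed
    have e7: "expectation (\<lambda>\<omega>. B (Q \<omega>) (y \<omega>)) = 0"
    proof -
      have l: "bounded_linear (\<lambda>x. \<Sum>i\<in>Basis. B i x *\<^sub>R i)"
        by (intro bounded_linear_sum bounded_linear_compose[OF bounded_linear_scaleR_left] B.bounded_linear_right)
      have "B (Q \<omega>) (y \<omega>) = (\<Sum>i\<in>Basis. B i (y \<omega>) *\<^sub>R i) \<bullet> Q \<omega>" for \<omega>
        by (rule riesz[OF bounded_linear.linear[OF B.bounded_linear_left]])
      then show ?thesis using orth[OF lin_m[OF ym l] sq_integrable_bounded_linear[OF ys l]] by simp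
    qed
    have e8: "second_moment B u = expectation (\<lambda>\<omega>. B (x \<omega>) (x \<omega>))"
      using uv by (simp add: second_moment_def Xe_eq x_def)
    have e9: "second_moment (generator B) u = expectation (\<lambda>\<omega>. B (fx \<omega>) (x \<omega>)) + expectation (\<lambda>\<omega>. B (x \<omega>) (fx \<omega>)) + expectation (\<lambda>\<omega>. B (gx \<omega>) (gx \<omega>))"
    proof -
      have "second_moment (generator B) u = expectation (\<lambda>\<omega>. B (fx \<omega>) (x \<omega>) + B (x \<omega>) (fx \<omega>) + B (gx \<omega>) (gx \<omega>))"
        using uv by (simp add: second_moment_def Xe_eq x_def generator_def fx_def gx_def)
      then show ?thesis using ix by simp
    qed
    have p: "0 < C * (h * r)" "0 < r * c1" "0 < C' * h" using C C' c1 h r by auto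
    have b1: "\<bar>expectation (\<lambda>\<omega>. B (fx \<omega>) (fx \<omega>))\<bar> \<le> K * c1 * c1"
      by (rule integral_bilinear_le[OF fs fb c1 fs fb c1 B K])
    have b2: "\<bar>expectation (\<lambda>\<omega>. B (y \<omega>) (R \<omega>))\<bar> \<le> K * \<alpha> * (C * (h * r))"
      by (rule integral_bilinear_le[OF ys yb \<alpha> R p(1) B K])
    have b3: "\<bar>expectation (\<lambda>\<omega>. B (R \<omega>) (y \<omega>))\<bar> \<le> K * (C * (h * r)) * \<alpha>"
      by (rule integral_bilinear_le[OF R p(1) ys yb \<alpha> B K])
    have b4: "\<bar>expectation (\<lambda>\<omega>. B (z \<omega>) (T \<omega>))\<bar> \<le> K * (r * c1) * (C' * h)"
      by (rule integral_bilinear_le[OF zs zb p(2) Ts Tb p(3) B K])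
    have b5: "\<bar>expectation (\<lambda>\<omega>. B (T \<omega>) (z \<omega>))\<bar> \<le> K * (C' * h) * (r * c1)"
      by (rule integral_bilinear_le[OF Ts Tb p(3) zs zb p(2) B K])
    have b6: "\<bar>expectation (\<lambda>\<omega>. B (T \<omega>) (T \<omega>))\<bar> \<le> K * (C' * h) * (C' * h)"
      by (rule integral_bilinear_le[OF Ts Tb p(3) Ts Tb p(3) B K])
    \<comment> \<open>Terms of order 2 are lowered to order 3/2 at the cost of the constant
      \<open>sqrt L\<close>.\<close>
    have hh: "h\<^sup>2 \<le> h * r * sqrt L"
    proof -
      have "h\<^sup>2 = h * r * r" by (simp add: power2_eq_square r(2)[symmetric])
      also have "\<dots> \<le> h * r * sqrt L" using r h by (intro mult_left_mono) auto
      finally show ?thesis .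
    qed
    have b1': "\<bar>h\<^sup>2 * expectation (\<lambda>\<omega>. B (fx \<omega>) (fx \<omega>))\<bar> \<le> h * r * sqrt L * (K * c1 * c1)"
    proof -
      have "\<bar>h\<^sup>2 * expectation (\<lambda>\<omega>. B (fx \<omega>) (fx \<omega>))\<bar> \<le> h\<^sup>2 * (K * c1 * c1)"
        using b1 by (simp add: abs_mult mult_left_mono)
      also have "\<dots> \<le> h * r * sqrt L * (K * c1 * c1)"
        using hh K(2) c1 by (intro mult_right_mono) auto
      finally show ?thesis .
    qed
    have b6': "K * (C' * h) * (C' * h) \<le> h * r * sqrt L * (K * C' * C')"
    proof -
      have "K * (C' * h) * (C' * h) = h\<^sup>2 * (K * C' * C')" by (simp add: power2_eq_square mult_ac)
      also have "\<dots> \<le> h * r * sqrt L * (K * C' * C')"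
        using hh K(2) C' by (intro mult_right_mono) auto
      finally show ?thesis .
    qed
    have "\<bar>second_moment B v - second_moment B u - h * second_moment (generator B) u\<bar>
      = \<bar>h\<^sup>2 * expectation (\<lambda>\<omega>. B (fx \<omega>) (fx \<omega>)) + expectation (\<lambda>\<omega>. B (y \<omega>) (R \<omega>)) + expectation (\<lambda>\<omega>. B (R \<omega>) (y \<omega>))
        + expectation (\<lambda>\<omega>. B (z \<omega>) (T \<omega>)) + expectation (\<lambda>\<omega>. B (T \<omega>) (z \<omega>)) + expectation (\<lambda>\<omega>. B (T \<omega>) (T \<omega>))\<bar>"
      unfolding e1 e2 e3 e4 e5 e6 e7 e8 e9 by (simp add: distrib_left)
    also have "\<dots> \<le> h * r * sqrt L * (K * c1 * c1) + K * \<alpha> * (C * (h * r)) + K * (C * (h * r)) * \<alpha>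
        + K * (r * c1) * (C' * h) + K * (C' * h) * (r * c1) + h * r * sqrt L * (K * C' * C')"
      using b1' b2 b3 b4 b5 b6 b6' by linarith
    also have "\<dots> = D * h * r" by (simp add: D_def algebra_simps)
    finally show "\<bar>second_moment B v - second_moment B u - (v - u) * second_moment (generator B) u\<bar> \<le> D * (v - u) * sqrt (v - u)"
      by (simp add: h_def r_def)
  qed
qed

lemma second_moment_derivative:
  assumes B: "bounded_bilinear B" and s: "s \<in> {a..b}"
  shows "(second_moment B has_real_derivative second_moment (generator B) s) (at s within {a..b})"
proof -
  note cB = second_moment_continuous[OF B] and cG = second_moment_continuous[OF bounded_bilinear_generator[OF B]]
  obtain C where C: "\<And>u v. a < u \<Longrightarrow> u < v \<Longrightarrow> v \<le> b \<Longrightarrow>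
    \<bar>second_moment B v - second_moment B u - (v - u) * second_moment (generator B) u\<bar> \<le> C * (v - u) * sqrt (v - u)"
    using second_moment_rate_interior[OF B] by blast
  have "\<bar>second_moment B v - second_moment B u - (v - u) * second_moment (generator B) u\<bar> \<le> C * (v - u) * sqrt (v - u)"
    if uv: "a \<le> u" "u < v" "v \<le> b" for u v
  proof (cases "u = a")
    case True
    have l: "(second_moment B \<longlongrightarrow> second_moment B a) (at_right a)"
      "(second_moment (generator B) \<longlongrightarrow> second_moment (generator B) a) (at_right a)"
      using bspec[OF cB[unfolded continuous_on_def], of a] bspec[OF cG[unfolded continuous_on_def], of a] a_less_b
      by (simp_all add: at_within_Icc_at_right)
    have lower: "((\<lambda>u. \<bar>second_moment B v - second_moment B u - (v - u) * second_moment (generator B) u\<bar>)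
        \<longlongrightarrow> \<bar>second_moment B v - second_moment B a - (v - a) * second_moment (generator B) a\<bar>) (at_right a)"
      by (intro tendsto_intros l)
    have upper: "((\<lambda>u. C * (v - u) * sqrt (v - u)) \<longlongrightarrow> C * (v - a) * sqrt (v - a)) (at_right a)"
      by (intro tendsto_intros)
    have "eventually (\<lambda>u. \<bar>second_moment B v - second_moment B u - (v - u) * second_moment (generator B) u\<bar>
        \<le> C * (v - u) * sqrt (v - u)) (at_right a)"
      using C uv unfolding eventually_at_right[OF uv(2)[unfolded True]] True by auto
    from tendsto_le[OF trivial_limit_at_right_real upper lower this] show ?thesis
      by (simp only: True)
  qed (use C uv in auto)
  from has_real_derivative_if_rate[OF this cG s] show ?thesis .
qed

end

section \<open>The flow of second moments\<close>

lemma bounded_bilinear_if_bilinear: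
  fixes B :: "'b::euclidean_space \<Rightarrow> 'c::euclidean_space \<Rightarrow> 'd::real_normed_vector"
  shows "bilinear B \<Longrightarrow> bounded_bilinear B"
  by (simp add: bilinear_conv_bounded_bilinear)

section \<open>Matrices, transposes and quadratic forms\<close>

lemma matrix_add_rdistrib: "(B + C) ** A = B ** A + C ** (A :: 'a::semiring_1^'k^'m)"
  by (simp add: matrix_matrix_mult_def vec_eq_iff sum.distrib distrib_right)

lemmas matrix_linear_simps =
  matrix_add_ldistrib matrix_add_rdistrib matrix_scalar_ac scalar_matrix_assoc[symmetric]

lemma transpose_add: "transpose (X + Y) = transpose X + transpose Y"
  by (simp add: transpose_def vec_eq_iff)

lemma transpose_diff: "transpose (X - Y) = transpose X - transpose Y"
  by (simp add: transpose_def vec_eq_iff)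

lemma transpose_scaleR: "transpose (r *\<^sub>R X) = r *\<^sub>R transpose X"
  by (simp add: transpose_def vec_eq_iff)

lemma inner_transpose: "x \<bullet> (transpose C *v y) = (C *v x) \<bullet> (y :: real^'m)"
  for C :: "real^'n^'m"
  by (metis dot_lmul_matrix inner_commute transpose_matrix_vector)

definition quad :: "real^'n^'n \<Rightarrow> real^'n \<Rightarrow> real" where
  "quad Z v = v \<bullet> (Z *v v)"

lemma quad_add: "quad (X + Y) v = quad X v + quad Y v"
  and quad_diff: "quad (X - Y) v = quad X v - quad Y v"
  by (simp_all add: quad_def matrix_vector_mult_add_rdistrib matrix_vector_mult_diff_rdistrib inner_add inner_diff)

lemma quad_scaleR: "quad (r *\<^sub>R X) v = r * quad X v"
  by (simp add: quad_def scaleR_matrix_vector_assoc[symmetric])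

lemma quad_zero: "quad 0 v = 0"
  by (simp add: quad_def)

lemma quad_scaleR_vector: "quad Z (r *\<^sub>R v) = r\<^sup>2 * quad Z v"
  by (simp add: quad_def matrix_vector_mult_scaleR power2_eq_square)

lemma quad_mat_1: "quad (mat 1) v = (norm v)\<^sup>2"
  by (simp add: quad_def power2_norm_eq_inner)

lemma quad_congruence: "quad (transpose C ** Z ** C) v = quad Z (C *v v)"
  by (simp only: quad_def matrix_vector_mul_assoc[symmetric] inner_transpose)

lemma pos_def_iff: "pos_def Z \<longleftrightarrow> transpose Z = Z \<and> (\<forall>v. v \<noteq> 0 \<longrightarrow> 0 < quad Z v)"
  by (simp add: pos_def_def quad_def)

lemma pos_semidef_iff: "pos_semidef Z \<longleftrightarrow> transpose Z = Z \<and> (\<forall>v. 0 \<le> quad Z v)"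
  by (simp add: pos_semidef_def quad_def)

lemma quad_pos_nonneg: "pos_def Z \<Longrightarrow> 0 \<le> quad Z v"
  by (cases "v = 0") (auto simp: pos_def_iff less_imp_le quad_def)

lemma quad_upper_bound:
  fixes Z :: "real^'n^'n"
  obtains K where "0 < K" "\<And>v. quad Z v \<le> K * (norm v)\<^sup>2"
proof -
  obtain K where K: "0 < K" "\<And>v. norm (Z *v v) \<le> norm v * K"
    using bounded_linear.pos_bounded[OF matrix_vector_mul_bounded_linear[of Z]] by blast
  have "quad Z v \<le> K * (norm v)\<^sup>2" for v
  proof -
    have "quad Z v \<le> norm v * norm (Z *v v)"
      unfolding quad_def by (rule norm_cauchy_schwarz)
    also have "\<dots> \<le> norm v * (norm v * K)" by (intro mult_left_mono K) simp
    finally show ?thesis by (simp add: power2_eq_square mult_ac)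
  qed
  then show ?thesis using K that by blast
qed

text \<open>The minimum over the compact unit sphere, extended by homogeneity. It turns strict
  inequalities between forms into inequalities with a margin.\<close>

lemma quad_lower_bound:
  fixes Z :: "real^'n^'n"
  assumes Z: "pos_def Z"
  obtains e where "0 < e" "\<And>v. e * (norm v)\<^sup>2 \<le> quad Z v"
proof -
  have "continuous_on (sphere 0 1) (quad Z)"
    unfolding quad_def[abs_def]
    by (intro continuous_intros linear_continuous_on matrix_vector_mul_bounded_linear)
  moreover have "sphere (0::real^'n) 1 \<noteq> {}" by simp
  ultimately obtain w where w: "w \<in> sphere 0 1" "\<And>v. v \<in> sphere 0 1 \<Longrightarrow> quad Z w \<le> quad Z v"
    using continuous_attains_inf[OF compact_sphere] by blast
  have "w \<noteq> 0" using w(1) by auto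
  then have pos: "0 < quad Z w" using Z by (simp add: pos_def_iff)
  have "quad Z w * (norm v)\<^sup>2 \<le> quad Z v" for v
  proof (cases "v = 0")
    case False
    then have "quad Z w \<le> quad Z ((1 / norm v) *\<^sub>R v)" by (intro w(2)) simp
    also have "\<dots> = quad Z v / (norm v)\<^sup>2" by (simp add: quad_scaleR_vector power_divide)
    finally show ?thesis using False by (simp add: pos_le_divide_eq)
  qed (simp add: quad_def)
  then show ?thesis using pos that by blast
qed

definition lyapunov :: "real^'n^'n \<Rightarrow> real^'n^'n \<Rightarrow> real^'n^'n \<Rightarrow> real^'n^'n" where
  "lyapunov A Ec Z = transpose A ** Z + Z ** A + transpose Ec ** Z ** Ec"

lemma linear_lyapunov: "linear (lyapunov A Ec)"
  by (rule linearI) (simp_all add: lyapunov_def matrix_linear_simps scaleR_add_right)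

section \<open>Calculus of linear flows\<close>

lemma nonincreasing_if_derivative_nonpos:
  fixes h h' :: "real \<Rightarrow> real"
  assumes "a \<le> b" and d: "\<And>s. s \<in> {a..b} \<Longrightarrow> (h has_real_derivative h' s) (at s within {a..b})"
    and np: "\<And>s. s \<in> {a..b} \<Longrightarrow> h' s \<le> 0"
  shows "h b \<le> h a"
proof (rule DERIV_nonpos_imp_decreasing_open[OF assms(1)])
  show "\<exists>y. DERIV h s :> y \<and> y \<le> 0" if "a < s" "s < b" for s
    using d[of s] np[of s] that by (auto simp: at_within_Icc_at)
  show "continuous_on {a..b} h"
    by (rule DERIV_continuous_on[OF d])
qed

text \<open>A product rule in which the derivative of the functionals is known for each fixed
  argument only. Expansion of \<open>S s\<close> in a basis reduces it to finitely many products of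
  scalar functions.\<close>

lemma linear_family_derivative:
  fixes \<kappa> :: "real \<Rightarrow> 'z::euclidean_space \<Rightarrow> real"
  assumes lin: "\<And>s. s \<in> T \<Longrightarrow> linear (\<kappa> s)" and L: "linear L" and s0: "s0 \<in> T"
    and d: "\<And>Z. ((\<lambda>s. \<kappa> s Z) has_real_derivative \<kappa> s0 (L Z)) (at s0 within T)"
    and S: "(S has_vector_derivative S') (at s0 within T)"
  shows "((\<lambda>s. \<kappa> s (S s)) has_real_derivative \<kappa> s0 S' + \<kappa> s0 (L (S s0))) (at s0 within T)"
proof -
  have expand: "l Z = (\<Sum>e\<in>Basis. (Z \<bullet> e) * l e)" if "linear l" for l :: "'z \<Rightarrow> real" and Z
  proof -
    have "l Z = l (\<Sum>e\<in>Basis. (Z \<bullet> e) *\<^sub>R e)" by (simp add: euclidean_representation)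
    also have "\<dots> = (\<Sum>e\<in>Basis. (Z \<bullet> e) * l e)" using that by (simp add: linear_sum linear_scale)
    finally show ?thesis .
  qed
  have "((\<lambda>s. S s \<bullet> e) has_real_derivative S' \<bullet> e) (at s0 within T)" for e
    using bounded_linear.has_vector_derivative[OF bounded_linear_inner_left S]
    by (simp add: has_real_derivative_iff_has_vector_derivative)
  then have "((\<lambda>s. \<Sum>e\<in>Basis. (S s \<bullet> e) * \<kappa> s e) has_real_derivative
      (\<Sum>e\<in>Basis. (S' \<bullet> e) * \<kappa> s0 e + \<kappa> s0 (L e) * (S s0 \<bullet> e))) (at s0 within T)"
    by (intro DERIV_sum DERIV_mult d)
  also have "(\<Sum>e\<in>Basis. (S' \<bullet> e) * \<kappa> s0 e + \<kappa> s0 (L e) * (S s0 \<bullet> e)) = \<kappa> s0 S' + \<kappa> s0 (L (S s0))"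
    using expand[OF lin[OF s0], of S'] expand[OF linear_compose[OF L lin[OF s0]], of "S s0"]
    by (simp add: sum.distrib mult.commute)
  finally show ?thesis
    by (rule has_field_derivative_transform_within[OF _ zero_less_one s0]) (simp add: expand[OF lin, symmetric])
qed

text \<open>In effect \<open>N s\<close> is the exponential of \<open>s\<close> times
  \<open>L\<close>. The derivative is given with \<open>L\<close> applied first; the form with
  \<open>L\<close> applied last is a consequence, proved as commutation.\<close>

locale moment_flow =
  fixes N :: "real \<Rightarrow> 'z::euclidean_space \<Rightarrow> 'z" and L :: "'z \<Rightarrow> 'z"
  assumes linear_N: "0 \<le> s \<Longrightarrow> linear (N s)" and linear_L: "linear L"
    and N_0: "N 0 Z = Z"
    and N_derivative: "0 < b \<Longrightarrow> s \<in> {0..b} \<Longrightarrow>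
      ((\<lambda>s. N s Z) has_vector_derivative N s (L Z)) (at s within {0..b})"
begin

text \<open>Uniqueness for the linear equation satisfied by the commutator, by Gronwall's argument.\<close>

lemma N_commutes:
  assumes b: "0 \<le> b"
  shows "N b (L Z) = L (N b Z)"
proof (cases "b = 0")
  case False
  then have b: "0 < b" using b by simp
  define D where "D s Z = N s (L Z) - L (N s Z)" for s Z
  have lin: "linear (D s)" if "0 \<le> s" for s
  proof (rule linearI)
    show "D s (x + y) = D s x + D s y" "D s (r *\<^sub>R x) = r *\<^sub>R D s x" for x y r
      using linear_N[OF that] linear_L by (simp_all add: D_def linear_add linear_scale scaleR_diff_right)
  qed
  have expand: "D s Z = (\<Sum>c\<in>Basis. (Z \<bullet> c) *\<^sub>R D s c)" if "0 \<le> s" for s Z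
  proof -
    have "D s Z = D s (\<Sum>c\<in>Basis. (Z \<bullet> c) *\<^sub>R c)" by (simp add: euclidean_representation)
    also have "\<dots> = (\<Sum>c\<in>Basis. (Z \<bullet> c) *\<^sub>R D s c)" using lin[OF that] by (simp add: linear_sum linear_scale)
    finally show ?thesis .
  qed
  \<comment> \<open>Differentiation reproduces the commutator with \<open>L Z\<close> in place of
    \<open>Z\<close>: a closed linear equation with initial value 0.\<close>
  have D': "((\<lambda>s. D s Z) has_vector_derivative D s (L Z)) (at s within {0..b})" if "s \<in> {0..b}" for s Z
    unfolding D_def
    by (intro has_vector_derivative_diff N_derivative[OF b that]
        bounded_linear.has_vector_derivative[OF linear_conv_bounded_linear[THEN iffD1, OF linear_L]])
  \<comment> \<open>The squared Hilbert-Schmidt norm of \<open>D s\<close>. Its derivative is at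
    most \<open>K\<close> times itself, so \<open>exp (- K * s) * \<psi> s\<close> cannot rise above
    its initial value 0.\<close>
  define \<psi> where "\<psi> s = (\<Sum>e\<in>Basis. D s e \<bullet> D s e)" for s
  define k where "k = (\<Sum>e\<in>(Basis::'z set). norm (L e))"
  define K where "K = 2 * k * real (card (Basis :: 'z set))"
  have kb: "\<bar>L e \<bullet> c\<bar> \<le> k" if "e \<in> Basis" "c \<in> Basis" for e c :: 'z
  proof -
    have "\<bar>L e \<bullet> c\<bar> \<le> norm (L e)" using Basis_le_norm[OF that(2), of "L e"] by simp
    also have "\<dots> \<le> k" unfolding k_def using that(1) by (intro member_le_sum) auto
    finally show ?thesis .
  qed
  have \<psi>': "(\<psi> has_real_derivative (\<Sum>e\<in>Basis. D s e \<bullet> D s (L e) + D s (L e) \<bullet> D s e)) (at s within {0..b})"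
    if "s \<in> {0..b}" for s
    unfolding has_real_derivative_iff_has_vector_derivative \<psi>_def
    by (intro has_vector_derivative_sum bounded_bilinear.has_vector_derivative[OF bounded_bilinear_inner] D'[OF that])
  have le: "(\<Sum>e\<in>Basis. D s e \<bullet> D s (L e) + D s (L e) \<bullet> D s e) \<le> K * \<psi> s" if s: "s \<in> {0..b}" for s
  proof -
    have DL: "D s (L e) = (\<Sum>c\<in>Basis. (L e \<bullet> c) *\<^sub>R D s c)" for e
      using s by (intro expand) simp
    have pair: "2 * ((L e \<bullet> c) * (D s e \<bullet> D s c)) \<le> k * (D s e \<bullet> D s e + D s c \<bullet> D s c)" if "e \<in> Basis" "c \<in> Basis" for e c
    proof -
      have "2 * ((L e \<bullet> c) * (D s e \<bullet> D s c)) \<le> 2 * (\<bar>L e \<bullet> c\<bar> * \<bar>D s e \<bullet> D s c\<bar>)"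
        by (simp add: abs_mult[symmetric])
      also have "\<dots> \<le> 2 * (k * (norm (D s e) * norm (D s c)))"
        using kb[OF that] Cauchy_Schwarz_ineq2[of "D s e" "D s c"] by (intro mult_left_mono mult_mono) (auto intro: order_trans[OF abs_ge_zero])
      also have "\<dots> = k * (2 * norm (D s e) * norm (D s c))" by simp
      also have "\<dots> \<le> k * ((norm (D s e))\<^sup>2 + (norm (D s c))\<^sup>2)"
        by (intro mult_left_mono sum_squares_bound) (simp add: k_def sum_nonneg)
      finally show ?thesis by (simp add: power2_norm_eq_inner)
    qed
    have "(\<Sum>e\<in>Basis. D s e \<bullet> D s (L e) + D s (L e) \<bullet> D s e) = (\<Sum>e\<in>Basis. \<Sum>c\<in>Basis. 2 * ((L e \<bullet> c) * (D s e \<bullet> D s c)))"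
      by (intro sum.cong refl) (simp add: DL inner_sum_left inner_sum_right inner_commute sum_distrib_left[symmetric] flip: sum.distrib)
    also have "\<dots> \<le> (\<Sum>e\<in>Basis. \<Sum>c\<in>Basis. k * (D s e \<bullet> D s e + D s c \<bullet> D s c))"
      by (intro sum_mono pair)
    also have "\<dots> = k * ((\<Sum>e\<in>Basis. \<Sum>c\<in>(Basis::'z set). D s e \<bullet> D s e) + (\<Sum>e\<in>(Basis::'z set). \<psi> s))"
      by (simp add: \<psi>_def sum_distrib_left[symmetric] sum.distrib)
    also have "\<dots> = K * \<psi> s"
      by (simp add: K_def \<psi>_def sum_distrib_left[symmetric])
    finally show ?thesis .
  qed
  have "exp (- K * b) * \<psi> b \<le> exp (- K * 0) * \<psi> 0"
  proof (rule nonincreasing_if_derivative_nonpos[where h = "\<lambda>s. exp (- K * s) * \<psi> s", OF less_imp_le[OF b]])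
    fix s assume s: "s \<in> {0..b}"
    let ?d = "\<Sum>e\<in>Basis. D s e \<bullet> D s (L e) + D s (L e) \<bullet> D s e"
    show "((\<lambda>s. exp (- K * s) * \<psi> s) has_real_derivative exp (- K * s) * (?d - K * \<psi> s)) (at s within {0..b})"
      by (rule derivative_eq_intros \<psi>'[OF s] refl | simp add: algebra_simps)+
    show "exp (- K * s) * (?d - K * \<psi> s) \<le> 0"
      using le[OF s] by (simp add: mult_nonneg_nonpos)
  qed
  moreover have "\<psi> 0 = 0" by (simp add: \<psi>_def D_def N_0)
  moreover have "0 \<le> \<psi> b" unfolding \<psi>_def by (intro sum_nonneg) simp
  ultimately have "\<psi> b = 0" by (simp add: mult_le_0_iff)
  then have "\<forall>e\<in>Basis. D b e = 0" unfolding \<psi>_def by (subst (asm) sum_nonneg_eq_0_iff) auto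
  then have "D b Z = 0" using expand[OF less_imp_le[OF b], of Z] by simp
  then show ?thesis by (simp add: D_def)
qed (simp add: N_0)

lemma backward_derivative:
  assumes "a < b" "\<tau> \<in> {a..b}"
  shows "((\<lambda>\<tau>. N (b - \<tau>) Z) has_vector_derivative - N (b - \<tau>) (L Z)) (at \<tau> within {a..b})"
proof -
  have img: "(\<lambda>\<tau>. b - \<tau>) ` {a..b} = {0..b - a}" by simp
  have "((\<lambda>\<tau>. b - \<tau>) has_vector_derivative - 1) (at \<tau> within {a..b})"
    by (auto intro!: derivative_eq_intros)
  moreover have "((\<lambda>s. N s Z) has_vector_derivative N (b - \<tau>) (L Z)) (at (b - \<tau>) within (\<lambda>\<tau>. b - \<tau>) ` {a..b})"
    unfolding img using assms by (intro N_derivative) auto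
  ultimately have "((\<lambda>s. N s Z) \<circ> (\<lambda>\<tau>. b - \<tau>) has_vector_derivative (- 1) *\<^sub>R N (b - \<tau>) (L Z)) (at \<tau> within {a..b})"
    by (rule vector_diff_chain_within)
  then show ?thesis by (simp add: o_def)
qed

end

section \<open>The moment flow of the fundamental solution\<close>

context wiener_basis
begin

lemma fundamental_linear_sde:
  fixes A Ec :: "real^'n^'n"
  assumes "fundamental_solution M F W A Ec \<Phi>" "0 < b"
  shows "linear_sde M F W (\<lambda>X. A ** X) (\<lambda>X. Ec ** X) 0 b (\<lambda>_. mat 1) \<Phi>"
proof (intro linear_sde.intro linear_sde_axioms.intro wiener_basis_axioms)
  show "bounded_linear (\<lambda>X. A ** X)" "bounded_linear (\<lambda>X. Ec ** X)"
    by (auto intro!: linear_conv_bounded_linear[THEN iffD1] linearI simp: matrix_linear_simps)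
  show "ito_sde_on M F W (\<lambda>X. A ** X) (\<lambda>X. Ec ** X) 0 b (\<lambda>_. mat 1) \<Phi>"
    using assms by (simp add: fundamental_solution_def)
  show "sq_integrable M (\<lambda>_. mat 1)" by (simp add: sq_integrable_def)
qed (use assms in auto)

lemma fundamental_sq_integrable:
  fixes A Ec :: "real^'n^'n"
  assumes \<Phi>: "fundamental_solution M F W A Ec \<Phi>" and s: "0 \<le> s"
  obtains Y where "sq_integrable M Y" "\<And>\<omega>. \<omega> \<in> space M \<Longrightarrow> Y \<omega> = \<Phi> s \<omega>"
proof -
  interpret S: linear_sde M F W "\<lambda>X. A ** X" "\<lambda>X. Ec ** X" 0 "s + 1" "\<lambda>_. mat 1" \<Phi>
    using s by (intro fundamental_linear_sde[OF \<Phi>]) simp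
  have "sq_integrable M (S.Xe s)"
    using S.Xe_second_moment s by (metis atLeastAtMost_iff less_add_one less_imp_le)
  moreover have "S.Xe s \<omega> = \<Phi> s \<omega>" if "\<omega> \<in> space M" for \<omega>
    using that s \<Phi> by (auto simp: S.Xe_def fundamental_solution_def)
  ultimately show ?thesis by (rule that)
qed

lemma bounded_bilinear_congruence:
  "bounded_bilinear (\<lambda>X Y :: real^'n^'n. transpose X ** Z ** Y)"
  by (rule bounded_bilinear_if_bilinear)
    (auto simp: bilinear_def matrix_linear_simps transpose_add transpose_scaleR intro!: linearI)

lemma integrable_Xi:
  fixes A Ec :: "real^'n^'n"
  assumes \<Phi>: "fundamental_solution M F W A Ec \<Phi>" and s: "0 \<le> s"
  shows "integrable M (Xi \<Phi> Z s)"
proof -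
  obtain Y where Y: "sq_integrable M Y" "\<And>\<omega>. \<omega> \<in> space M \<Longrightarrow> Y \<omega> = \<Phi> s \<omega>"
    using fundamental_sq_integrable[OF assms] by blast
  have "integrable M (\<lambda>\<omega>. transpose (Y \<omega>) ** Z ** Y \<omega>)"
    by (rule integrable_bilinear_sq_integrable[OF Y(1) Y(1) bounded_bilinear_congruence])
  then show ?thesis
    by (rule Bochner_Integration.integrable_cong[THEN iffD1, OF refl, rotated]) (simp add: Xi_def Y(2))
qed

text \<open>Each component is a second moment of \<open>\<Phi>\<close> for the form that takes the
  component along \<open>e\<close> of \<open>transpose X ** Z ** Y\<close>. The generator belonging
  to multiplication by \<open>A\<close> and \<open>Ec\<close> from the left reproduces this form
  with \<open>lyapunov A Ec Z\<close> in place of \<open>Z\<close>.\<close>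

lemma fundamental_moment_flow:
  fixes A Ec :: "real^'n^'n"
  assumes \<Phi>: "fundamental_solution M F W A Ec \<Phi>"
  shows "moment_flow (\<lambda>s Z. expectation (Xi \<Phi> Z s)) (lyapunov A Ec)"
proof (rule moment_flow.intro)
  note int = integrable_Xi[OF \<Phi>]
  show "linear (\<lambda>Z. expectation (Xi \<Phi> Z s))" if s: "0 \<le> s" for s
  proof (rule linearI)
    fix Z Z' :: "real^'n^'n" and r :: real
    have "Xi \<Phi> (Z + Z') s = (\<lambda>\<omega>. Xi \<Phi> Z s \<omega> + Xi \<Phi> Z' s \<omega>)" by (auto simp: Xi_def matrix_linear_simps)
    then show "expectation (Xi \<Phi> (Z + Z') s) = expectation (Xi \<Phi> Z s) + expectation (Xi \<Phi> Z' s)"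
      using int[OF s] by simp
    have "Xi \<Phi> (r *\<^sub>R Z) s = (\<lambda>\<omega>. r *\<^sub>R Xi \<Phi> Z s \<omega>)" by (auto simp: Xi_def matrix_linear_simps)
    then show "expectation (Xi \<Phi> (r *\<^sub>R Z) s) = r *\<^sub>R expectation (Xi \<Phi> Z s)" by simp
  qed
  show "linear (lyapunov A Ec)" by (rule linear_lyapunov)
  have "expectation (Xi \<Phi> Z 0) = expectation (\<lambda>_. Z)" for Z
    using \<Phi> by (intro Bochner_Integration.integral_cong) (auto simp: Xi_def fundamental_solution_def)
  then show "expectation (Xi \<Phi> Z 0) = Z" for Z by (simp add: prob_space)
  fix b s :: real and Z assume b: "0 < b" and s: "s \<in> {0..b}"
  interpret S: linear_sde M F W "\<lambda>X. A ** X" "\<lambda>X. Ec ** X" 0 b "\<lambda>_. mat 1" \<Phi>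
    by (rule fundamental_linear_sde[OF \<Phi> b])
  have comp: "((\<lambda>s. expectation (Xi \<Phi> Z s) \<bullet> e) has_real_derivative expectation (Xi \<Phi> (lyapunov A Ec Z) s) \<bullet> e) (at s within {0..b})" for e
  proof -
    define B where "B Z X Y = (transpose X ** Z ** Y) \<bullet> e" for Z X Y :: "real^'n^'n"
    have B: "bounded_bilinear (B Z)" for Z
      unfolding B_def[abs_def]
      by (rule bounded_bilinear_if_bilinear)
        (auto simp: bilinear_def matrix_linear_simps transpose_add transpose_scaleR inner_add_left intro!: linearI)
    have sm: "S.second_moment (B Z) s = expectation (Xi \<Phi> Z s) \<bullet> e" if "s \<in> {0..b}" for s Z
    proof -
      have "S.second_moment (B Z) s = expectation (\<lambda>\<omega>. Xi \<Phi> Z s \<omega> \<bullet> e)"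
        unfolding S.second_moment_def using \<Phi> that
        by (intro Bochner_Integration.integral_cong) (auto simp: B_def Xi_def S.Xe_def fundamental_solution_def)
      also have "\<dots> = expectation (Xi \<Phi> Z s) \<bullet> e" using that int by (intro integral_inner_left) auto
      finally show ?thesis .
    qed
    have "S.generator (B Z) = B (lyapunov A Ec Z)"
      by (intro ext) (simp add: S.generator_def B_def lyapunov_def matrix_transpose_mul matrix_linear_simps matrix_mul_assoc inner_add_left)
    with S.second_moment_derivative[OF B s, of Z] sm[OF s, of "lyapunov A Ec Z"]
    have "(S.second_moment (B Z) has_real_derivative expectation (Xi \<Phi> (lyapunov A Ec Z) s) \<bullet> e) (at s within {0..b})"
      by simp
    then show ?thesis
      by (rule has_field_derivative_transform_within[OF _ zero_less_one s]) (simp add: sm)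
  qed
  show "((\<lambda>s. expectation (Xi \<Phi> Z s)) has_vector_derivative expectation (Xi \<Phi> (lyapunov A Ec Z) s)) (at s within {0..b})"
    unfolding has_vector_derivative_def
  proof (subst has_derivative_componentwise_within, intro ballI)
    fix e :: "real^'n^'n"
    show "((\<lambda>s. expectation (Xi \<Phi> Z s) \<bullet> e) has_derivative (\<lambda>x. (x *\<^sub>R expectation (Xi \<Phi> (lyapunov A Ec Z) s)) \<bullet> e)) (at s within {0..b})"
      using comp[of e] unfolding has_field_derivative_def
      by (rule has_derivative_eq_rhs) (simp add: fun_eq_iff mult.commute)
  qed
qed

lemma quad_expectation_Xi:
  fixes A Ec :: "real^'n^'n"
  assumes \<Phi>: "fundamental_solution M F W A Ec \<Phi>" and s: "0 \<le> s"
  shows "quad (expectation (Xi \<Phi> Z s)) v = expectation (\<lambda>\<omega>. quad Z (\<Phi> s \<omega> *v v))"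
proof -
  have "bounded_linear (\<lambda>Z. quad Z v)"
    by (auto intro!: linear_conv_bounded_linear[THEN iffD1] linearI simp: quad_add quad_scaleR)
  from integral_bounded_linear[OF this integrable_Xi[OF assms], of Z]
  show ?thesis by (simp add: Xi_def quad_congruence)
qed

lemma transpose_expectation_Xi:
  fixes A Ec :: "real^'n^'n"
  assumes \<Phi>: "fundamental_solution M F W A Ec \<Phi>" and s: "0 \<le> s" and Z: "transpose Z = Z"
  shows "transpose (expectation (Xi \<Phi> Z s)) = expectation (Xi \<Phi> Z s)"
proof -
  have "bounded_linear (transpose :: real^'n^'n \<Rightarrow> real^'n^'n)"
    by (auto intro!: linear_conv_bounded_linear[THEN iffD1] linearI simp: transpose_add transpose_scaleR)
  from integral_bounded_linear[OF this integrable_Xi[OF assms(1,2)], of Z]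
  show ?thesis using Z by (simp add: Xi_def matrix_transpose_mul matrix_mul_assoc cong: Bochner_Integration.integral_cong)
qed

lemma expectation_jump:
  fixes A Ec :: "real^'n^'n"
  assumes \<Phi>: "fundamental_solution M F W A Ec \<Phi>" and s: "0 \<le> s"
  shows "expectation (\<lambda>\<omega>. transpose J ** Xi \<Phi> Z s \<omega> ** J + transpose Ed ** Xi \<Phi> Z s \<omega> ** Ed)
    = transpose J ** expectation (Xi \<Phi> Z s) ** J + transpose Ed ** expectation (Xi \<Phi> Z s) ** Ed"
proof (rule integral_bounded_linear[OF _ integrable_Xi[OF assms]])
  show "bounded_linear (\<lambda>Z. transpose J ** Z ** J + transpose Ed ** Z ** Ed)"
    by (auto intro!: linear_conv_bounded_linear[THEN iffD1] linearI simp: matrix_linear_simps scaleR_add_right)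
qed

end

section \<open>Impulses and stability\<close>

lemma loewner_less_0_iff: "X \<prec>\<^sub>L 0 \<longleftrightarrow> transpose X = X \<and> (\<forall>v. v \<noteq> 0 \<longrightarrow> quad X v < 0)"
proof -
  have "transpose (0 - X) = 0 - X \<longleftrightarrow> transpose X = X"
    unfolding transpose_diff by (simp add: transpose_def vec_eq_iff)
  moreover have "quad (0 - X) v = - quad X v" for v
    unfolding quad_diff by (simp add: quad_def)
  ultimately show ?thesis by (simp add: loewner_less_def pos_def_iff)
qed

lemma loewner_le_0_iff: "X \<preceq>\<^sub>L 0 \<longleftrightarrow> transpose X = X \<and> (\<forall>v. quad X v \<le> 0)"
proof -
  have "transpose (0 - X) = 0 - X \<longleftrightarrow> transpose X = X"
    unfolding transpose_diff by (simp add: transpose_def vec_eq_iff)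
  moreover have "quad (0 - X) v = - quad X v" for v
    unfolding quad_diff by (simp add: quad_def)
  ultimately show ?thesis by (simp add: loewner_le_def pos_semidef_iff)
qed

text \<open>The effect of an impulse on quadratic forms: zero mean of \<open>\<nu> k\<close> removes
  the mixed terms and unit variance leaves the form with \<open>Ed\<close> unweighted.\<close>

definition jump_map :: "real^'n^'n \<Rightarrow> real^'n^'n \<Rightarrow> real^'n^'n \<Rightarrow> real^'n^'n" where
  "jump_map J Ed Z = transpose J ** Z ** J + transpose Ed ** Z ** Ed"

lemma quad_jump_map: "quad (jump_map J Ed Z) v = quad Z (J *v v) + quad Z (Ed *v v)"
  by (simp add: jump_map_def quad_add quad_congruence)

lemma transpose_jump_map: "transpose Z = Z \<Longrightarrow> transpose (jump_map J Ed Z) = jump_map J Ed Z"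
  by (simp add: jump_map_def transpose_add matrix_transpose_mul matrix_mul_assoc)

lemma transpose_lyapunov: "transpose Z = Z \<Longrightarrow> transpose (lyapunov A Ec Z) = lyapunov A Ec Z"
  by (simp add: lyapunov_def transpose_add matrix_transpose_mul matrix_mul_assoc add.commute)

lemma bounded_bilinear_quad: "bounded_bilinear (\<lambda>x y :: real^'n. x \<bullet> (Z *v y))"
  by (rule bounded_bilinear_if_bilinear)
    (auto simp: bilinear_def inner_add matrix_vector_right_distrib matrix_vector_mult_scaleR intro!: linearI)

lemma integrable_quad: "sq_integrable M y \<Longrightarrow> integrable M (\<lambda>\<omega>. quad Z (y \<omega>))"
  unfolding quad_def by (rule integrable_bilinear_sq_integrable[OF _ _ bounded_bilinear_quad])

lemma sigma_sets_compose_subset: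
  assumes Z: "Z \<in> measurable M R" and h: "h \<in> measurable R N"
  shows "sigma_sets (space M) {(\<lambda>\<omega>. h (Z \<omega>)) -` B \<inter> space M |B. B \<in> sets N} \<subseteq> sets (vimage_algebra (space M) Z R)"
proof -
  have "(\<lambda>\<omega>. h (Z \<omega>)) \<in> measurable (vimage_algebra (space M) Z R) N"
    by (rule measurable_compose[OF measurable_vimage_algebra1 h]) (use measurable_space[OF Z] in auto)
  then have "{(\<lambda>\<omega>. h (Z \<omega>)) -` B \<inter> space M |B. B \<in> sets N} \<subseteq> sets (vimage_algebra (space M) Z R)"
    by (auto dest: measurable_sets)
  from sets.sigma_sets_subset[OF this] show ?thesis by simp
qed

lemma (in prob_space) indep_var_compose_independent_rvs:
  assumes ind: "independent_rvs M S X T Y" and h: "h \<in> measurable S N" and k: "k \<in> measurable T N"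
  shows "indep_var N (\<lambda>\<omega>. h (X \<omega>)) N (\<lambda>\<omega>. k (Y \<omega>))"
proof -
  have X: "X \<in> measurable M S" and Y: "Y \<in> measurable M T"
    and i: "indep_set (sets (vimage_algebra (space M) X S)) (sets (vimage_algebra (space M) Y T))"
    using ind by (auto simp: independent_rvs_def)
  note sub = sigma_sets_compose_subset
  have "random_variable N (\<lambda>\<omega>. h (X \<omega>))" "random_variable N (\<lambda>\<omega>. k (Y \<omega>))"
    using measurable_compose[OF X h] measurable_compose[OF Y k] by auto
  then show ?thesis
    unfolding indep_var_eq using indep_set_mono[OF i sub[OF X h] sub[OF Y k]] by blast
qed

lemma iid_standardized_moments:
  assumes "iid_standardized M \<nu>" "1 \<le> k"
  shows "integrable M (\<nu> k)" "integrable M (\<lambda>\<omega>. (\<nu> k \<omega>)\<^sup>2)"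
    "prob_space.expectation M (\<nu> k) = 0" "prob_space.expectation M (\<lambda>\<omega>. (\<nu> k \<omega>)\<^sup>2) = 1"
proof -
  have *: "integrable M (\<nu> k) \<and> integrable M (\<lambda>\<omega>. (\<nu> k \<omega>)\<^sup>2) \<and>
      prob_space.expectation M (\<nu> k) = 0 \<and> prob_space.variance M (\<nu> k) = 1"
    using assms unfolding iid_standardized_def by blast
  then show "integrable M (\<nu> k)" "integrable M (\<lambda>\<omega>. (\<nu> k \<omega>)\<^sup>2)" "prob_space.expectation M (\<nu> k) = 0" by auto
  with * show "prob_space.expectation M (\<lambda>\<omega>. (\<nu> k \<omega>)\<^sup>2) = 1" by simp
qed

text \<open>In the expansion of the form, the part linear in \<open>\<mu>\<close> has expectation 0
  and the quadratic part keeps its expectation, both by independence from \<open>y\<close>. Square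
  integrability after the jump is the same computation with \<open>Z = mat 1\<close>.\<close>

lemma (in prob_space) jump_moment:
  fixes y :: "'a \<Rightarrow> real^'n" and J Ed :: "real^'n^'n"
  assumes ind: "independent_rvs M borel \<mu> borel y"
    and \<mu>: "integrable M \<mu>" "integrable M (\<lambda>\<omega>. (\<mu> \<omega>)\<^sup>2)" "expectation \<mu> = 0" "expectation (\<lambda>\<omega>. (\<mu> \<omega>)\<^sup>2) = 1"
    and y: "sq_integrable M y"
  shows "sq_integrable M (\<lambda>\<omega>. J *v y \<omega> + \<mu> \<omega> *\<^sub>R (Ed *v y \<omega>))"
    and "expectation (\<lambda>\<omega>. quad Z (J *v y \<omega> + \<mu> \<omega> *\<^sub>R (Ed *v y \<omega>))) = expectation (\<lambda>\<omega>. quad (jump_map J Ed Z) (y \<omega>))"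
proof -
  have [measurable]: "\<mu> \<in> borel_measurable M" "y \<in> borel_measurable M"
    using ind by (auto simp: independent_rvs_def)
  define p where "p \<omega> = J *v y \<omega>" for \<omega>
  define q where "q \<omega> = Ed *v y \<omega>" for \<omega>
  have p: "sq_integrable M p" and q: "sq_integrable M q"
    unfolding p_def[abs_def] q_def[abs_def]
    by (rule sq_integrable_bounded_linear[OF y matrix_vector_mul_bounded_linear])+
  have expand: "quad Z (p \<omega> + \<mu> \<omega> *\<^sub>R q \<omega>) = quad Z (p \<omega>) + \<mu> \<omega> * (p \<omega> \<bullet> (Z *v q \<omega>) + q \<omega> \<bullet> (Z *v p \<omega>)) + (\<mu> \<omega>)\<^sup>2 * quad Z (q \<omega>)" for Z \<omega>
    by (simp add: quad_def matrix_vector_right_distrib matrix_vector_mult_scaleR inner_add power2_eq_square algebra_simps)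
  have cross: "integrable M (\<lambda>\<omega>. \<mu> \<omega> * (p \<omega> \<bullet> (Z *v q \<omega>) + q \<omega> \<bullet> (Z *v p \<omega>))) \<and>
      expectation (\<lambda>\<omega>. \<mu> \<omega> * (p \<omega> \<bullet> (Z *v q \<omega>) + q \<omega> \<bullet> (Z *v p \<omega>))) = 0" for Z
  proof -
    have "continuous_on UNIV (\<lambda>v. (J *v v) \<bullet> (Z *v (Ed *v v)) + (Ed *v v) \<bullet> (Z *v (J *v v)))"
      by (intro continuous_intros linear_continuous_on_compose[OF _ matrix_vector_mul_linear])
    then have m: "(\<lambda>v. (J *v v) \<bullet> (Z *v (Ed *v v)) + (Ed *v v) \<bullet> (Z *v (J *v v))) \<in> borel_measurable borel"
      by (rule borel_measurable_continuous_onI)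
    have iv': "indep_var borel \<mu> borel (\<lambda>\<omega>. p \<omega> \<bullet> (Z *v q \<omega>) + q \<omega> \<bullet> (Z *v p \<omega>))"
      using indep_var_compose_independent_rvs[OF ind measurable_ident m] by (simp add: p_def q_def)
    have "integrable M (\<lambda>\<omega>. p \<omega> \<bullet> (Z *v q \<omega>) + q \<omega> \<bullet> (Z *v p \<omega>))"
      by (intro Bochner_Integration.integrable_add integrable_bilinear_sq_integrable[OF _ _ bounded_bilinear_quad] p q)
    from indep_var_integrable[OF iv' \<mu>(1) this] indep_var_lebesgue_integral[OF iv' \<mu>(1) this] \<mu>(3)
    show ?thesis by simp
  qed
  have sq: "integrable M (\<lambda>\<omega>. (\<mu> \<omega>)\<^sup>2 * quad Z (q \<omega>)) \<and> expectation (\<lambda>\<omega>. (\<mu> \<omega>)\<^sup>2 * quad Z (q \<omega>)) = expectation (\<lambda>\<omega>. quad Z (q \<omega>))" for Z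
  proof -
    have "continuous_on UNIV (\<lambda>v. quad Z (Ed *v v))"
      unfolding quad_def by (intro continuous_intros linear_continuous_on_compose[OF _ matrix_vector_mul_linear])
    then have m: "(\<lambda>v. quad Z (Ed *v v)) \<in> borel_measurable borel"
      by (rule borel_measurable_continuous_onI)
    have m2: "(\<lambda>r::real. r\<^sup>2) \<in> borel_measurable borel" by measurable
    have iv': "indep_var borel (\<lambda>\<omega>. (\<mu> \<omega>)\<^sup>2) borel (\<lambda>\<omega>. quad Z (q \<omega>))"
      using indep_var_compose_independent_rvs[OF ind m2 m] by (simp add: q_def)
    from indep_var_integrable[OF iv' \<mu>(2) integrable_quad[OF q]] indep_var_lebesgue_integral[OF iv' \<mu>(2) integrable_quad[OF q]] \<mu>(4)
    show ?thesis by simp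
  qed
  have int: "integrable M (\<lambda>\<omega>. quad Z (p \<omega> + \<mu> \<omega> *\<^sub>R q \<omega>))" for Z
    unfolding expand using cross sq integrable_quad[OF p] by simp
  have [measurable]: "p \<in> borel_measurable M" "q \<in> borel_measurable M"
    using p q by (auto simp: sq_integrable_def)
  have "sq_integrable M (\<lambda>\<omega>. p \<omega> + \<mu> \<omega> *\<^sub>R q \<omega>)"
    unfolding sq_integrable_def using int[of "mat 1"] by (simp add: quad_mat_1)
  then show "sq_integrable M (\<lambda>\<omega>. J *v y \<omega> + \<mu> \<omega> *\<^sub>R (Ed *v y \<omega>))" by (simp add: p_def q_def)
  have "expectation (\<lambda>\<omega>. quad Z (p \<omega> + \<mu> \<omega> *\<^sub>R q \<omega>)) = expectation (\<lambda>\<omega>. quad Z (p \<omega>)) + expectation (\<lambda>\<omega>. quad Z (q \<omega>))"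
    unfolding expand using cross sq integrable_quad[OF p] by simp
  also have "\<dots> = expectation (\<lambda>\<omega>. quad (jump_map J Ed Z) (y \<omega>))"
    unfolding quad_jump_map p_def q_def using integrable_quad[OF p] integrable_quad[OF q]
    by (simp add: p_def q_def)
  finally show "expectation (\<lambda>\<omega>. quad Z (J *v y \<omega> + \<mu> \<omega> *\<^sub>R (Ed *v y \<omega>))) = expectation (\<lambda>\<omega>. quad (jump_map J Ed Z) (y \<omega>))"
    by (simp add: p_def q_def)
qed

section \<open>Moments along trajectories of the impulsive system\<close>

context wiener_basis
begin

text \<open>Duality: with the form transported backwards by \<open>N (s - r)\<close>, the moment
  \<open>\<kappa> r (N (s - r) Z)\<close> is constant in \<open>r\<close>. The forward derivative
  contributes \<open>\<kappa> r\<close> of \<open>L (N (s - r) Z)\<close>, the backward one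
  \<open>\<kappa> r\<close> of \<open>- N (s - r) (L Z)\<close>, and these cancel by commutation.
  The ends \<open>r = s\<close> and \<open>r = a\<close> are the two sides of the claim.\<close>

lemma sde_moment:
  fixes A Ec Z :: "real^'n^'n" and x :: "real \<Rightarrow> 'a \<Rightarrow> real^'n"
  assumes \<Phi>: "fundamental_solution M F W A Ec \<Phi>"
    and x: "linear_sde M F W ((*v) A) ((*v) Ec) a b \<xi> x" and s: "s \<in> {a<..b}"
  shows "sq_integrable M (x s)"
    and "expectation (\<lambda>\<omega>. quad Z (x s \<omega>)) = expectation (\<lambda>\<omega>. quad (expectation (Xi \<Phi> Z (s - a))) (\<xi> \<omega>))"
proof -
  interpret S: linear_sde M F W "(*v) A" "(*v) Ec" a b \<xi> x by (rule x)
  interpret N: moment_flow "\<lambda>s Z. expectation (Xi \<Phi> Z s)" "lyapunov A Ec"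
    by (rule fundamental_moment_flow[OF \<Phi>])
  let ?N = "\<lambda>s Z. expectation (Xi \<Phi> Z s)"
  show "sq_integrable M (x s)" using S.X_second_moment s by blast
  have Xe: "sq_integrable M (S.Xe r)" if "r \<in> {a..s}" for r
    using S.Xe_second_moment[of "sq_integrable M (S.Xe r)"] that s by auto
  define B :: "real^'n^'n \<Rightarrow> real^'n \<Rightarrow> real^'n \<Rightarrow> real" where "B Z x y = x \<bullet> (Z *v y)" for Z x y
  have B: "bounded_bilinear (B Z)" for Z unfolding B_def[abs_def] by (rule bounded_bilinear_quad)
  have gen: "S.generator (B Z) = B (lyapunov A Ec Z)" for Z
  proof (intro ext)
    fix x y
    have "(A *v x) \<bullet> (Z *v y) = x \<bullet> ((transpose A ** Z) *v y)"
      "x \<bullet> (Z *v (A *v y)) = x \<bullet> ((Z ** A) *v y)"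
      "(Ec *v x) \<bullet> (Z *v (Ec *v y)) = x \<bullet> ((transpose Ec ** Z ** Ec) *v y)"
      by (simp_all only: matrix_vector_mul_assoc[symmetric] inner_transpose)
    then show "S.generator (B Z) x y = B (lyapunov A Ec Z) x y"
      by (simp only: S.generator_def B_def lyapunov_def matrix_vector_mult_add_rdistrib inner_add_right)
  qed
  define \<kappa> where "\<kappa> r Z = S.second_moment (B Z) r" for r Z
  have \<kappa>: "\<kappa> r Z = expectation (\<lambda>\<omega>. quad Z (S.Xe r \<omega>))" for r Z
    by (simp add: \<kappa>_def S.second_moment_def B_def quad_def)
  have lin: "linear (\<kappa> r)" if r: "r \<in> {a..s}" for r
    by (rule linearI) (simp_all add: \<kappa> quad_add quad_scaleR integrable_quad[OF Xe[OF r]])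
  have as: "a < s" using s by simp
  have "((\<lambda>r. \<kappa> r (?N (s - r) Z)) has_real_derivative 0) (at r within {a..s})" if r: "r \<in> {a..s}" for r
  proof -
    have d: "((\<lambda>r. \<kappa> r Z) has_real_derivative \<kappa> r (lyapunov A Ec Z)) (at r within {a..s})" for Z
      using S.second_moment_derivative[OF B, of r Z] r s unfolding gen \<kappa>_def
      by (auto intro: has_field_derivative_subset)
    from linear_family_derivative[OF lin linear_lyapunov r d N.backward_derivative[OF as r, of Z]]
    have "((\<lambda>r. \<kappa> r (?N (s - r) Z)) has_real_derivative
        \<kappa> r (- ?N (s - r) (lyapunov A Ec Z)) + \<kappa> r (lyapunov A Ec (?N (s - r) Z))) (at r within {a..s})" .
    also have "\<kappa> r (- ?N (s - r) (lyapunov A Ec Z)) + \<kappa> r (lyapunov A Ec (?N (s - r) Z)) = 0"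
      using N.N_commutes[of "s - r" Z] linear_neg[OF lin[OF r]] r by simp
    finally show ?thesis .
  qed
  then obtain k where k: "\<And>r. r \<in> {a..s} \<Longrightarrow> \<kappa> r (?N (s - r) Z) = k"
    using has_field_derivative_zero_constant[of "{a..s}" "\<lambda>r. \<kappa> r (?N (s - r) Z)"] by auto
  have "\<kappa> s (?N 0 Z) = \<kappa> a (?N (s - a) Z)" using k[of s] k[of a] as by simp
  then show "expectation (\<lambda>\<omega>. quad Z (x s \<omega>)) = expectation (\<lambda>\<omega>. quad (?N (s - a) Z) (\<xi> \<omega>))"
    using as by (simp add: N.N_0 \<kappa> S.Xe_eq S.Xe_a)
qed

text \<open>The point is square integrability of the value after each impulse. It passes by
  induction through the interval, where second moments stay finite, and then through the
  jump.\<close>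

lemma impulsive_linear_sde:
  fixes A J Ec Ed :: "real^'n^'n"
  assumes sol: "impulsive_solution M F W \<nu> A J Ec Ed t x0 x"
    and iid: "iid_standardized M \<nu>"
    and t: "t 0 = 0" "\<And>k. t k < t (Suc k)"
  shows "linear_sde M F W ((*v) A) ((*v) Ec) (t k) (t (Suc k))
    (\<lambda>\<omega>. if k = 0 then x0 else J *v x (t k) \<omega> + \<nu> k \<omega> *\<^sub>R (Ed *v x (t k) \<omega>)) x"
proof -
  have tn: "0 \<le> t k" for k using t(1) lift_Suc_mono_le[of t 0 k] less_imp_le[OF t(2)] by simp
  have lin: "linear_sde M F W ((*v) A) ((*v) Ec) (t k) (t (Suc k))
      (\<lambda>\<omega>. if k = 0 then x0 else J *v x (t k) \<omega> + \<nu> k \<omega> *\<^sub>R (Ed *v x (t k) \<omega>)) x"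
    if "sq_integrable M (\<lambda>\<omega>. if k = 0 then x0 else J *v x (t k) \<omega> + \<nu> k \<omega> *\<^sub>R (Ed *v x (t k) \<omega>))" for k
    using that tn t(2) sol
    by (intro linear_sde.intro linear_sde_axioms.intro wiener_basis_axioms) (auto simp: impulsive_solution_def)
  show ?thesis
  proof (induction k)
    case 0
    show ?case by (rule lin) (simp add: sq_integrable_def)
  next
    case (Suc k)
    interpret S: linear_sde M F W "(*v) A" "(*v) Ec" "t k" "t (Suc k)"
      "\<lambda>\<omega>. if k = 0 then x0 else J *v x (t k) \<omega> + \<nu> k \<omega> *\<^sub>R (Ed *v x (t k) \<omega>)" x
      by (rule Suc)
    have y: "sq_integrable M (x (t (Suc k)))"
      using S.X_second_moment t(2)[of k] by (metis greaterThanAtMost_iff order_refl)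
    have "sq_integrable M (\<lambda>\<omega>. J *v x (t (Suc k)) \<omega> + \<nu> (Suc k) \<omega> *\<^sub>R (Ed *v x (t (Suc k)) \<omega>))"
      using sol by (intro jump_moment(1)[OF _ _ _ _ _ y] iid_standardized_moments[OF iid]) (auto simp: impulsive_solution_def)
    then show ?case by (intro lin) simp
  qed
qed

text \<open>\<open>jump\<close> compares the states just before successive impulses and yields a
  geometric rate. At intermediate times the time elapsed since the impulse may be shorter than
  \<open>Tbar\<close>; there \<open>flow\<close> still gives a bound by a fixed multiple of the last
  state before an impulse.\<close>

lemma ms_asymp_stable_if_contraction:
  fixes A J Ec Ed P :: "real^'n^'n"
  assumes \<Phi>: "fundamental_solution M F W A Ec \<Phi>" and iid: "iid_standardized M \<nu>"
    and P: "pos_def P" and Tbar: "0 < Tbar" and \<epsilon>: "0 < \<epsilon>"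
    and flow: "\<And>s v. 0 \<le> s \<Longrightarrow> quad (expectation (Xi \<Phi> P s)) v \<le> quad P v"
    and jump: "\<And>s v. Tbar \<le> s \<Longrightarrow> quad (jump_map J Ed (expectation (Xi \<Phi> P s))) v \<le> quad P v - \<epsilon> * (norm v)\<^sup>2"
    and t: "t 0 = 0" "\<And>k. t (Suc k) - t k \<ge> Tbar"
  shows "ms_asymp_stable M F W \<nu> A J Ec Ed t"
  unfolding ms_asymp_stable_def
proof (intro allI impI)
  fix x0 x assume sol: "impulsive_solution M F W \<nu> A J Ec Ed t x0 x"
  have t': "t k < t (Suc k)" for k using t(2)[of k] Tbar by linarith
  note sde = impulsive_linear_sde[OF sol iid t(1) t']
  have sq: "sq_integrable M (x s)" if "s \<in> {t k<..t (Suc k)}" for s k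
    by (rule sde_moment(1)[OF \<Phi> sde that])
  have sqt: "sq_integrable M (x (t (Suc k)))" for k using sq[of "t (Suc k)" k] t' by simp
  have \<nu>: "integrable M (\<nu> k)" "integrable M (\<lambda>\<omega>. (\<nu> k \<omega>)\<^sup>2)" "expectation (\<nu> k) = 0" "expectation (\<lambda>\<omega>. (\<nu> k \<omega>)\<^sup>2) = 1"
    if "1 \<le> k" for k
    using iid_standardized_moments[OF iid that] by auto
  have moment: "expectation (\<lambda>\<omega>. quad P (x s \<omega>))
      = expectation (\<lambda>\<omega>. quad (jump_map J Ed (expectation (Xi \<Phi> P (s - t (Suc k))))) (x (t (Suc k)) \<omega>))"
    if "s \<in> {t (Suc k)<..t (Suc (Suc k))}" for s k
  proof -
    have "independent_rvs M borel (\<nu> (Suc k)) borel (x (t (Suc k)))"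
      using sol by (simp add: impulsive_solution_def)
    from jump_moment(2)[OF this \<nu> sqt] sde_moment(2)[OF \<Phi> sde that, of P]
    show ?thesis by simp
  qed
  \<comment> \<open>The index starts at \<open>t (Suc 0)\<close>, because there is no jump at
    \<open>t 0\<close>.\<close>
  define m where "m k = expectation (\<lambda>\<omega>. quad P (x (t (Suc k)) \<omega>))" for k
  obtain \<mu> where \<mu>: "0 < \<mu>" "\<And>v. \<mu> * (norm v)\<^sup>2 \<le> quad P v" using quad_lower_bound[OF P] by blast
  obtain K where K: "0 < K" "\<And>v. quad P v \<le> K * (norm v)\<^sup>2" using quad_upper_bound by blast
  obtain K' where K': "0 < K'" "\<And>v. quad (jump_map J Ed P) v \<le> K' * (norm v)\<^sup>2" using quad_upper_bound by blast
  \<comment> \<open>As \<open>quad P v\<close> is at most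
    \<open>(K + \<epsilon>) * (norm v)\<^sup>2\<close>, the margin
    \<open>\<epsilon> * (norm v)\<^sup>2\<close> is at least
    \<open>\<epsilon> / (K + \<epsilon>)\<close> times \<open>quad P v\<close>. The added
    \<open>\<epsilon>\<close> keeps \<open>\<rho>\<close> positive.\<close>
  define \<rho> where "\<rho> = 1 - \<epsilon> / (K + \<epsilon>)"
  have \<rho>: "0 < \<rho>" "\<rho> < 1" using K(1) \<epsilon> by (auto simp: \<rho>_def divide_less_eq)
  have sq2: "integrable M (\<lambda>\<omega>. (norm (x (t (Suc k)) \<omega>))\<^sup>2)" for k
    using sqt[of k] by (simp add: sq_integrable_def)
  have contract: "m (Suc k) \<le> \<rho> * m k" for k
  proof -
    have pt: "quad (jump_map J Ed (expectation (Xi \<Phi> P (t (Suc (Suc k)) - t (Suc k))))) v \<le> \<rho> * quad P v" for v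
    proof -
      have "quad P v \<le> (K + \<epsilon>) * (norm v)\<^sup>2" using K(2)[of v] \<epsilon> by (simp add: distrib_right add_increasing2)
      then have "\<epsilon> / (K + \<epsilon>) * quad P v \<le> \<epsilon> / (K + \<epsilon>) * ((K + \<epsilon>) * (norm v)\<^sup>2)"
        using K(1) \<epsilon> by (intro mult_left_mono) auto
      also have "\<dots> = \<epsilon> * (norm v)\<^sup>2" using K(1) \<epsilon> by simp
      finally show ?thesis using jump[OF t(2)[of "Suc k"], of v] by (simp add: \<rho>_def left_diff_distrib)
    qed
    have "m (Suc k) = expectation (\<lambda>\<omega>. quad (jump_map J Ed (expectation (Xi \<Phi> P (t (Suc (Suc k)) - t (Suc k))))) (x (t (Suc k)) \<omega>))"
      unfolding m_def using t' by (intro moment) simp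
    also have "\<dots> \<le> expectation (\<lambda>\<omega>. \<rho> * quad P (x (t (Suc k)) \<omega>))"
      by (intro integral_mono integrable_quad integrable_mult_right sqt pt)
    finally show ?thesis by (simp add: m_def)
  qed
  have m: "m k \<le> \<rho> ^ k * m 0" for k
  proof (induction k)
    case (Suc k)
    have "m (Suc k) \<le> \<rho> * m k" by (rule contract)
    also have "\<dots> \<le> \<rho> * (\<rho> ^ k * m 0)" using \<rho> Suc by (intro mult_left_mono) auto
    finally show ?case by (simp add: mult.assoc)
  qed simp
  have m0: "0 \<le> m 0" unfolding m_def by (intro Bochner_Integration.integral_nonneg quad_pos_nonneg[OF P])
  define h where "h s = expectation (\<lambda>\<omega>. (norm (x s \<omega>))\<^sup>2)" for s
  \<comment> \<open>\<open>K'\<close> bounds the form right after the impulse. One division by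
    \<open>\<mu>\<close> passes from the norm of \<open>x s\<close> to \<open>P\<close>, the other
    from the norm before the impulse to \<open>m k\<close>.\<close>
  define C where "C = K' / \<mu> / \<mu> * m 0"
  have C: "0 \<le> C" using K' \<mu> m0 by (simp add: C_def)
  have h: "h s \<le> C * \<rho> ^ k" if s: "s \<in> {t (Suc k)<..t (Suc (Suc k))}" for s k
  proof -
    have norm_le: "expectation (\<lambda>\<omega>. (norm (y \<omega>))\<^sup>2) \<le> expectation (\<lambda>\<omega>. quad P (y \<omega>)) / \<mu>" if "sq_integrable M y" for y :: "'a \<Rightarrow> real^'n"
    proof -
      have "\<mu> * expectation (\<lambda>\<omega>. (norm (y \<omega>))\<^sup>2) = expectation (\<lambda>\<omega>. \<mu> * (norm (y \<omega>))\<^sup>2)" by simp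
      also have "\<dots> \<le> expectation (\<lambda>\<omega>. quad P (y \<omega>))"
        using that by (intro integral_mono integrable_quad \<mu>) (auto simp: sq_integrable_def)
      finally show ?thesis using \<mu>(1) by (simp add: pos_le_divide_eq mult.commute)
    qed
    have "quad (jump_map J Ed (expectation (Xi \<Phi> P (s - t (Suc k))))) v \<le> K' * (norm v)\<^sup>2" for v
    proof -
      have "quad (jump_map J Ed (expectation (Xi \<Phi> P (s - t (Suc k))))) v \<le> quad (jump_map J Ed P) v"
        unfolding quad_jump_map using s by (intro add_mono flow) auto
      then show ?thesis using K'(2)[of v] by linarith
    qed
    then have "expectation (\<lambda>\<omega>. quad P (x s \<omega>)) \<le> expectation (\<lambda>\<omega>. K' * (norm (x (t (Suc k)) \<omega>))\<^sup>2)"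
      unfolding moment[OF s] by (intro integral_mono integrable_quad integrable_mult_right sqt sq2)
    also have "\<dots> = K' * expectation (\<lambda>\<omega>. (norm (x (t (Suc k)) \<omega>))\<^sup>2)" by simp
    also have "\<dots> \<le> K' * (m k / \<mu>)"
      unfolding m_def using K'(1) by (intro mult_left_mono norm_le sqt) auto
    also have "\<dots> \<le> K' * (\<rho> ^ k * m 0 / \<mu>)"
      using K'(1) \<mu>(1) m by (intro mult_left_mono divide_right_mono) auto
    finally have "expectation (\<lambda>\<omega>. quad P (x s \<omega>)) / \<mu> \<le> K' * (\<rho> ^ k * m 0 / \<mu>) / \<mu>"
      using \<mu>(1) by (intro divide_right_mono) auto
    with norm_le[OF sq[OF s]] show ?thesis by (simp add: h_def C_def mult_ac)
  qed
  \<comment> \<open>The dwell time excludes accumulation of impulses: the instants grow at least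
    linearly, so every late time lies in some interval between them.\<close>
  have tlarge: "real n * Tbar \<le> t (k + n)" for n k
  proof (induction n)
    case 0
    show ?case using t(1) lift_Suc_mono_le[of t 0 k] less_imp_le[OF t'] by simp
  next
    case (Suc n)
    then show ?case using t(2)[of "k + n"] by (simp add: distrib_right)
  qed
  have locate: "\<exists>k\<ge>n. s \<in> {t (Suc k)<..t (Suc (Suc k))}" if s: "t (Suc n) < s" for s n
  proof -
    obtain j :: nat where "s / Tbar < real j" using reals_Archimedean2 by blast
    then have "s < real j * Tbar" using Tbar by (simp add: pos_divide_less_eq)
    also have "\<dots> \<le> t (Suc n + j)" by (rule tlarge)
    finally have "s \<le> t (Suc n + j)" by simp
    with partition_cell_exists[of "\<lambda>i. t (Suc n + i)" s j] s
    obtain i where "t (Suc n + i) < s" "s \<le> t (Suc n + Suc i)" by auto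
    then show ?thesis by (intro exI[of _ "n + i"]) auto
  qed
  have h0: "(h \<longlongrightarrow> 0) at_top"
  proof (rule tendstoI)
    fix e :: real assume e: "0 < e"
    have "(\<lambda>k. C * \<rho> ^ k) \<longlonglongrightarrow> C * 0"
      using \<rho> by (intro tendsto_mult tendsto_const LIMSEQ_power_zero) simp
    then have "eventually (\<lambda>k. C * \<rho> ^ k < e) sequentially"
      using e by (intro order_tendstoD(2)) auto
    then obtain n where n: "C * \<rho> ^ n < e" by (auto simp: eventually_sequentially)
    have "dist (h s) 0 < e" if s: "t (Suc n) < s" for s
    proof -
      obtain k where k: "n \<le> k" "s \<in> {t (Suc k)<..t (Suc (Suc k))}" using locate[OF s] by blast
      have "h s \<le> C * \<rho> ^ k" by (rule h[OF k(2)])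
      also have "\<dots> \<le> C * \<rho> ^ n" using C \<rho> k(1) by (intro mult_left_mono power_decreasing) auto
      finally show ?thesis using n by (simp add: h_def)
    qed
    then show "eventually (\<lambda>s. dist (h s) 0 < e) at_top" unfolding eventually_at_top_dense by blast
  qed
  \<comment> \<open>Stability is stated with a nonnegative integral, which agrees with the
    expectation \<open>h\<close> because the second moments are finite.\<close>
  have "eventually (\<lambda>s. ennreal (h s) = (\<integral>\<^sup>+\<omega>. ennreal ((norm (x s \<omega>))\<^sup>2) \<partial>M)) at_top"
    unfolding eventually_at_top_dense
  proof (intro exI allI impI)
    fix s assume "t (Suc 0) < s"
    then obtain k where "s \<in> {t (Suc k)<..t (Suc (Suc k))}" using locate by blast
    from nn_integral_sq_integrable[OF sq[OF this]] show "ennreal (h s) = (\<integral>\<^sup>+\<omega>. ennreal ((norm (x s \<omega>))\<^sup>2) \<partial>M)"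
      by (simp add: h_def)
  qed
  with tendsto_ennrealI[OF h0] show "((\<lambda>s. \<integral>\<^sup>+\<omega>. ennreal ((norm (x s \<omega>))\<^sup>2) \<partial>M) \<longlongrightarrow> 0) at_top"
    unfolding ennreal_0 by (rule Lim_transform_eventually)
qed

section \<open>Passage between the three conditions\<close>

lemma theta_condition_iff:
  fixes A J Ec Ed P :: "real^'n^'n"
  assumes \<Phi>: "fundamental_solution M F W A Ec \<Phi>" and P: "transpose P = P" and \<theta>: "0 \<le> \<theta>"
  shows "theta_condition M \<Phi> A J Ec Ed P \<theta> \<longleftrightarrow>
    (\<forall>v. v \<noteq> 0 \<longrightarrow> quad (jump_map J Ed (expectation (Xi \<Phi> P \<theta>))) v < quad P v) \<and>
    (\<forall>v. v \<noteq> 0 \<longrightarrow> quad (lyapunov A Ec P) v < 0)"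
proof -
  have "transpose (jump_map J Ed (expectation (Xi \<Phi> P \<theta>)) - P) = jump_map J Ed (expectation (Xi \<Phi> P \<theta>)) - P"
    by (simp add: transpose_diff P transpose_jump_map transpose_expectation_Xi[OF \<Phi> \<theta> P])
  then show ?thesis
    unfolding theta_condition_def expectation_jump[OF \<Phi> \<theta>]
    unfolding jump_map_def[symmetric] lyapunov_def[symmetric]
    by (simp add: loewner_less_0_iff transpose_lyapunov P quad_diff)
qed

text \<open>The derivative of the form is that of \<open>N u (L P)\<close>, which is the expectation
  of the nonpositive form \<open>L P\<close> at the random vector
  \<open>\<Phi> u \<omega> *v v\<close>.\<close>

lemma flow_antimono:
  fixes A Ec P :: "real^'n^'n"
  assumes \<Phi>: "fundamental_solution M F W A Ec \<Phi>" and L: "\<And>v. quad (lyapunov A Ec P) v \<le> 0"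
    and s: "0 \<le> r" "r \<le> s"
  shows "quad (expectation (Xi \<Phi> P s)) v \<le> quad (expectation (Xi \<Phi> P r)) v"
proof (cases "s = r")
  case False
  interpret N: moment_flow "\<lambda>s Z. expectation (Xi \<Phi> Z s)" "lyapunov A Ec"
    by (rule fundamental_moment_flow[OF \<Phi>])
  have bl: "bounded_linear (\<lambda>Z. quad Z v)"
    by (auto intro!: linear_conv_bounded_linear[THEN iffD1] linearI simp: quad_add quad_scaleR)
  show ?thesis
  proof (rule nonincreasing_if_derivative_nonpos[OF s(2)])
    fix u assume u: "u \<in> {r..s}"
    have "((\<lambda>s. expectation (Xi \<Phi> P s)) has_vector_derivative expectation (Xi \<Phi> (lyapunov A Ec P) u)) (at u within {r..s})"
      using u s False by (intro has_vector_derivative_within_subset[OF N.N_derivative[of s]]) auto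
    from bounded_linear.has_vector_derivative[OF bl this]
    show "((\<lambda>s. quad (expectation (Xi \<Phi> P s)) v) has_real_derivative quad (expectation (Xi \<Phi> (lyapunov A Ec P) u)) v) (at u within {r..s})"
      by (simp add: has_real_derivative_iff_has_vector_derivative)
    have "0 \<le> expectation (\<lambda>\<omega>. - quad (lyapunov A Ec P) (\<Phi> u \<omega> *v v))"
      using L by (intro Bochner_Integration.integral_nonneg) simp
    then show "quad (expectation (Xi \<Phi> (lyapunov A Ec P) u)) v \<le> 0"
      using quad_expectation_Xi[OF \<Phi>, of u] u s by simp
  qed
qed simp

lemma clock_condition_if_theta_condition:
  fixes A J Ec Ed P :: "real^'n^'n"
  assumes \<Phi>: "fundamental_solution M F W A Ec \<Phi>" and Tbar: "0 < Tbar" and P: "pos_def P"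
    and \<theta>: "theta_condition M \<Phi> A J Ec Ed P Tbar"
  shows "\<exists>S \<epsilon>. (\<forall>\<tau>\<ge>0. transpose (S \<tau>) = S \<tau>) \<and> pos_def (S Tbar) \<and>
    (\<forall>s\<ge>0. S (Tbar + s) = S Tbar) \<and> \<epsilon> > 0 \<and> clock_condition A J Ec Ed Tbar S \<epsilon>"
proof -
  interpret N: moment_flow "\<lambda>s Z. expectation (Xi \<Phi> Z s)" "lyapunov A Ec"
    by (rule fundamental_moment_flow[OF \<Phi>])
  let ?N = "\<lambda>s Z. expectation (Xi \<Phi> Z s)"
  have sym: "transpose P = P" using P by (simp add: pos_def_iff)
  have c: "\<And>v. v \<noteq> 0 \<Longrightarrow> quad (jump_map J Ed (?N Tbar P)) v < quad P v" "\<And>v. v \<noteq> 0 \<Longrightarrow> quad (lyapunov A Ec P) v < 0"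
    using \<theta> theta_condition_iff[OF \<Phi> sym, of Tbar] Tbar by auto
  define S where "S \<tau> = (if \<tau> \<le> Tbar then ?N (Tbar - \<tau>) P else P)" for \<tau>
  have ST: "S Tbar = P" and S0: "S 0 = ?N Tbar P" using Tbar by (simp_all add: S_def N.N_0)
  have Nsym: "transpose (?N s P) = ?N s P" if "0 \<le> s" for s
    by (rule transpose_expectation_Xi[OF \<Phi> that sym])
  have "pos_def (P - jump_map J Ed (?N Tbar P))"
    using c(1) Tbar by (simp add: pos_def_iff transpose_diff sym transpose_jump_map Nsym quad_diff)
  \<comment> \<open>The strict jump inequality has a margin, by compactness of the unit sphere; this
    margin is the \<epsilon> of the clock condition.\<close>
  then obtain \<epsilon> where \<epsilon>: "0 < \<epsilon>" "\<And>v. \<epsilon> * (norm v)\<^sup>2 \<le> quad (P - jump_map J Ed (?N Tbar P)) v"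
    using quad_lower_bound by blast
  have "clock_condition A J Ec Ed Tbar S \<epsilon>"
    unfolding clock_condition_def
  proof (intro conjI exI[of _ "\<lambda>\<tau>. - ?N (Tbar - \<tau>) (lyapunov A Ec P)"] ballI)
    show "transpose A ** S Tbar + S Tbar ** A + transpose Ec ** S Tbar ** Ec \<prec>\<^sub>L 0"
      unfolding ST lyapunov_def[symmetric] loewner_less_0_iff using c(2) by (simp add: transpose_lyapunov sym)
    fix \<tau> assume \<tau>: "\<tau> \<in> {0..Tbar}"
    \<comment> \<open>The derivative is taken within the interval that ends at \<open>Tbar\<close>,
      so the constant continuation of \<open>S\<close> beyond it, which may produce a kink, does not
      interfere.\<close>
    show "(S has_vector_derivative - ?N (Tbar - \<tau>) (lyapunov A Ec P)) (at \<tau> within {0..Tbar})"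
      by (rule has_vector_derivative_transform[OF \<tau> _ N.backward_derivative[OF Tbar \<tau>]]) (simp add: S_def)
    have "- ?N (Tbar - \<tau>) (lyapunov A Ec P) + transpose A ** S \<tau> + S \<tau> ** A + transpose Ec ** S \<tau> ** Ec
        = lyapunov A Ec (S \<tau>) - ?N (Tbar - \<tau>) (lyapunov A Ec P)"
      by (simp add: lyapunov_def)
    \<comment> \<open>By commutation the differential inequality of the clock condition holds with
      equality.\<close>
    also have "\<dots> = 0" using \<tau> by (simp add: S_def N.N_commutes)
    finally have zero: "- ?N (Tbar - \<tau>) (lyapunov A Ec P) + transpose A ** S \<tau> + S \<tau> ** A + transpose Ec ** S \<tau> ** Ec = 0" .
    show "- ?N (Tbar - \<tau>) (lyapunov A Ec P) + transpose A ** S \<tau> + S \<tau> ** A + transpose Ec ** S \<tau> ** Ec \<preceq>\<^sub>L 0"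
      unfolding zero by (simp add: loewner_le_0_iff transpose_def vec_eq_iff quad_zero)
    have e: "transpose J ** S 0 ** J - S Tbar + transpose Ed ** S 0 ** Ed + \<epsilon> *\<^sub>R mat 1
        = (jump_map J Ed (?N Tbar P) - P) + \<epsilon> *\<^sub>R mat 1"
      by (simp add: S0 ST jump_map_def)
    show "transpose J ** S 0 ** J - S Tbar + transpose Ed ** S 0 ** Ed + \<epsilon> *\<^sub>R mat 1 \<preceq>\<^sub>L 0"
      unfolding e loewner_le_0_iff using \<epsilon>(2) Tbar
      by (auto simp: transpose_add transpose_diff transpose_scaleR transpose_jump_map Nsym sym quad_add quad_diff quad_scaleR quad_mat_1 algebra_simps)
  qed
  moreover have "\<forall>\<tau>\<ge>0. transpose (S \<tau>) = S \<tau>" using Nsym sym by (simp add: S_def)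
  moreover have "\<forall>s\<ge>0. S (Tbar + s) = S Tbar" by (auto simp: S_def N.N_0)
  ultimately show ?thesis using \<epsilon>(1) P ST by (intro exI[of _ S] exI[of _ \<epsilon>]) simp
qed

text \<open>Along \<open>N s (S s)\<close> the derivative is \<open>N s\<close> applied to
  \<open>S' s + L (S s)\<close>, hence nonpositive as a form. Comparing the two ends gives
  \<open>N Tbar (S Tbar)\<close> below \<open>S 0\<close>. The jump map preserves this order, and
  \<epsilon> makes the resulting jump inequality strict.\<close>

lemma theta_condition_if_clock_condition:
  fixes A J Ec Ed :: "real^'n^'n"
  assumes \<Phi>: "fundamental_solution M F W A Ec \<Phi>" and Tbar: "0 < Tbar" and P: "pos_def (S Tbar)"
    and \<epsilon>: "0 < \<epsilon>" and clock: "clock_condition A J Ec Ed Tbar S \<epsilon>"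
  shows "theta_condition M \<Phi> A J Ec Ed (S Tbar) Tbar"
proof -
  interpret N: moment_flow "\<lambda>s Z. expectation (Xi \<Phi> Z s)" "lyapunov A Ec"
    by (rule fundamental_moment_flow[OF \<Phi>])
  let ?N = "\<lambda>s Z. expectation (Xi \<Phi> Z s)"
  have sym: "transpose (S Tbar) = S Tbar" using P by (simp add: pos_def_iff)
  obtain S' where S': "\<And>\<tau>. \<tau> \<in> {0..Tbar} \<Longrightarrow> (S has_vector_derivative S' \<tau>) (at \<tau> within {0..Tbar})"
    and le: "\<And>\<tau> v. \<tau> \<in> {0..Tbar} \<Longrightarrow> quad (S' \<tau> + transpose A ** S \<tau> + S \<tau> ** A + transpose Ec ** S \<tau> ** Ec) v \<le> 0"
    and jump: "\<And>\<tau> v. \<tau> \<in> {0..Tbar} \<Longrightarrow> quad (transpose J ** S 0 ** J - S Tbar + transpose Ed ** S 0 ** Ed + \<epsilon> *\<^sub>R mat 1) v \<le> 0"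
    and lyap: "\<And>v. v \<noteq> 0 \<Longrightarrow> quad (lyapunov A Ec (S Tbar)) v < 0"
    using clock unfolding clock_condition_def loewner_le_0_iff loewner_less_0_iff lyapunov_def[symmetric] by blast
  have flow: "quad (?N Tbar (S Tbar)) v \<le> quad (S 0) v" for v
  proof -
    have bl: "bounded_linear (\<lambda>Z. quad Z v)"
      by (auto intro!: linear_conv_bounded_linear[THEN iffD1] linearI simp: quad_add quad_scaleR)
    have lin: "linear (\<lambda>Z. quad (?N s Z) v)" if "s \<in> {0..Tbar}" for s
      using linear_compose[OF N.linear_N bounded_linear.linear[OF bl]] that by (simp add: o_def)
    have "quad (?N Tbar (S Tbar)) v \<le> quad (?N 0 (S 0)) v"
    proof (rule nonincreasing_if_derivative_nonpos[where h = "\<lambda>s. quad (?N s (S s)) v", OF less_imp_le[OF Tbar]])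
      fix s assume s: "s \<in> {0..Tbar}"
      have d: "((\<lambda>s. quad (?N s Z) v) has_real_derivative quad (?N s (lyapunov A Ec Z)) v) (at s within {0..Tbar})" for Z
        using bounded_linear.has_vector_derivative[OF bl N.N_derivative[OF Tbar s]]
        by (simp add: has_real_derivative_iff_has_vector_derivative)
      show "((\<lambda>s. quad (?N s (S s)) v) has_real_derivative
          quad (?N s (S' s)) v + quad (?N s (lyapunov A Ec (S s))) v) (at s within {0..Tbar})"
        by (rule linear_family_derivative[OF lin linear_lyapunov s d S'[OF s]])
      have "quad (?N s (S' s)) v + quad (?N s (lyapunov A Ec (S s))) v = quad (?N s (S' s + lyapunov A Ec (S s))) v"
        using linear_add[OF lin[OF s], of "S' s"] by simp
      also have "\<dots> = - expectation (\<lambda>\<omega>. - quad (S' s + lyapunov A Ec (S s)) (\<Phi> s \<omega> *v v))"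
        using quad_expectation_Xi[OF \<Phi>, of s] s by simp
      also have "\<dots> \<le> 0"
      proof -
        have "0 \<le> expectation (\<lambda>\<omega>. - quad (S' s + lyapunov A Ec (S s)) (\<Phi> s \<omega> *v v))"
          using le[OF s] by (intro Bochner_Integration.integral_nonneg) (simp add: lyapunov_def add.assoc)
        then show ?thesis by simp
      qed
      finally show "quad (?N s (S' s)) v + quad (?N s (lyapunov A Ec (S s))) v \<le> 0" .
    qed
    then show ?thesis by (simp add: N.N_0)
  qed
  have "quad (jump_map J Ed (?N Tbar (S Tbar))) v < quad (S Tbar) v" if v: "v \<noteq> 0" for v
  proof -
    have "quad (jump_map J Ed (?N Tbar (S Tbar))) v \<le> quad (jump_map J Ed (S 0)) v"
      unfolding quad_jump_map by (intro add_mono flow)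
    moreover have "quad (jump_map J Ed (S 0)) v - quad (S Tbar) v + \<epsilon> * (norm v)\<^sup>2 \<le> 0"
      using jump[of 0 v] Tbar by (simp add: jump_map_def quad_add quad_diff quad_scaleR quad_mat_1)
    moreover have "0 < \<epsilon> * (norm v)\<^sup>2" using \<epsilon> v by simp
    ultimately show ?thesis by linarith
  qed
  then show ?thesis using theta_condition_iff[OF \<Phi> sym] lyap Tbar by simp
qed

end

section \<open>Equivalence of the conditions and mean-square stability\<close>

theorem theorem7:
  fixes A J Ec Ed :: "real^'n^'n" and Tbar :: real
    and M :: "'a measure" and F :: "real \<Rightarrow> 'a measure"
    and W :: "real \<Rightarrow> 'a \<Rightarrow> real" and \<nu> :: "nat \<Rightarrow> 'a \<Rightarrow> real"
    and \<Phi> :: "real \<Rightarrow> 'a \<Rightarrow> real^'n^'n"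
  assumes "Tbar > 0"
    and "prob_space M"
    and "filtration (space M) F" and "\<And>s. subalgebra M (F s)"
    and "wiener_process M F W"
    and "iid_standardized M \<nu>"
    and "independent_processes M \<nu> W"
    and "fundamental_solution M F W A Ec \<Phi>"
  shows
    "((\<exists>P. pos_def P \<and> (\<forall>\<theta>\<ge>Tbar. theta_condition M \<Phi> A J Ec Ed P \<theta>)) \<longleftrightarrow>
      (\<exists>P. pos_def P \<and> theta_condition M \<Phi> A J Ec Ed P Tbar)) \<and>
     ((\<exists>P. pos_def P \<and> theta_condition M \<Phi> A J Ec Ed P Tbar) \<longleftrightarrow>
      (\<exists>S \<epsilon>. (\<forall>\<tau>\<ge>0. transpose (S \<tau>) = S \<tau>) \<and> pos_def (S Tbar) \<and>
        (\<forall>s\<ge>0. S (Tbar + s) = S Tbar) \<and> \<epsilon> > 0 \<and> clock_condition A J Ec Ed Tbar S \<epsilon>)) \<and>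
     ((\<exists>P. pos_def P \<and> (\<forall>\<theta>\<ge>Tbar. theta_condition M \<Phi> A J Ec Ed P \<theta>)) \<or>
      (\<exists>P. pos_def P \<and> theta_condition M \<Phi> A J Ec Ed P Tbar) \<or>
      (\<exists>S \<epsilon>. (\<forall>\<tau>\<ge>0. transpose (S \<tau>) = S \<tau>) \<and> pos_def (S Tbar) \<and>
        (\<forall>s\<ge>0. S (Tbar + s) = S Tbar) \<and> \<epsilon> > 0 \<and> clock_condition A J Ec Ed Tbar S \<epsilon>) \<longrightarrow>
      (\<forall>t. t 0 = 0 \<and> (\<forall>k. t (Suc k) - t k \<ge> Tbar) \<longrightarrow>
        ms_asymp_stable M F W \<nu> A J Ec Ed t))"
    (is "(?i \<longleftrightarrow> ?ii) \<and> (_ \<longleftrightarrow> ?iii) \<and> (_ \<longrightarrow> ?stable)")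
proof -
  interpret wiener_basis M F W
    using assms(2-5) by (intro wiener_basis.intro wiener_basis_axioms.intro)
  note \<Phi> = assms(8)
  interpret N: moment_flow "\<lambda>s Z. expectation (Xi \<Phi> Z s)" "lyapunov A Ec"
    by (rule fundamental_moment_flow[OF \<Phi>])
  \<comment> \<open>Monotone from time 0 on and not just beyond \<open>Tbar\<close>: with
    \<open>r = 0\<close> it also controls the state shortly after an impulse.\<close>
  have decay: "quad (expectation (Xi \<Phi> P s)) v \<le> quad (expectation (Xi \<Phi> P r)) v"
    if "pos_def P" "theta_condition M \<Phi> A J Ec Ed P Tbar" "0 \<le> r" "r \<le> s" for P r s v
  proof (rule flow_antimono[OF \<Phi> _ that(3,4)])
    fix v
    have "transpose P = P" using that(1) by (simp add: pos_def_iff)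
    then show "quad (lyapunov A Ec P) v \<le> 0"
      using that(2) theta_condition_iff[OF \<Phi>, of P Tbar] assms(1) by (cases "v = 0") (auto simp: quad_def less_imp_le)
  qed
  have "?ii \<Longrightarrow> ?i"
  proof (elim exE conjE)
    fix P assume P: "pos_def P" "theta_condition M \<Phi> A J Ec Ed P Tbar"
    have sym: "transpose P = P" using P(1) by (simp add: pos_def_iff)
    have "theta_condition M \<Phi> A J Ec Ed P \<theta>" if \<theta>: "Tbar \<le> \<theta>" for \<theta>
    proof -
      have "quad (jump_map J Ed (expectation (Xi \<Phi> P \<theta>))) v \<le> quad (jump_map J Ed (expectation (Xi \<Phi> P Tbar))) v" for v
        unfolding quad_jump_map using \<theta> assms(1) by (intro add_mono decay[OF P]) auto
      note le = this
      have c: "\<And>v. v \<noteq> 0 \<Longrightarrow> quad (jump_map J Ed (expectation (Xi \<Phi> P Tbar))) v < quad P v"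
        "\<And>v. v \<noteq> 0 \<Longrightarrow> quad (lyapunov A Ec P) v < 0"
        using P(2) theta_condition_iff[OF \<Phi> sym, of Tbar] assms(1) by auto
      have "quad (jump_map J Ed (expectation (Xi \<Phi> P \<theta>))) v < quad P v" if "v \<noteq> 0" for v
        by (rule le_less_trans[OF le c(1)[OF that]])
      with c(2) show ?thesis
        using theta_condition_iff[OF \<Phi> sym, of \<theta>] \<theta> assms(1) by simp
    qed
    then show ?i using P(1) by blast
  qed
  moreover have "?i \<Longrightarrow> ?ii" by blast
  moreover have "?ii \<Longrightarrow> ?iii"
    using clock_condition_if_theta_condition[OF \<Phi> assms(1)] by blast
  moreover have "?iii \<Longrightarrow> ?ii"
    using theta_condition_if_clock_condition[OF \<Phi> assms(1)] by blast
  \<comment> \<open>Each of the three statements leads to the second one, so stability is derived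
    from it alone.\<close>
  moreover have "?ii \<Longrightarrow> ?stable"
  proof (elim exE conjE, intro allI impI, elim conjE)
    fix P t assume P: "pos_def P" "theta_condition M \<Phi> A J Ec Ed P Tbar"
      and t: "t 0 = (0::real)" "\<forall>k. t (Suc k) - t k \<ge> Tbar"
    have sym: "transpose P = P" using P(1) by (simp add: pos_def_iff)
    have "pos_def (P - jump_map J Ed (expectation (Xi \<Phi> P Tbar)))"
      using P theta_condition_iff[OF \<Phi> sym, of Tbar] assms(1)
      by (simp add: pos_def_iff transpose_diff transpose_jump_map transpose_expectation_Xi[OF \<Phi> _ sym] quad_diff)
    then obtain \<epsilon> where \<epsilon>: "0 < \<epsilon>" "\<And>v. \<epsilon> * (norm v)\<^sup>2 \<le> quad (P - jump_map J Ed (expectation (Xi \<Phi> P Tbar))) v"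
      using quad_lower_bound by blast
    show "ms_asymp_stable M F W \<nu> A J Ec Ed t"
    proof (rule ms_asymp_stable_if_contraction[OF \<Phi> assms(6) P(1) assms(1) \<epsilon>(1)])
      show "quad (expectation (Xi \<Phi> P s)) v \<le> quad P v" if "0 \<le> s" for s v
        using decay[OF P order_refl that, of v] by (simp add: N.N_0)
      \<comment> \<open>The margin found at \<open>Tbar\<close> serves all longer elapsed times,
        because \<open>decay\<close> only lowers the left side.\<close>
      show "quad (jump_map J Ed (expectation (Xi \<Phi> P s))) v \<le> quad P v - \<epsilon> * (norm v)\<^sup>2" if "Tbar \<le> s" for s v
      proof -
        have "quad (jump_map J Ed (expectation (Xi \<Phi> P s))) v \<le> quad (jump_map J Ed (expectation (Xi \<Phi> P Tbar))) v"
          unfolding quad_jump_map using that assms(1) by (intro add_mono decay[OF P]) auto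
        then show ?thesis using \<epsilon>(2)[of v] by (simp add: quad_diff)
      qed
    qed (use t in auto)
  qed
  ultimately show ?thesis by blast
qed

end
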